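(* The structure of the $A_n$-module $T^1_{A_n}$ is as follows. (i) Let $a,b\subseteq V(\mathcal{A}_n)$. If $a\in\mathcal{A}_n$, $b\subseteq V(\operatorname{lk}(a,\mathcal{A}_n))$ and $b$ consists of two crossing diagonals with $Q_b\in\mathcal{P}_a$, then $\dim_{\mathbb{C}}T^1_{a-b}(\mathcal{A}_n)=1$; otherwise $T^1_{a-b}(\mathcal{A}_n)=0$. (ii) There is a one-to-one correspondence between inscribed quadrangles in the $n$-gon and a minimal set of generators for the $A_n$-module $T^1_{A_n}$.
   Context: $\mathcal{A}_n$: label the vertices of a convex $n$-gon cyclically by $1,\dots,n$ and let $\delta_{ij}$ be the diagonal joining $i$ and $j$. The vertex set $V(\mathcal{A}_n)$ is the set of $\tfrac12 n(n-3)$ diagonals, and a set of diagonals is a face iff no two of them cross. $A_n=\mathbb{C}[x_{ij}]/\langle x_{ik}x_{jl}: 1\le i<j<k<l\le n\rangle$ (one variable per diagonal) is its Stanley--Reisner ring. $\operatorname{lk}(a,\mathcal{K})=\{g\in\mathcal{K}: g\cap a=\emptyset,\ g\cup a\in\mathcal{K}\}$. An inscribed quadrangle is a quadrangle $Q_{ijkl}$ whose vertices are four vertices $i<j<k<l$ of the $n$-gon. If $b=\{\delta_{ik},\delta_{jl}\}$ consists of two crossing diagonals, $i<j<k<l$, then $Q_b=Q_{ijkl}$. For a face $a\in\mathcal{A}_n$, $\mathcal{P}_a$ is the set of polygons in the partition of the $n$-gon cut out by the diagonals in $a$ (for $a=\emptyset$ it is the $n$-gon itself). For a $\mathbb{C}$-algebra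 $A$, $T^i_A$ is the cotangent (André--Quillen) cohomology $T^i(A/\mathbb{C};A)$. For a Stanley--Reisner ring $A_{\mathcal{K}}$, $T^i_{A_{\mathcal{K}}}$ ($i=1,2$) is $\mathbb{Z}^{V(\mathcal{K})}$-graded. Write a degree as $\mathbf{a}-\mathbf{b}$ with $\mathbf{a},\mathbf{b}\in\mathbb{Z}_{\ge0}^{V(\mathcal{K})}$ having disjoint supports $a$ and $b$. It is a known fact (Altmann--Christophersen) that the piece of degree $\mathbf{a}-\mathbf{b}$ vanishes unless $a\in\mathcal{K}$, $\mathbf{b}\in\{0,1\}^{V(\mathcal{K})}$, $b\subseteq V(\operatorname{lk}(a,\mathcal{K}))$ and $b\ne\emptyset$, and that for $\mathbf{b}\in\{0,1\}^{V(\mathcal{K})}$ it depends only on the supports $a,b$; it is denoted $T^i_{a-b}(\mathcal{K})$. *)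

theory Defs
  imports
    "HOL-Algebra.QuotRing"
    "HOL-Library.Poly_Mapping"
    "Jordan_Normal_Form.VS_Connect"
begin

section \<open>Linear algebra over a carrier-based ring\<close>

definition has_dim :: "('k, 'm) ring_scheme \<Rightarrow> ('k, 'b, 'n) module_scheme \<Rightarrow> nat \<Rightarrow> bool" where
  "has_dim K V d \<longleftrightarrow>
     vectorspace K V \<and> vectorspace.fin_dim K V \<and> vectorspace.dim K V = d"

definition minimal_generating_set :: "('a, 'm) ring_scheme \<Rightarrow> ('a, 'b, 'n) module_scheme \<Rightarrow> 'b set \<Rightarrow> bool" where
  "minimal_generating_set R M G \<longleftrightarrow>
     module R M \<and> G \<subseteq> carrier M \<and> module.gen_set R M G \<and>
     (\<forall>H. H \<subset> G \<longrightarrow> \<not> module.gen_set R M H)"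

text \<open>Same style as \<^const>\<open>FactRing\<close>; the fields \<open>mult\<close> and \<open>one\<close> of a module record carry no information.\<close>

definition quotient_module :: "('a, 'b, 'm) module_scheme \<Rightarrow> 'b set \<Rightarrow> ('a, 'b set) module" where
  "quotient_module M N =
    \<lparr>carrier = a_rcosets\<^bsub>M\<^esub> N, mult = undefined, one = undefined, zero = N, add = set_add M,
     smult = (\<lambda>r C. \<Union>x\<in>C. N +>\<^bsub>M\<^esub> (r \<odot>\<^bsub>M\<^esub> x))\<rparr>"


section \<open>First cotangent cohomology\<close>

text \<open>
  Let \<open>A = P/I\<close> with \<open>P\<close> a polynomial ring over the field \<open>k\<close> (\<open>k\<close> is given as a subset of \<open>P\<close>).
  The truncated cotangent complex of \<open>A\<close> over \<open>k\<close> is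
  \<open>Rel/Rel\<^sub>0 \<rightarrow> F \<otimes> A \<rightarrow> \<Omega>\<^bsub>P/k\<^esub> \<otimes> A\<close>, where \<open>F \<rightarrow> I\<close> is a free \<open>P\<close>-module mapping onto \<open>I\<close>,
  \<open>Rel\<close> is the kernel and \<open>Rel\<^sub>0\<close> the Koszul relations.  Applying \<open>Hom\<^sub>A(-, A)\<close>, the 1-cocycles are
  the homomorphisms \<open>F \<rightarrow> A\<close> that vanish on \<open>Rel\<close>, i.e. \<open>Hom\<^sub>P(I, A)\<close>, and the 0-cochains are
  \<open>Der\<^sub>k(P, A)\<close>, with coboundary the restriction to \<open>I\<close>.  So
  \<open>T\<^sup>1(A/k; A) = coker (Der\<^sub>k(P, A) \<rightarrow> Hom\<^sub>P(I, A))\<close>.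
\<close>

definition Hom_ideal :: "('a, 'm) ring_scheme \<Rightarrow> 'a set \<Rightarrow> ('a set, 'a \<Rightarrow> 'a set) module" where
  "Hom_ideal P I =
    \<lparr>carrier = {\<phi> \<in> I \<rightarrow>\<^sub>E carrier (P Quot I).
        (\<forall>f\<in>I. \<forall>g\<in>I. \<phi> (f \<oplus>\<^bsub>P\<^esub> g) = \<phi> f \<oplus>\<^bsub>P Quot I\<^esub> \<phi> g) \<and>
        (\<forall>p\<in>carrier P. \<forall>f\<in>I. \<phi> (p \<otimes>\<^bsub>P\<^esub> f) = (I +>\<^bsub>P\<^esub> p) \<otimes>\<^bsub>P Quot I\<^esub> \<phi> f)},
     mult = undefined, one = undefined,
     zero = (\<lambda>f\<in>I. \<zero>\<^bsub>P Quot I\<^esub>),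
     add = (\<lambda>\<phi> \<psi>. \<lambda>f\<in>I. \<phi> f \<oplus>\<^bsub>P Quot I\<^esub> \<psi> f),
     smult = (\<lambda>r \<phi>. \<lambda>f\<in>I. r \<otimes>\<^bsub>P Quot I\<^esub> \<phi> f)\<rparr>"

definition derivations :: "'a set \<Rightarrow> ('a, 'm) ring_scheme \<Rightarrow> 'a set \<Rightarrow> ('a \<Rightarrow> 'a set) set" where
  "derivations k P I =
    {D \<in> carrier P \<rightarrow> carrier (P Quot I).
       (\<forall>p\<in>carrier P. \<forall>q\<in>carrier P. D (p \<oplus>\<^bsub>P\<^esub> q) = D p \<oplus>\<^bsub>P Quot I\<^esub> D q) \<and>
       (\<forall>p\<in>carrier P. \<forall>q\<in>carrier P.
          D (p \<otimes>\<^bsub>P\<^esub> q) =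
            ((I +>\<^bsub>P\<^esub> p) \<otimes>\<^bsub>P Quot I\<^esub> D q) \<oplus>\<^bsub>P Quot I\<^esub> ((I +>\<^bsub>P\<^esub> q) \<otimes>\<^bsub>P Quot I\<^esub> D p)) \<and>
       (\<forall>c\<in>k. D c = \<zero>\<^bsub>P Quot I\<^esub>)}"

definition coboundaries :: "'a set \<Rightarrow> ('a, 'm) ring_scheme \<Rightarrow> 'a set \<Rightarrow> ('a \<Rightarrow> 'a set) set" where
  "coboundaries k P I = (\<lambda>D. restrict D I) ` derivations k P I"

definition T1 :: "'a set \<Rightarrow> ('a, 'm) ring_scheme \<Rightarrow> 'a set \<Rightarrow> ('a set, ('a \<Rightarrow> 'a set) set) module" where
  "T1 k P I = quotient_module (Hom_ideal P I) (coboundaries k P I)"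


section \<open>Polynomial rings and their multigrading\<close>

type_synonym 'v cpoly = "('v \<Rightarrow>\<^sub>0 nat) \<Rightarrow>\<^sub>0 complex"

definition pconst :: "complex \<Rightarrow> 'v cpoly" where
  "pconst c = Poly_Mapping.single 0 c"

definition pvar :: "'v \<Rightarrow> 'v cpoly" where
  "pvar v = Poly_Mapping.single (Poly_Mapping.single v 1) 1"

text \<open>The ring \<open>\<complex>[x\<^sub>v : v \<in> V]\<close>; the variables in use are cut out of the type by the carrier.\<close>

definition poly_ring :: "'v set \<Rightarrow> 'v cpoly ring" where
  "poly_ring V =
    \<lparr>carrier = {p. \<forall>m\<in>Poly_Mapping.keys p. Poly_Mapping.keys m \<subseteq> V},
     mult = (*), one = 1, zero = 0, add = (+)\<rparr>"

text \<open>Degrees live in \<open>\<int>\<^sup>V\<close>; the homogeneous part is \<open>{0}\<close> in degrees with a negative entry.\<close>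

definition poly_homog :: "'v set \<Rightarrow> ('v \<Rightarrow> int) \<Rightarrow> 'v cpoly set" where
  "poly_homog V e =
    {p \<in> carrier (poly_ring V). \<forall>m\<in>Poly_Mapping.keys p. \<forall>v. int (Poly_Mapping.lookup m v) = e v}"

text \<open>Let \<open>I\<close> be a monomial ideal of \<open>\<complex>[x\<^sub>v : v \<in> V]\<close>.  A homomorphism \<open>I \<rightarrow> A\<close> has degree \<open>c\<close> if it
  maps \<open>I\<^sub>e\<close> into \<open>A\<^bsub>e+c\<^esub>\<close> for every \<open>e\<close>; the degree \<open>c\<close> part of \<open>T\<^sup>1\<close> consists of the classes
  of these.\<close>

definition Hom_homog :: "'v set \<Rightarrow> 'v cpoly set \<Rightarrow> ('v \<Rightarrow> int) \<Rightarrow> ('v cpoly \<Rightarrow> 'v cpoly set) set" where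
  "Hom_homog V I c =
    {\<phi> \<in> carrier (Hom_ideal (poly_ring V) I).
       \<forall>e. \<forall>f \<in> I \<inter> poly_homog V e.
         \<phi> f \<in> (\<lambda>p. I +>\<^bsub>poly_ring V\<^esub> p) ` poly_homog V (\<lambda>v. e v + c v)}"

definition T1_graded :: "'v set \<Rightarrow> 'v cpoly set \<Rightarrow> ('v \<Rightarrow> int) \<Rightarrow> (complex, ('v cpoly \<Rightarrow> 'v cpoly set) set) module" where
  "T1_graded V I c =
    \<lparr>carrier = (\<lambda>\<phi>. coboundaries (range pconst) (poly_ring V) I +>\<^bsub>Hom_ideal (poly_ring V) I\<^esub> \<phi>) ` Hom_homog V I c,
     mult = undefined, one = undefined,
     zero = \<zero>\<^bsub>T1 (range pconst) (poly_ring V) I\<^esub>,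
     add = add (T1 (range pconst) (poly_ring V) I),
     smult = (\<lambda>z x. (I +>\<^bsub>poly_ring V\<^esub> pconst z) \<odot>\<^bsub>T1 (range pconst) (poly_ring V) I\<^esub> x)\<rparr>"


section \<open>The complex of dissections of the \<open>n\<close>-gon\<close>

text \<open>The diagonal \<open>\<delta>\<^bsub>ij\<^esub>\<close> is the two-element set \<open>{i, j}\<close>, and a polygon inscribed in the \<open>n\<close>-gon is
  the set of its vertices.\<close>

definition diagonals :: "nat \<Rightarrow> nat set set" where
  "diagonals n = {{i, j} | i j. 1 \<le> i \<and> i < j \<and> j \<le> n \<and> j \<noteq> i + 1 \<and> \<not> (i = 1 \<and> j = n)}"

definition crossing :: "nat set \<Rightarrow> nat set \<Rightarrow> bool" where
  "crossing d e \<longleftrightarrow> (\<exists>i j k l. i < j \<and> j < k \<and> k < l \<and> {d, e} = {{i, k}, {j, l}})"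

definition dissection_complex :: "nat \<Rightarrow> nat set set set" where
  "dissection_complex n = {F. F \<subseteq> diagonals n \<and> (\<forall>d\<in>F. \<forall>e\<in>F. \<not> crossing d e)}"

definition link :: "'v set \<Rightarrow> 'v set set \<Rightarrow> 'v set set" where
  "link a K = {g \<in> K. g \<inter> a = {} \<and> g \<union> a \<in> K}"

definition vertices :: "'v set set \<Rightarrow> 'v set" where
  "vertices K = \<Union> K"

definition quadrangles :: "nat \<Rightarrow> nat set set" where
  "quadrangles n = {{i, j, k, l} | i j k l. 1 \<le> i \<and> i < j \<and> j < k \<and> k < l \<and> l \<le> n}"

text \<open>A diagonal \<open>{i < j}\<close> cuts the \<open>n\<close>-gon into the polygons with vertices \<open>i, \<dots>, j\<close> and
  \<open>j, \<dots>, n, 1, \<dots>, i\<close>.  The pieces cut out by a set of noncrossing diagonals are the intersections of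
  one side of each of them that are not degenerate, i.e. not just a point or a segment.\<close>

definition sides :: "nat \<Rightarrow> nat set \<Rightarrow> nat set set" where
  "sides n d = {{Min d..Max d}, {1..Min d} \<union> {Max d..n}}"

definition polygons :: "nat \<Rightarrow> nat set set \<Rightarrow> nat set set" where
  "polygons n a =
    {S. 3 \<le> card S \<and> (\<exists>s. (\<forall>d\<in>a. s d \<in> sides n d) \<and> S = {1..n} \<inter> (\<Inter>d\<in>a. s d))}"


section \<open>The ring \<open>A\<^sub>n\<close> and its \<open>T\<^sup>1\<close>\<close>

abbreviation poly_n :: "nat \<Rightarrow> nat set cpoly ring" where
  "poly_n n \<equiv> poly_ring (diagonals n)"

definition ideal_n :: "nat \<Rightarrow> nat set cpoly set" where
  "ideal_n n =
    Idl\<^bsub>poly_n n\<^esub> {pvar {i, k} * pvar {j, l} | i j k l. 1 \<le> i \<and> i < j \<and> j < k \<and> k < l \<and> l \<le> n}"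

definition A_ring :: "nat \<Rightarrow> nat set cpoly set ring" where
  "A_ring n = poly_n n Quot ideal_n n"

definition T1_A :: "nat \<Rightarrow> (nat set cpoly set, (nat set cpoly \<Rightarrow> nat set cpoly set) set) module" where
  "T1_A n = T1 (range pconst) (poly_n n) (ideal_n n)"

definition T1_A_deg :: "nat \<Rightarrow> (nat set \<Rightarrow> int) \<Rightarrow> (complex, (nat set cpoly \<Rightarrow> nat set cpoly set) set) module" where
  "T1_A_deg n c = T1_graded (diagonals n) (ideal_n n) c"

end

theory Submission
imports Defs
begin

text \<open>
  For a monomial ideal \<open>I\<close> a homomorphism \<open>I \<rightarrow> A\<close> is determined by the coefficients of its values on
  monomials, and linearity makes these coefficients invariant under multiplying source and target by
  a common monomial.  Let \<open>I\<close> be generated by the products \<open>x\<^sub>d x\<^sub>e\<close> of crossing diagonals and consider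
  a nonzero homomorphism of degree \<open>\<alpha> - \<beta>\<close>, with \<open>\<alpha>\<close>, \<open>\<beta>\<close> of disjoint supports \<open>a\<close>, \<open>b\<close>.  Cancelling as
  many factors as possible shows that \<open>\<beta>\<close> is squarefree and \<open>b\<close> is either a single diagonal \<open>p\<close> or a
  crossing pair \<open>{p, q}\<close>.

  If \<open>b = {p}\<close>, the coefficients are indexed by the diagonals crossing \<open>p\<close> that are compatible with
  \<open>a\<close>, and noncrossing diagonals have equal coefficients.  Two crossing ones are both compatible with a side of
  their quadrangle that crosses \<open>p\<close>; so all coefficients agree and the homomorphism is a multiple of
  \<open>x\<^sup>\<alpha> \<partial>/\<partial>x\<^sub>p\<close>, a coboundary.  If \<open>b = {p, q}\<close>, the homomorphism is determined by its value on \<open>x\<^sub>p x\<^sub>q\<close>, and a nonzero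
  value is possible iff no further diagonal compatible with \<open>a\<close> crosses \<open>p\<close> or \<open>q\<close>, that is, iff
  \<open>a\<close> contains the sides of the quadrangle of \<open>p\<close>, \<open>q\<close>.  The homomorphisms with \<open>a\<close> equal to the
  set of these sides generate \<open>T\<^sup>1\<close>, and each of them is needed because it is the only one that does not map
  \<open>x\<^sub>p x\<^sub>q\<close> into \<open>(x\<^sub>p, x\<^sub>q)\<close>, as all coboundaries do.
\<close>

section \<open>Quotients and scalars of modules\<close>

text \<open>The algebra is carried out for an abstract crossing relation; the polygon supplies the
  axiom \<open>connected\<close> and a least good set for each crossing pair. A side of the
  quadrangle of two crossing diagonals may replace them because every diagonal that crosses the side
  crosses one of the two, so compatibility with a passes to the side. That a good a contains the
  sides of its quadrangle is proved by contraposition: if a side is neither in a nor an edge of the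
  n-gon, some vertex t beyond it is not separated from it by a, and joining t to a suitable far
  vertex of the quadrangle gives a diagonal compatible with a that crosses p or q. On the algebraic
  side, classes in A are represented by polynomials without monomials of I; the price is that the
  invariance of coefficients holds only at target monomials outside I. An arbitrary homomorphism
  splits into finitely many homogeneous ones because I is finitely generated.\<close>

lemma (in Module.module) submodule_abelian_subgroup:
  assumes "submodule R N M"
  shows "abelian_subgroup N M"
proof -
  interpret N: submodule R N M by fact
  have inv: "\<ominus>\<^bsub>M\<^esub> x \<in> N" if "x \<in> N" for x
    proof -
    have "x \<in> carrier M" using that N.subset by auto
    then have "\<ominus>\<^bsub>M\<^esub> x = (\<ominus>\<^bsub>R\<^esub> \<one>\<^bsub>R\<^esub>) \<odot>\<^bsub>M\<^esub> x" by (simp add: smult_l_minus)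
    then show ?thesis using that N.smult_closed[of "\<ominus>\<^bsub>R\<^esub> \<one>\<^bsub>R\<^esub>" x] by simp
  qed
  have "subgroup N (add_monoid M)"
    by (intro M.add.subgroupI) (use N.subset N.zero_closed inv in \<open>auto simp del: N.zero_closed\<close>)
  then show ?thesis
    by (intro abelian_subgroupI3 additive_subgroupI M.abelian_group_axioms)
qed

text \<open>The scalar action is defined as a union over all representatives of the coset. Each of
  them contributes the same coset because multiples of elements of \<open>N\<close> stay in
  \<open>N\<close>, and the union of a constant nonempty family is that coset.\<close>

lemma (in Module.module) quotient_module_smult:
  assumes "submodule R N M" "r \<in> carrier R" "x \<in> carrier M"
  shows "smult (quotient_module M N) r (N +>\<^bsub>M\<^esub> x) = N +>\<^bsub>M\<^esub> (r \<odot>\<^bsub>M\<^esub> x)"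
proof -
  interpret N: submodule R N M by fact
  interpret abelian_subgroup N M by (rule submodule_abelian_subgroup[OF assms(1)])
  have "N +>\<^bsub>M\<^esub> (r \<odot>\<^bsub>M\<^esub> y) = N +>\<^bsub>M\<^esub> (r \<odot>\<^bsub>M\<^esub> x)" if "y \<in> N +>\<^bsub>M\<^esub> x" for y
  proof -
    obtain h where h: "h \<in> N" "y = h \<oplus>\<^bsub>M\<^esub> x"
      using \<open>y \<in> N +>\<^bsub>M\<^esub> x\<close> by (auto simp: a_r_coset_def')
    have "r \<odot>\<^bsub>M\<^esub> y = r \<odot>\<^bsub>M\<^esub> h \<oplus>\<^bsub>M\<^esub> r \<odot>\<^bsub>M\<^esub> x"
      using h assms a_subset by (auto simp: smult_r_distr)
    moreover have "r \<odot>\<^bsub>M\<^esub> h \<in> N" using h assms by simp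
    ultimately have "r \<odot>\<^bsub>M\<^esub> y \<in> N +>\<^bsub>M\<^esub> (r \<odot>\<^bsub>M\<^esub> x)"
      by (auto simp: a_r_coset_def')
    then show ?thesis
      using a_repr_independence[OF _ _ a_subgroup] assms by auto
  qed
  then have "(\<Union>y\<in>N +>\<^bsub>M\<^esub> x. N +>\<^bsub>M\<^esub> (r \<odot>\<^bsub>M\<^esub> y)) = (\<Union>y\<in>N +>\<^bsub>M\<^esub> x. N +>\<^bsub>M\<^esub> (r \<odot>\<^bsub>M\<^esub> x))"
    by (intro SUP_cong refl)
  moreover have "x \<in> N +>\<^bsub>M\<^esub> x" using assms(3) by (rule a_rcos_self)
  then have "N +>\<^bsub>M\<^esub> x \<noteq> {}" by blast
  ultimately show ?thesis
    by (simp add: quotient_module_def)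
qed

lemma (in Module.module) quotient_module_add:
  assumes "submodule R N M" "x \<in> carrier M" "y \<in> carrier M"
  shows "(N +>\<^bsub>M\<^esub> x) \<oplus>\<^bsub>quotient_module M N\<^esub> (N +>\<^bsub>M\<^esub> y) = N +>\<^bsub>M\<^esub> (x \<oplus>\<^bsub>M\<^esub> y)"
proof -
  interpret N: submodule R N M by fact
  interpret abelian_subgroup N M by (rule submodule_abelian_subgroup[OF assms(1)])
  show ?thesis using assms a_rcos_sum by (simp add: quotient_module_def)
qed

lemma carrier_quotient_module:
  "carrier (quotient_module M N) = (\<lambda>x. N +>\<^bsub>M\<^esub> x) ` carrier M"
  by (simp add: quotient_module_def A_RCOSETS_def RCOSETS_def a_r_coset_def UNION_singleton_eq_range)

lemma (in Module.module) quotient_module_eq_zero_iff: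
  assumes "submodule R N M" "x \<in> carrier M"
  shows "N +>\<^bsub>M\<^esub> x = \<zero>\<^bsub>quotient_module M N\<^esub> \<longleftrightarrow> x \<in> N"
proof -
  interpret N: submodule R N M by fact
  interpret abelian_subgroup N M by (rule submodule_abelian_subgroup[OF assms(1)])
  have "\<zero>\<^bsub>quotient_module M N\<^esub> = N" by (simp add: quotient_module_def)
  then show ?thesis
    using a_coset_join1[OF _ assms(2) a_subgroup] a_coset_join2[OF assms(2) a_subgroup] by metis
qed

lemma (in Module.module) module_quotient_module:
  assumes "submodule R N M"
  shows "module R (quotient_module M N)"
proof -
  interpret N: submodule R N M by fact
  interpret abelian_subgroup N M by (rule submodule_abelian_subgroup[OF assms(1)])
  let ?Q = "quotient_module M N"
  note add = quotient_module_add[OF assms] and smult = quotient_module_smult[OF assms]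
  have zero: "\<zero>\<^bsub>?Q\<^esub> = N +>\<^bsub>M\<^esub> \<zero>\<^bsub>M\<^esub>"
    by (rule quotient_module_eq_zero_iff[OF assms M.zero_closed, THEN iffD2, OF N.zero_closed, symmetric])
  have coset: "\<exists>y\<in>carrier M. x = N +>\<^bsub>M\<^esub> y" if "x \<in> carrier ?Q" for x
    using that unfolding carrier_quotient_module by blast
  have closed: "N +>\<^bsub>M\<^esub> y \<in> carrier ?Q" if "y \<in> carrier M" for y
    using that unfolding carrier_quotient_module by blast
  show ?thesis
  proof (rule moduleI)
    show "cring R" by (rule R.is_cring)
    show "abelian_group ?Q"
    proof (rule abelian_groupI)
      show "\<zero>\<^bsub>?Q\<^esub> \<in> carrier ?Q" unfolding zero by (rule closed) (rule M.zero_closed)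
    next
      fix x assume "x \<in> carrier ?Q"
      with coset obtain x' where x: "x' \<in> carrier M" "x = N +>\<^bsub>M\<^esub> x'" by blast
      then show "\<zero>\<^bsub>?Q\<^esub> \<oplus>\<^bsub>?Q\<^esub> x = x" unfolding zero x(2) add[OF M.zero_closed x(1)] by (simp only: M.l_zero)
      have "(N +>\<^bsub>M\<^esub> (\<ominus>\<^bsub>M\<^esub> x')) \<oplus>\<^bsub>?Q\<^esub> x = \<zero>\<^bsub>?Q\<^esub>"
        unfolding zero x(2) add[OF M.a_inv_closed[OF x(1)] x(1)] M.l_neg[OF x(1)] ..
      then show "\<exists>y\<in>carrier ?Q. y \<oplus>\<^bsub>?Q\<^esub> x = \<zero>\<^bsub>?Q\<^esub>"
        using closed[OF M.a_inv_closed[OF x(1)]] by blast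
      fix y assume "y \<in> carrier ?Q"
      with coset obtain y' where y: "y' \<in> carrier M" "y = N +>\<^bsub>M\<^esub> y'" by blast
      show "x \<oplus>\<^bsub>?Q\<^esub> y \<in> carrier ?Q"
        unfolding x(2) y(2) add[OF x(1) y(1)] using x y by (intro closed M.a_closed)
      show "x \<oplus>\<^bsub>?Q\<^esub> y = y \<oplus>\<^bsub>?Q\<^esub> x"
        unfolding x(2) y(2) add[OF x(1) y(1)] add[OF y(1) x(1)] M.a_comm[OF x(1) y(1)] ..
      fix z assume "z \<in> carrier ?Q"
      with coset obtain z' where z: "z' \<in> carrier M" "z = N +>\<^bsub>M\<^esub> z'" by blast
      show "x \<oplus>\<^bsub>?Q\<^esub> y \<oplus>\<^bsub>?Q\<^esub> z = x \<oplus>\<^bsub>?Q\<^esub> (y \<oplus>\<^bsub>?Q\<^esub> z)"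
        unfolding x(2) y(2) z(2) using x(1) y(1) z(1) by (simp only: add M.a_closed M.a_assoc)
    qed
  next
    fix x assume "x \<in> carrier ?Q"
    with coset obtain x' where x: "x' \<in> carrier M" "x = N +>\<^bsub>M\<^esub> x'" by blast
    show "\<one>\<^bsub>R\<^esub> \<odot>\<^bsub>?Q\<^esub> x = x" unfolding x(2) smult[OF R.one_closed x(1)] smult_one[OF x(1)] ..
  next
    fix r x assume r: "r \<in> carrier R" and "x \<in> carrier ?Q"
    with coset obtain x' where x: "x' \<in> carrier M" "x = N +>\<^bsub>M\<^esub> x'" by blast
    show "r \<odot>\<^bsub>?Q\<^esub> x \<in> carrier ?Q" unfolding x(2) smult[OF r x(1)] using r x by (intro closed smult_closed)
    fix s assume s: "s \<in> carrier R"
    show "(r \<oplus>\<^bsub>R\<^esub> s) \<odot>\<^bsub>?Q\<^esub> x = r \<odot>\<^bsub>?Q\<^esub> x \<oplus>\<^bsub>?Q\<^esub> s \<odot>\<^bsub>?Q\<^esub> x"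
      unfolding x(2) using r s x(1) by (simp only: smult add R.a_closed smult_closed smult_l_distr)
    show "(r \<otimes>\<^bsub>R\<^esub> s) \<odot>\<^bsub>?Q\<^esub> x = r \<odot>\<^bsub>?Q\<^esub> (s \<odot>\<^bsub>?Q\<^esub> x)"
      unfolding x(2) using r s x(1) by (simp only: smult R.m_closed smult_closed smult_assoc1)
    fix y assume "y \<in> carrier ?Q"
    with coset obtain y' where y: "y' \<in> carrier M" "y = N +>\<^bsub>M\<^esub> y'" by blast
    show "r \<odot>\<^bsub>?Q\<^esub> (x \<oplus>\<^bsub>?Q\<^esub> y) = r \<odot>\<^bsub>?Q\<^esub> x \<oplus>\<^bsub>?Q\<^esub> r \<odot>\<^bsub>?Q\<^esub> y"
      unfolding x(2) y(2) using r x(1) y(1) by (simp only: smult add M.a_closed smult_closed smult_r_distr)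
  qed
qed

text \<open>The graded pieces are complex vector spaces while \<open>T1\<close> is a module over A;
  this is the change of scalars along the constants. The record is spelled out so that
  \<open>T1_graded\<close> is a carrier update of it.\<close>

lemma module_restrict_scalars:
  assumes "module R M" "cring S" "h \<in> Ring.ring_hom S R"
  shows "module S \<lparr>carrier = carrier M, mult = undefined, one = undefined, zero = \<zero>\<^bsub>M\<^esub>, add = add M,
    smult = (\<lambda>z x. h z \<odot>\<^bsub>M\<^esub> x)\<rparr>"
proof -
  interpret Module.module R M by fact
  interpret S: cring S by fact
  have [simp]: "z \<in> carrier S \<Longrightarrow> h z \<in> carrier R" for z
    using assms(3) by (auto simp: Ring.ring_hom_def)
  show ?thesis
  proof (rule moduleI)
    show "abelian_group \<lparr>carrier = carrier M, mult = undefined, one = undefined, zero = \<zero>\<^bsub>M\<^esub>, add = add M,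
      smult = (\<lambda>z x. h z \<odot>\<^bsub>M\<^esub> x)\<rparr>"
      using M.add.inv_closed M.l_neg by (intro abelian_groupI) (auto simp: M.a_ac)
  qed (use assms in \<open>auto simp: ring_hom_add ring_hom_mult ring_hom_one smult_l_distr smult_r_distr smult_assoc1\<close>)
qed

lemma has_dim_1I:
  assumes V: "vectorspace K V" and x: "x \<in> carrier V" "x \<noteq> \<zero>\<^bsub>V\<^esub>"
    and span: "\<And>y. y \<in> carrier V \<Longrightarrow> \<exists>z\<in>carrier K. y = z \<odot>\<^bsub>V\<^esub> x"
  shows "has_dim K V 1"
proof -
  interpret vectorspace K V by fact
  have gen: "gen_set {x}"
  proof (intro equalityI subsetI)
    fix y assume "y \<in> carrier V"
    then obtain z where z: "z \<in> carrier K" "y = z \<odot>\<^bsub>V\<^esub> x" using span by blast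
    have "submodule K (span {x}) V" using x by (intro span_is_submodule) auto
    moreover have "x \<in> span {x}" using x in_own_span[of "{x}"] by auto
    ultimately show "y \<in> span {x}" using z by (auto dest: submodule.smult_closed)
  qed (use x span_is_subset2[of "{x}"] in auto)
  have "lin_indpt {x}"
  proof
    assume "lin_dep {x}"
    then obtain A c v where A: "finite A" "A \<subseteq> {x}" "c \<in> A \<rightarrow> carrier K" "lincomb c A = \<zero>\<^bsub>V\<^esub>" "v \<in> A" "c v \<noteq> \<zero>\<^bsub>K\<^esub>"
      unfolding lin_dep_def by blast
    then have "A = {x}" "v = x" by auto
    then have "c x \<odot>\<^bsub>V\<^esub> x = \<zero>\<^bsub>V\<^esub>" "c x \<in> carrier K"
      using A x by (auto simp: lincomb_def)
    then have c: "c x \<odot>\<^bsub>V\<^esub> x = \<zero>\<^bsub>V\<^esub>" "c x \<in> Units K"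
      using A \<open>v = x\<close> by (auto simp: field_Units)
    have "x = (inv\<^bsub>K\<^esub> (c x) \<otimes>\<^bsub>K\<^esub> c x) \<odot>\<^bsub>V\<^esub> x"
      using c(2) x by (simp add: R.Units_l_inv)
    also have "\<dots> = inv\<^bsub>K\<^esub> (c x) \<odot>\<^bsub>V\<^esub> (c x \<odot>\<^bsub>V\<^esub> x)"
      by (intro smult_assoc1 x R.Units_inv_closed R.Units_closed c(2))
    also have "\<dots> = \<zero>\<^bsub>V\<^esub>"
      using c by (simp add: R.Units_inv_closed)
    finally show False using x by simp
  qed
  then have basis: "basis {x}" unfolding basis_def using gen x by blast
  have "finite {x}" by simp
  have "vectorspace.dim K V = 1"
    unfolding dim_basis[OF \<open>finite {x}\<close> basis] by simp
  moreover have fin_dim unfolding fin_dim_def using gen x by blast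
  ultimately show ?thesis unfolding has_dim_def using V by blast
qed

section \<open>Homomorphisms from an ideal to the quotient ring\<close>

lemma Hom_ideal_mem:
  "\<phi> \<in> carrier (Hom_ideal P I) \<longleftrightarrow> \<phi> \<in> I \<rightarrow>\<^sub>E carrier (P Quot I) \<and>
     (\<forall>f\<in>I. \<forall>g\<in>I. \<phi> (f \<oplus>\<^bsub>P\<^esub> g) = \<phi> f \<oplus>\<^bsub>P Quot I\<^esub> \<phi> g) \<and>
     (\<forall>p\<in>carrier P. \<forall>f\<in>I. \<phi> (p \<otimes>\<^bsub>P\<^esub> f) = (I +>\<^bsub>P\<^esub> p) \<otimes>\<^bsub>P Quot I\<^esub> \<phi> f)"
  by (simp add: Hom_ideal_def)

lemma Hom_ideal_simps:
  "\<zero>\<^bsub>Hom_ideal P I\<^esub> = (\<lambda>f\<in>I. \<zero>\<^bsub>P Quot I\<^esub>)"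
  "\<phi> \<oplus>\<^bsub>Hom_ideal P I\<^esub> \<psi> = (\<lambda>f\<in>I. \<phi> f \<oplus>\<^bsub>P Quot I\<^esub> \<psi> f)"
  "r \<odot>\<^bsub>Hom_ideal P I\<^esub> \<phi> = (\<lambda>f\<in>I. r \<otimes>\<^bsub>P Quot I\<^esub> \<phi> f)"
  by (simp_all add: Hom_ideal_def)

locale quotient_ring = P: cring P + I: ideal I P for P (structure) and I
begin

abbreviation "A \<equiv> P Quot I"
abbreviation "cl \<equiv> (+>) I"
abbreviation "H \<equiv> Hom_ideal P I"

sublocale A: cring A
  by (rule I.quotient_is_cring) (rule P.is_cring)

lemma cl_closed [simp, intro]: "x \<in> carrier P \<Longrightarrow> cl x \<in> carrier A"
  using I.rcos_ring_hom by (rule ring_hom_closed)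

lemma cl_add: "x \<in> carrier P \<Longrightarrow> y \<in> carrier P \<Longrightarrow> cl (x \<oplus> y) = cl x \<oplus>\<^bsub>A\<^esub> cl y"
  using I.rcos_ring_hom by (rule ring_hom_add)

lemma cl_mult: "x \<in> carrier P \<Longrightarrow> y \<in> carrier P \<Longrightarrow> cl (x \<otimes> y) = cl x \<otimes>\<^bsub>A\<^esub> cl y"
  using I.rcos_ring_hom by (rule ring_hom_mult)

lemma zero_A: "\<zero>\<^bsub>A\<^esub> = I"
  by (simp add: FactRing_def)

lemma cl_eq_zero_iff: "x \<in> carrier P \<Longrightarrow> cl x = \<zero>\<^bsub>A\<^esub> \<longleftrightarrow> x \<in> I"
  unfolding zero_A using P.a_coset_join1[of I x] P.a_coset_join2[of x I] I.a_subgroup by metis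

lemma carrier_A: "carrier A = cl ` carrier P"
  by (simp add: FactRing_def A_RCOSETS_def RCOSETS_def a_r_coset_def UNION_singleton_eq_range)

lemma cl_eq_iff:
  assumes "x \<in> carrier P" "y \<in> carrier P"
  shows "cl x = cl y \<longleftrightarrow> x \<ominus> y \<in> I"
  using P.quotient_eq_iff_same_a_r_cos[OF I.ideal_axioms assms] by blast

lemma I_carrier [simp, intro]: "f \<in> I \<Longrightarrow> f \<in> carrier P"
  using I.a_subset by blast

lemma I_mult [simp, intro]: "p \<in> carrier P \<Longrightarrow> f \<in> I \<Longrightarrow> p \<otimes> f \<in> I"
  by (rule I.I_l_closed)

lemma HomI:
  assumes "\<And>f. f \<in> I \<Longrightarrow> F f \<in> carrier A"
    and "\<And>f g. f \<in> I \<Longrightarrow> g \<in> I \<Longrightarrow> F (f \<oplus> g) = F f \<oplus>\<^bsub>A\<^esub> F g"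
    and "\<And>p f. p \<in> carrier P \<Longrightarrow> f \<in> I \<Longrightarrow> F (p \<otimes> f) = cl p \<otimes>\<^bsub>A\<^esub> F f"
  shows "(\<lambda>f\<in>I. F f) \<in> carrier H"
  using assms unfolding Hom_ideal_mem by auto

lemma
  assumes "\<phi> \<in> carrier H"
  shows Hom_closed: "f \<in> I \<Longrightarrow> \<phi> f \<in> carrier A"
    and Hom_add: "f \<in> I \<Longrightarrow> g \<in> I \<Longrightarrow> \<phi> (f \<oplus> g) = \<phi> f \<oplus>\<^bsub>A\<^esub> \<phi> g"
    and Hom_mult: "p \<in> carrier P \<Longrightarrow> f \<in> I \<Longrightarrow> \<phi> (p \<otimes> f) = cl p \<otimes>\<^bsub>A\<^esub> \<phi> f"
    and Hom_extensional: "\<phi> \<in> extensional I"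
  using assms unfolding Hom_ideal_mem by (auto simp: PiE_def)

lemma Hom_eqI:
  assumes "\<phi> \<in> carrier H" "\<psi> \<in> carrier H" "\<And>f. f \<in> I \<Longrightarrow> \<phi> f = \<psi> f"
  shows "\<phi> = \<psi>"
  using assms by (intro extensionalityI[of _ I]) (auto simp: Hom_extensional)

lemma Hom_add_closed: "\<phi> \<in> carrier H \<Longrightarrow> \<psi> \<in> carrier H \<Longrightarrow> \<phi> \<oplus>\<^bsub>H\<^esub> \<psi> \<in> carrier H"
  unfolding Hom_ideal_simps
  by (intro HomI) (auto simp: Hom_closed Hom_add Hom_mult A.a_ac A.r_distr)

lemma Hom_smult_closed: "r \<in> carrier A \<Longrightarrow> \<phi> \<in> carrier H \<Longrightarrow> r \<odot>\<^bsub>H\<^esub> \<phi> \<in> carrier H"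
  unfolding Hom_ideal_simps
  by (intro HomI) (auto simp: Hom_closed Hom_add Hom_mult A.m_ac A.r_distr)

lemma Hom_zero_closed: "\<zero>\<^bsub>H\<^esub> \<in> carrier H"
  unfolding Hom_ideal_simps by (intro HomI) auto

sublocale H: Module.module A H
proof (rule moduleI)
  show "cring A" by (rule A.is_cring)
  note [simp] = Hom_closed
  show "abelian_group H"
  proof (rule abelian_groupI)
    fix \<phi> assume \<phi>: "\<phi> \<in> carrier H"
    have "(\<lambda>f\<in>I. \<ominus>\<^bsub>A\<^esub> \<phi> f) \<in> carrier H"
      using \<phi> by (intro HomI) (auto simp: Hom_add Hom_mult A.minus_add A.r_minus A.a_comm)
    moreover have "(\<lambda>f\<in>I. \<ominus>\<^bsub>A\<^esub> \<phi> f) \<oplus>\<^bsub>H\<^esub> \<phi> = \<zero>\<^bsub>H\<^esub>"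
      unfolding Hom_ideal_simps using \<phi> by (intro restrict_ext) (auto simp: A.l_neg)
    ultimately show "\<exists>\<psi>\<in>carrier H. \<psi> \<oplus>\<^bsub>H\<^esub> \<phi> = \<zero>\<^bsub>H\<^esub>" by blast
    show "\<zero>\<^bsub>H\<^esub> \<oplus>\<^bsub>H\<^esub> \<phi> = \<phi>"
      using \<phi> by (intro Hom_eqI Hom_add_closed Hom_zero_closed) (auto simp: Hom_ideal_simps)
  next
    fix \<phi> \<psi> assume "\<phi> \<in> carrier H" "\<psi> \<in> carrier H"
    then show "\<phi> \<oplus>\<^bsub>H\<^esub> \<psi> = \<psi> \<oplus>\<^bsub>H\<^esub> \<phi>"
      unfolding Hom_ideal_simps by (intro restrict_ext) (auto simp: A.a_comm)
  next
    fix \<phi> \<psi> \<chi> assume "\<phi> \<in> carrier H" "\<psi> \<in> carrier H" "\<chi> \<in> carrier H"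
    then show "\<phi> \<oplus>\<^bsub>H\<^esub> \<psi> \<oplus>\<^bsub>H\<^esub> \<chi> = \<phi> \<oplus>\<^bsub>H\<^esub> (\<psi> \<oplus>\<^bsub>H\<^esub> \<chi>)"
      unfolding Hom_ideal_simps by (intro restrict_ext) (auto simp: A.a_assoc)
  qed (auto intro: Hom_add_closed Hom_zero_closed)
  fix r \<phi> assume r: "r \<in> carrier A" and \<phi>: "\<phi> \<in> carrier H"
  then show "r \<odot>\<^bsub>H\<^esub> \<phi> \<in> carrier H" by (rule Hom_smult_closed)
  fix s assume s: "s \<in> carrier A"
  show "(r \<oplus>\<^bsub>A\<^esub> s) \<odot>\<^bsub>H\<^esub> \<phi> = r \<odot>\<^bsub>H\<^esub> \<phi> \<oplus>\<^bsub>H\<^esub> s \<odot>\<^bsub>H\<^esub> \<phi>"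
    unfolding Hom_ideal_simps using r s \<phi> by (intro restrict_ext) (auto simp: A.l_distr)
  show "(r \<otimes>\<^bsub>A\<^esub> s) \<odot>\<^bsub>H\<^esub> \<phi> = r \<odot>\<^bsub>H\<^esub> (s \<odot>\<^bsub>H\<^esub> \<phi>)"
    unfolding Hom_ideal_simps using r s \<phi> by (intro restrict_ext) (auto simp: A.m_assoc)
  fix \<psi> assume \<psi>: "\<psi> \<in> carrier H"
  show "r \<odot>\<^bsub>H\<^esub> (\<phi> \<oplus>\<^bsub>H\<^esub> \<psi>) = r \<odot>\<^bsub>H\<^esub> \<phi> \<oplus>\<^bsub>H\<^esub> r \<odot>\<^bsub>H\<^esub> \<psi>"
    unfolding Hom_ideal_simps using r \<phi> \<psi> by (intro restrict_ext) (auto simp: A.r_distr)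
next
  fix \<phi> assume \<phi>: "\<phi> \<in> carrier H"
  show "\<one>\<^bsub>A\<^esub> \<odot>\<^bsub>H\<^esub> \<phi> = \<phi>"
    using \<phi> by (intro Hom_eqI Hom_smult_closed) (auto simp: Hom_ideal_simps Hom_closed)
qed

lemma derivationI:
  assumes "\<And>p. p \<in> carrier P \<Longrightarrow> D p \<in> carrier A"
    and "\<And>p q. p \<in> carrier P \<Longrightarrow> q \<in> carrier P \<Longrightarrow> D (p \<oplus> q) = D p \<oplus>\<^bsub>A\<^esub> D q"
    and "\<And>p q. p \<in> carrier P \<Longrightarrow> q \<in> carrier P \<Longrightarrow>
      D (p \<otimes> q) = (cl p \<otimes>\<^bsub>A\<^esub> D q) \<oplus>\<^bsub>A\<^esub> (cl q \<otimes>\<^bsub>A\<^esub> D p)"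
    and "\<And>c. c \<in> k \<Longrightarrow> D c = \<zero>\<^bsub>A\<^esub>"
  shows "D \<in> derivations k P I"
  using assms by (simp add: derivations_def)

lemma
  assumes "D \<in> derivations k P I"
  shows derivation_closed: "p \<in> carrier P \<Longrightarrow> D p \<in> carrier A"
    and derivation_add: "p \<in> carrier P \<Longrightarrow> q \<in> carrier P \<Longrightarrow> D (p \<oplus> q) = D p \<oplus>\<^bsub>A\<^esub> D q"
    and derivation_mult: "p \<in> carrier P \<Longrightarrow> q \<in> carrier P \<Longrightarrow>
      D (p \<otimes> q) = (cl p \<otimes>\<^bsub>A\<^esub> D q) \<oplus>\<^bsub>A\<^esub> (cl q \<otimes>\<^bsub>A\<^esub> D p)"
    and derivation_const: "c \<in> k \<Longrightarrow> D c = \<zero>\<^bsub>A\<^esub>"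
  using assms by (auto simp: derivations_def)

lemma coboundaries_submodule: "submodule A (coboundaries k P I) H"
proof
  show "coboundaries k P I \<subseteq> carrier H"
  proof
    fix \<phi> assume "\<phi> \<in> coboundaries k P I"
    then obtain D where D: "D \<in> derivations k P I" "\<phi> = restrict D I"
      by (auto simp: coboundaries_def)
    have "restrict D I \<in> carrier H"
    proof (rule HomI)
      fix p f assume pf: "p \<in> carrier P" "f \<in> I"
      \<comment> \<open>This makes the restriction of a derivation linear: in the Leibniz rule the
        term with the factor \<open>cl f\<close> disappears.\<close>
      then have "cl f = \<zero>\<^bsub>A\<^esub>" by (simp add: cl_eq_zero_iff)
      with pf D show "D (p \<otimes> f) = cl p \<otimes>\<^bsub>A\<^esub> D f"
        by (simp add: derivation_mult derivation_closed)
    qed (use D in \<open>auto simp: derivation_add derivation_closed\<close>)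
    with D show "\<phi> \<in> carrier H" by simp
  qed
next
  fix \<phi> \<psi> assume "\<phi> \<in> coboundaries k P I" "\<psi> \<in> coboundaries k P I"
  then obtain D E where D: "D \<in> derivations k P I" "\<phi> = restrict D I"
    and E: "E \<in> derivations k P I" "\<psi> = restrict E I"
    by (auto simp: coboundaries_def)
  have "(\<lambda>p. D p \<oplus>\<^bsub>A\<^esub> E p) \<in> derivations k P I"
    using D E by (intro derivationI)
      (auto simp: derivation_add derivation_closed derivation_mult derivation_const A.r_distr A.a_ac)
  moreover have "\<phi> \<oplus>\<^bsub>H\<^esub> \<psi> = restrict (\<lambda>p. D p \<oplus>\<^bsub>A\<^esub> E p) I"
    unfolding Hom_ideal_simps D E by (intro restrict_ext) auto
  ultimately show "\<phi> \<oplus>\<^bsub>H\<^esub> \<psi> \<in> coboundaries k P I" by (auto simp: coboundaries_def)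
next
  have "(\<lambda>_. \<zero>\<^bsub>A\<^esub>) \<in> derivations k P I" by (intro derivationI) auto
  moreover have "\<zero>\<^bsub>H\<^esub> = restrict (\<lambda>_. \<zero>\<^bsub>A\<^esub>) I" by (simp add: Hom_ideal_simps)
  ultimately show "\<zero>\<^bsub>H\<^esub> \<in> coboundaries k P I" by (auto simp: coboundaries_def)
next
  fix r \<phi> assume r: "r \<in> carrier A" and "\<phi> \<in> coboundaries k P I"
  then obtain D where D: "D \<in> derivations k P I" "\<phi> = restrict D I"
    by (auto simp: coboundaries_def)
  have "(\<lambda>p. r \<otimes>\<^bsub>A\<^esub> D p) \<in> derivations k P I"
    using D r by (intro derivationI)
      (auto simp: derivation_add derivation_closed derivation_mult derivation_const A.r_distr A.m_ac)
  moreover have "r \<odot>\<^bsub>H\<^esub> \<phi> = restrict (\<lambda>p. r \<otimes>\<^bsub>A\<^esub> D p) I"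
    unfolding Hom_ideal_simps D by (intro restrict_ext) auto
  ultimately show "r \<odot>\<^bsub>H\<^esub> \<phi> \<in> coboundaries k P I" by (auto simp: coboundaries_def)
qed

end

section \<open>Monomial ideals\<close>

abbreviation "lookup \<equiv> Poly_Mapping.lookup"
abbreviation "keys \<equiv> Poly_Mapping.keys"
abbreviation "single \<equiv> Poly_Mapping.single"

text \<open>Updating at a fresh key is the same as adding a single term. In contrast to
  \<open>update_induct\<close>, the rule remembers that all monomials lie in \<open>S\<close>, so
  inductions can be confined to the monomials of an ideal.\<close>

lemma poly_mapping_induct_keys [consumes 1, case_names zero add]:
  fixes f :: "'a \<Rightarrow>\<^sub>0 'b::comm_monoid_add"
  assumes "keys f \<subseteq> S" and "Q 0"
    and "\<And>m z f. m \<in> S \<Longrightarrow> keys f \<subseteq> S \<Longrightarrow> Q f \<Longrightarrow> Q (single m z + f)"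
  shows "Q f"
proof -
  have "keys f \<subseteq> S \<longrightarrow> Q f"
  proof (induction f rule: update_induct)
    case const
    then show ?case using assms(2) by simp
  next
    case (update f a b)
    then have eq: "Poly_Mapping.update a b f = single a b + f"
      by (intro poly_mapping_eqI) (auto simp: lookup_update lookup_add lookup_single in_keys_iff when_def)
    show ?case
    proof
      assume "keys (Poly_Mapping.update a b f) \<subseteq> S"
      with update show "Q (Poly_Mapping.update a b f)"
        unfolding eq[symmetric] keys_update by (auto simp: eq split: if_splits intro: assms(3))
    qed
  qed
  with assms(1) show ?thesis by simp
qed

lemma lookup_single_times_add:
  fixes t s :: "'v \<Rightarrow>\<^sub>0 nat"
  shows "lookup (single t z * p) (t + s) = (z :: complex) * lookup p s"
proof -
  have "keys p \<subseteq> UNIV" by simp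
  then show ?thesis
    by (induction p rule: poly_mapping_induct_keys)
      (auto simp: distrib_left mult_single lookup_add lookup_single when_def)
qed

lemma lookup_single_times_eq_0:
  fixes t m :: "'v \<Rightarrow>\<^sub>0 nat" and z :: complex
  assumes "\<nexists>s. m = t + s"
  shows "lookup (single t z * p) m = 0"
proof -
  have "m \<notin> keys (single t z * p)"
    using keys_mult[of "single t z" p] assms by (auto split: if_splits)
  then show ?thesis by (simp add: in_keys_iff)
qed

text \<open>The complex-linear extension of \<open>g\<close> from monomials; homomorphisms and
  derivations are both given in this way.\<close>

definition lin :: "(('v \<Rightarrow>\<^sub>0 nat) \<Rightarrow> 'v cpoly) \<Rightarrow> 'v cpoly \<Rightarrow> 'v cpoly" where
  "lin g f = (\<Sum>m\<in>keys f. pconst (lookup f m) * g m)"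

lemma pconst_0 [simp]: "pconst 0 = 0"
  and pconst_1 [simp]: "pconst 1 = 1"
  and pconst_add: "pconst (a + b) = pconst a + pconst b"
  and pconst_mult: "pconst (a * b) = pconst a * pconst b"
  and pconst_times_single: "pconst a * single m b = single m (a * b)"
  by (simp_all add: pconst_def single_add mult_single)

lemma keys_pconst_times: "keys (pconst z * p) \<subseteq> keys p"
  unfolding pconst_def using keys_mult[of "single 0 z" p] by (auto split: if_splits)

lemma lookup_pconst_times [simp]: "lookup (pconst z * p) m = z * lookup p m"
  unfolding pconst_def using lookup_single_times_add[of 0 z p m] by simp

lemma lin_add: "lin g (f + h) = lin g f + lin g h"
  unfolding lin_def by (rule setsum_keys_plus_distrib) (auto simp: pconst_add distrib_right)

lemma lin_0 [simp]: "lin g 0 = 0"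
  by (simp add: lin_def)

lemma lin_single [simp]: "lin g (single m z) = pconst z * g m"
  by (simp add: lin_def)

lemma keys_lin: "keys (lin g f) \<subseteq> (\<Union>m\<in>keys f. keys (g m))"
proof -
  have "keys (lin g f) \<subseteq> (\<Union>m\<in>keys f. keys (pconst (lookup f m) * g m))"
    unfolding lin_def by (rule keys_sum)
  also have "\<dots> \<subseteq> (\<Union>m\<in>keys f. keys (g m))"
    by (intro UN_mono keys_pconst_times order_refl)
  finally show ?thesis .
qed

text \<open>With \<open>S = - M\<close> this is the normal form modulo the ideal spanned by
  \<open>M\<close>; with a set of monomials of prescribed degree it extracts homogeneous
  components.\<close>

definition keep :: "('v \<Rightarrow>\<^sub>0 nat) set \<Rightarrow> 'v cpoly \<Rightarrow> 'v cpoly" where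
  "keep S p = (\<Sum>m\<in>keys p \<inter> S. single m (lookup p m))"

lemma lookup_keep: "lookup (keep S p) m = (if m \<in> S then lookup p m else 0)"
  by (auto simp: keep_def lookup_sum lookup_single when_def in_keys_iff if_distrib sum.delta)

lemma keys_keep: "keys (keep S p) = keys p \<inter> S"
  by (auto simp: in_keys_iff lookup_keep split: if_splits)

lemma keep_add: "keep S (p + q) = keep S p + keep S q"
  by (intro poly_mapping_eqI) (simp add: lookup_keep lookup_add)

lemma keep_eq_self: "keys p \<subseteq> S \<Longrightarrow> keep S p = p"
  by (intro poly_mapping_eqI) (auto simp: lookup_keep in_keys_iff)

lemma keep_0 [simp]: "keep S 0 = 0"
  by (simp add: keep_def)

section \<open>The polynomial ring, monomial ideals and normal forms\<close>

lemma poly_ring_simps [simp]: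
  "p \<in> carrier (poly_ring V) \<longleftrightarrow> (\<forall>m\<in>keys p. keys m \<subseteq> V)"
  "mult (poly_ring V) = (*)" "one (poly_ring V) = 1" "zero (poly_ring V) = 0" "add (poly_ring V) = (+)"
  by (simp_all add: poly_ring_def)

lemma keys_add_nat: "keys (m + t :: 'v \<Rightarrow>\<^sub>0 nat) = keys m \<union> keys t"
  by (auto simp: in_keys_iff lookup_add)

lemma poly_ring_times_closed:
  "p \<in> carrier (poly_ring V) \<Longrightarrow> q \<in> carrier (poly_ring V) \<Longrightarrow> p * q \<in> carrier (poly_ring V)"
  using keys_mult[of p q] by (fastforce simp: keys_add_nat)

lemma poly_ring_add_closed:
  "p \<in> carrier (poly_ring V) \<Longrightarrow> q \<in> carrier (poly_ring V) \<Longrightarrow> p + q \<in> carrier (poly_ring V)"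
  using keys_add[of p q] by auto

lemma cring_poly_ring: "cring (poly_ring V)"
proof (rule cringI)
  show "abelian_group (poly_ring V)"
  proof (rule abelian_groupI)
    fix x :: "'a cpoly" assume "x \<in> carrier (poly_ring V)"
    then show "\<exists>y\<in>carrier (poly_ring V). y \<oplus>\<^bsub>poly_ring V\<^esub> x = \<zero>\<^bsub>poly_ring V\<^esub>"
      by (intro bexI[of _ "- x"]) (auto simp: in_keys_iff)
  next
    fix x y :: "'a cpoly" assume "x \<in> carrier (poly_ring V)" "y \<in> carrier (poly_ring V)"
    then show "x \<oplus>\<^bsub>poly_ring V\<^esub> y \<in> carrier (poly_ring V)"
      unfolding poly_ring_simps(5) by (rule poly_ring_add_closed)
  qed (auto simp: algebra_simps)
  show "comm_monoid (poly_ring V)"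
  proof (rule comm_monoidI)
    fix x y :: "'a cpoly" assume "x \<in> carrier (poly_ring V)" "y \<in> carrier (poly_ring V)"
    then show "x \<otimes>\<^bsub>poly_ring V\<^esub> y \<in> carrier (poly_ring V)"
      unfolding poly_ring_simps(2) by (rule poly_ring_times_closed)
  qed (auto simp: algebra_simps)
qed (auto simp: algebra_simps)

lemma poly_ring_minus:
  assumes "x \<in> carrier (poly_ring V)"
  shows "\<ominus>\<^bsub>poly_ring V\<^esub> x = - x"
proof -
  interpret cring "poly_ring V" by (rule cring_poly_ring)
  have "- x \<in> carrier (poly_ring V)" using assms by (auto simp: in_keys_iff)
  then show ?thesis using assms by (intro minus_equality) auto
qed

definition monomial_span :: "('v \<Rightarrow>\<^sub>0 nat) set \<Rightarrow> 'v cpoly set" where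
  "monomial_span M = {p. keys p \<subseteq> M}"

text \<open>\<open>M\<close> lists all monomials of the ideal, not its generators, so that
  membership of a polynomial can be read off its support.\<close>

locale monomial_ideal =
  fixes V :: "'v set" and M :: "('v \<Rightarrow>\<^sub>0 nat) set"
  assumes M_V: "m \<in> M \<Longrightarrow> keys m \<subseteq> V"
    and M_add: "m \<in> M \<Longrightarrow> keys t \<subseteq> V \<Longrightarrow> m + t \<in> M"
begin

abbreviation "P \<equiv> poly_ring V"
abbreviation "I \<equiv> monomial_span M"

lemma I_subset: "I \<subseteq> carrier P"
  unfolding monomial_span_def using M_V by (fastforce simp only: poly_ring_simps)

lemma ideal_I: "ideal I P"
proof -
  interpret cring P by (rule cring_poly_ring)
  have mult: "p * q \<in> I" if "p \<in> carrier P" "q \<in> I" for p q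
  proof -
    have "keys (p * q) \<subseteq> {a + b |a b. a \<in> keys p \<and> b \<in> keys q}"
      by (rule keys_mult)
    then show ?thesis
      using that M_add unfolding monomial_span_def by (fastforce simp: add.commute)
  qed
  show ?thesis
  proof (rule idealI)
    show "subgroup I (add_monoid P)"
    proof (rule add.subgroupI)
      fix a b assume "a \<in> I" "b \<in> I"
      then show "a \<oplus>\<^bsub>P\<^esub> b \<in> I" using keys_add[of a b] by (auto simp: monomial_span_def)
    next
      fix a assume a: "a \<in> I"
      then have "a \<in> carrier P" using I_subset by blast
      then have "\<ominus>\<^bsub>P\<^esub> a = - a" by (rule poly_ring_minus)
      with a show "\<ominus>\<^bsub>P\<^esub> a \<in> I" by (auto simp: monomial_span_def in_keys_iff)
    next
      show "I \<subseteq> carrier P" by (rule I_subset)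
      have "0 \<in> I" by (simp add: monomial_span_def)
      then show "I \<noteq> {}" by blast
    qed
  next
    fix a x assume "a \<in> I" "x \<in> carrier P"
    then show "x \<otimes>\<^bsub>P\<^esub> a \<in> I" "a \<otimes>\<^bsub>P\<^esub> x \<in> I"
      using mult[of x a] unfolding poly_ring_simps by (simp_all add: mult.commute)
  qed (rule ring_axioms)
qed

sublocale quotient_ring P I
  by (intro quotient_ring.intro cring_poly_ring ideal_I)

text \<open>A difference lies in \<open>I\<close> exactly when none of its monomials lies outside
  \<open>M\<close>, so a class is known from its coefficients there.\<close>

lemma cl_eq_iff_keep:
  assumes "p \<in> carrier P" "q \<in> carrier P"
  shows "cl p = cl q \<longleftrightarrow> keep (- M) p = keep (- M) q"
proof -
  have "cl p = cl q \<longleftrightarrow> p - q \<in> I"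
    unfolding cl_eq_iff[OF assms] a_minus_def poly_ring_minus[OF assms(2)] by simp
  also have "\<dots> \<longleftrightarrow> keep (- M) p = keep (- M) q"
    by (auto simp: monomial_span_def poly_mapping_eq_iff fun_eq_iff lookup_keep in_keys_iff lookup_minus)
  finally show ?thesis .
qed

text \<open>The monomials outside \<open>M\<close> are a basis of \<open>A\<close>; \<open>nf X\<close> is the expansion of \<open>X\<close> in it.\<close>

definition nf :: "'v cpoly set \<Rightarrow> 'v cpoly" where
  "nf X = keep (- M) (SOME p. p \<in> carrier P \<and> cl p = X)"

lemma nf_cl: "p \<in> carrier P \<Longrightarrow> nf (cl p) = keep (- M) p"
proof -
  assume p: "p \<in> carrier P"
  let ?q = "SOME q. q \<in> carrier P \<and> cl q = cl p"
  have q: "?q \<in> carrier P \<and> cl ?q = cl p"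
    by (rule someI[of "\<lambda>q. q \<in> carrier P \<and> cl q = cl p" p]) (intro conjI p refl)
  show ?thesis unfolding nf_def using q cl_eq_iff_keep[OF conjunct1[OF q] p] by (metis (no_types, lifting))
qed

lemma nf_carrier: 
  assumes "X \<in> carrier A"
  shows "nf X \<in> carrier P" "keys (nf X) \<inter> M = {}"
proof -
  obtain p where p: "p \<in> carrier P" "X = cl p" using assms unfolding carrier_A by blast
  then show "nf X \<in> carrier P" "keys (nf X) \<inter> M = {}"
    by (auto simp: nf_cl keys_keep)
qed

lemma cl_nf:
  assumes "X \<in> carrier A"
  shows "cl (nf X) = X"
proof -
  obtain p where p: "p \<in> carrier P" "X = cl p" using assms unfolding carrier_A by blast
  have "keep (- M) (keep (- M) p) = keep (- M) p"
    by (intro poly_mapping_eqI) (simp add: lookup_keep)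
  then show ?thesis
    using p nf_carrier[OF assms] by (simp only: cl_eq_iff_keep nf_cl)
qed

lemma nf_inj: "X \<in> carrier A \<Longrightarrow> Y \<in> carrier A \<Longrightarrow> nf X = nf Y \<Longrightarrow> X = Y"
  by (metis cl_nf)

lemma nf_zero [simp]: "nf \<zero>\<^bsub>A\<^esub> = 0"
proof -
  have "\<zero>\<^bsub>A\<^esub> = cl 0" using cl_eq_zero_iff[of 0] by (simp add: monomial_span_def)
  then show ?thesis by (simp add: nf_cl)
qed

lemma nf_add:
  assumes "X \<in> carrier A" "Y \<in> carrier A"
  shows "nf (X \<oplus>\<^bsub>A\<^esub> Y) = nf X + nf Y"
proof -
  obtain p q where pq: "p \<in> carrier P" "X = cl p" "q \<in> carrier P" "Y = cl q"
    using assms unfolding carrier_A by blast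
  then have "X \<oplus>\<^bsub>A\<^esub> Y = cl (p + q)" using cl_add[of p q] by simp
  then show ?thesis using pq by (simp only: nf_cl keep_add poly_ring_add_closed)
qed

lemma nf_mult:
  assumes "p \<in> carrier P" "X \<in> carrier A"
  shows "nf (cl p \<otimes>\<^bsub>A\<^esub> X) = keep (- M) (p * nf X)"
proof -
  have "cl p \<otimes>\<^bsub>A\<^esub> X = cl (p * nf X)"
    using cl_mult[OF assms(1) nf_carrier(1)[OF assms(2)]] assms by (simp add: cl_nf)
  then show ?thesis using assms nf_carrier(1)[OF assms(2)] by (simp only: nf_cl poly_ring_times_closed)
qed

end

lemma pconst_times_keep: "keep S (pconst z * q) = pconst z * keep S q"
  by (intro poly_mapping_eqI) (simp add: lookup_keep)

lemma single_eq_pconst_times: "single t z = pconst z * single t 1"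
  by (simp add: pconst_times_single)

section \<open>Homomorphisms as matrices indexed by monomials\<close>

context monomial_ideal
begin

lemma pconst_carrier [simp]: "pconst z \<in> carrier P"
  by (auto simp: pconst_def split: if_splits)

lemma single_carrier [intro]: "keys m \<subseteq> V \<Longrightarrow> single m z \<in> carrier P"
  by (auto split: if_splits)

lemma single_I [intro]: "m \<in> M \<Longrightarrow> single m z \<in> I"
  by (simp add: monomial_span_def)

lemma I_keys: "f \<in> I \<Longrightarrow> keys f \<subseteq> M"
  by (simp add: monomial_span_def)

text \<open>The columns of the matrix of \<open>\<phi>\<close> with respect to monomials.\<close>

definition hc :: "('v cpoly \<Rightarrow> 'v cpoly set) \<Rightarrow> ('v \<Rightarrow>\<^sub>0 nat) \<Rightarrow> 'v cpoly" where
  "hc \<phi> m = nf (\<phi> (single m 1))"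

lemma hc_keys:
  assumes "\<phi> \<in> carrier H" "m \<in> M" "lookup (hc \<phi> m) m' \<noteq> 0"
  shows "m' \<notin> M" "keys m' \<subseteq> V"
proof -
  have m': "m' \<in> keys (hc \<phi> m)" using assms(3) by (simp add: in_keys_iff)
  have "\<phi> (single m 1) \<in> carrier A" using assms by (simp add: Hom_closed single_I)
  then have "hc \<phi> m \<in> carrier P" "keys (hc \<phi> m) \<inter> M = {}"
    unfolding hc_def by (rule nf_carrier)+
  with m' show "m' \<notin> M" "keys m' \<subseteq> V" unfolding poly_ring_simps by blast+
qed

lemma hc_add:
  assumes "\<phi> \<in> carrier H" "m \<in> M" "keys t \<subseteq> V"
  shows "hc \<phi> (m + t) = keep (- M) (single t 1 * hc \<phi> m)"
proof -
  have "\<phi> (single (m + t) 1) = \<phi> (single t 1 \<otimes>\<^bsub>P\<^esub> single m 1)"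
    by (simp add: mult_single add.commute)
  also have "\<dots> = cl (single t 1) \<otimes>\<^bsub>A\<^esub> \<phi> (single m 1)"
    using assms by (intro Hom_mult single_carrier single_I)
  finally show ?thesis
    unfolding hc_def using assms by (simp add: nf_mult Hom_closed single_I single_carrier del: poly_ring_simps)
qed

text \<open>Linearity multiplies the column of \<open>m\<close> by the monomial \<open>t\<close>.
  The entry survives only if its row stays outside \<open>M\<close>, since reduction modulo
  \<open>I\<close> deletes the other rows.\<close>

lemma hc_shift:
  assumes "\<phi> \<in> carrier H" "m \<in> M" "keys t \<subseteq> V" "m' + t \<notin> M"
  shows "lookup (hc \<phi> (m + t)) (m' + t) = lookup (hc \<phi> m) m'"
  using assms lookup_single_times_add[of t 1 "hc \<phi> m" m']
  by (simp add: hc_add lookup_keep add.commute)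

text \<open>The column of \<open>m + t\<close> is the reduced product of the monomial
  \<open>t\<close> with the column of \<open>m\<close>, so its nonzero rows are divisible by
  \<open>t\<close>. This is the device for cancelling common factors.\<close>

lemma hc_shift_nonzero:
  assumes "\<phi> \<in> carrier H" "m \<in> M" "keys t \<subseteq> V" "lookup (hc \<phi> (m + t)) m' \<noteq> 0"
  obtains s where "m' = s + t" "lookup (hc \<phi> m) s = lookup (hc \<phi> (m + t)) m'"
proof -
  have M: "m + t \<in> M" using assms M_add by blast
  have "\<exists>s. m' = t + s"
    using assms lookup_single_times_eq_0[of m' t 1 "hc \<phi> m"]
    by (auto simp: hc_add lookup_keep split: if_splits)
  then obtain s where s: "m' = s + t" by (auto simp: add.commute)
  then have "lookup (hc \<phi> m) s = lookup (hc \<phi> (m + t)) m'"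
    using hc_shift[OF assms(1-3), of s] hc_keys[OF assms(1) M assms(4)] by simp
  with s that show ?thesis by blast
qed

lemma nf_pconst_mult: "X \<in> carrier A \<Longrightarrow> nf (cl (pconst z) \<otimes>\<^bsub>A\<^esub> X) = pconst z * nf X"
  using nf_carrier(2)[of X] keep_eq_self[of "nf X" "- M"]
  by (simp add: nf_mult pconst_times_keep disjoint_eq_subset_Compl del: poly_ring_simps(1))

lemma nf_Hom:
  assumes \<phi>: "\<phi> \<in> carrier H" and f: "f \<in> I"
  shows "nf (\<phi> f) = lin (hc \<phi>) f"
  using I_keys[OF f]
proof (induction f rule: poly_mapping_induct_keys)
  case zero
  have "0 \<in> I" by (simp add: monomial_span_def)
  then have "nf (\<phi> 0) = nf (\<phi> 0) + nf (\<phi> 0)"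
    using Hom_add[OF \<phi>, of 0 0] nf_add[OF Hom_closed[OF \<phi>] Hom_closed[OF \<phi>], of 0 0] by simp
  then show ?case by simp
next
  case (add m z f)
  then have I: "f \<in> I" "single m z \<in> I" by (auto simp: monomial_span_def)
  have "\<phi> (single m z) = \<phi> (pconst z \<otimes>\<^bsub>P\<^esub> single m 1)"
    by (simp add: pconst_times_single)
  also have "\<dots> = cl (pconst z) \<otimes>\<^bsub>A\<^esub> \<phi> (single m 1)"
    using \<phi> add(1) by (intro Hom_mult pconst_carrier single_I)
  finally have "nf (\<phi> (single m z)) = pconst z * hc \<phi> m"
    unfolding hc_def using \<phi> add(1) by (simp add: nf_pconst_mult Hom_closed single_I)
  moreover have "\<phi> (single m z + f) = \<phi> (single m z) \<oplus>\<^bsub>A\<^esub> \<phi> f"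
    using Hom_add[OF \<phi> I(2,1)] by simp
  ultimately show ?case
    using \<phi> I add.IH by (simp add: nf_add Hom_closed lin_add)
qed

lemma Hom_eq_hcI:
  assumes "\<phi> \<in> carrier H" "\<psi> \<in> carrier H" "\<And>m. m \<in> M \<Longrightarrow> hc \<phi> m = hc \<psi> m"
  shows "\<phi> = \<psi>"
proof (rule Hom_eqI[OF assms(1,2)])
  fix f assume f: "f \<in> I"
  have "lin (hc \<phi>) f = lin (hc \<psi>) f"
    unfolding lin_def using assms(3) I_keys[OF f] by (intro sum.cong) auto
  then show "\<phi> f = \<psi> f"
    using f assms by (intro nf_inj) (auto simp: nf_Hom Hom_closed)
qed

lemma hc_Hom_add:
  "\<phi> \<in> carrier H \<Longrightarrow> \<psi> \<in> carrier H \<Longrightarrow> m \<in> M \<Longrightarrow> hc (\<phi> \<oplus>\<^bsub>H\<^esub> \<psi>) m = hc \<phi> m + hc \<psi> m"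
  by (simp add: hc_def Hom_ideal_simps single_I nf_add Hom_closed)

lemma hc_Hom_smult:
  "p \<in> carrier P \<Longrightarrow> \<phi> \<in> carrier H \<Longrightarrow> m \<in> M \<Longrightarrow> hc (cl p \<odot>\<^bsub>H\<^esub> \<phi>) m = keep (- M) (p * hc \<phi> m)"
  by (simp add: hc_def Hom_ideal_simps single_I nf_mult Hom_closed del: poly_ring_simps(1))

lemma hc_Hom_zero: "m \<in> M \<Longrightarrow> hc \<zero>\<^bsub>H\<^esub> m = 0"
  by (simp add: hc_def Hom_ideal_simps single_I)

text \<open>The passage back from columns to homomorphisms: the columns in \<open>g\<close> have to
  be compatible with shifts modulo \<open>I\<close>, and they are recovered up to reduction.\<close>

definition mk_hom :: "(('v \<Rightarrow>\<^sub>0 nat) \<Rightarrow> 'v cpoly) \<Rightarrow> 'v cpoly \<Rightarrow> 'v cpoly set" where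
  "mk_hom g = (\<lambda>f\<in>I. cl (lin g f))"

context
  fixes g :: "('v \<Rightarrow>\<^sub>0 nat) \<Rightarrow> 'v cpoly"
  assumes g_closed: "\<And>m. m \<in> M \<Longrightarrow> g m \<in> carrier P"
    and g_shift: "\<And>m t. m \<in> M \<Longrightarrow> keys t \<subseteq> V \<Longrightarrow> keep (- M) (g (m + t)) = keep (- M) (single t 1 * g m)"
begin

lemma lin_closed: "f \<in> I \<Longrightarrow> lin g f \<in> carrier P"
  using keys_lin[of g f] g_closed I_keys[of f] by fastforce

text \<open>Bilinearity reduces the claim to single terms, where it is \<open>g_shift\<close>. Both
  sides agree only after the monomials in \<open>M\<close> are discarded.\<close>

lemma lin_mult:
  assumes p: "keys p \<subseteq> {t. keys t \<subseteq> V}" and f: "keys f \<subseteq> M"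
  shows "keep (- M) (lin g (p * f)) = keep (- M) (p * lin g f)"
  using p
proof (induction p rule: poly_mapping_induct_keys)
  case (add t z p)
  have "keep (- M) (lin g (single t z * f)) = keep (- M) (single t z * lin g f)"
    using f
  proof (induction f rule: poly_mapping_induct_keys)
    case (add m w f)
    have "keep (- M) (lin g (single t z * single m w)) = pconst (z * w) * keep (- M) (g (m + t))"
      by (simp add: mult_single pconst_times_keep add.commute)
    also have "\<dots> = keep (- M) (single t z * (pconst w * g m))"
      using add(1) \<open>t \<in> {t. keys t \<subseteq> V}\<close>
      by (simp add: g_shift pconst_mult pconst_times_keep[symmetric] single_eq_pconst_times[of t z] mult.assoc mult.left_commute)
    finally show ?case
      using add.IH by (simp add: distrib_left lin_add keep_add)
  qed simp
  with add.IH show ?case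
    by (simp add: distrib_right lin_add keep_add)
qed simp

lemma mk_hom_closed: "mk_hom g \<in> carrier H"
  unfolding mk_hom_def
proof (rule HomI)
  fix f h assume "f \<in> I" "h \<in> I"
  then show "cl (lin g (f \<oplus>\<^bsub>P\<^esub> h)) = cl (lin g f) \<oplus>\<^bsub>A\<^esub> cl (lin g h)"
    using cl_add[OF lin_closed lin_closed] by (simp add: lin_add)
next
  fix p f assume p: "p \<in> carrier P" and f: "f \<in> I"
  have "p * f \<in> I" using I_mult[OF p f] by simp
  then have "cl (lin g (p * f)) = cl (p * lin g f)"
    using lin_mult[of p f] p I_keys[OF f] lin_closed f
    by (subst cl_eq_iff_keep) (auto intro!: poly_ring_times_closed simp del: poly_ring_simps(1), auto)
  then show "cl (lin g (p \<otimes>\<^bsub>P\<^esub> f)) = cl p \<otimes>\<^bsub>A\<^esub> cl (lin g f)"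
    using cl_mult[OF p lin_closed[OF f]] by simp
qed (rule cl_closed, rule lin_closed)

lemma hc_mk_hom: "m \<in> M \<Longrightarrow> hc (mk_hom g) m = keep (- M) (g m)"
  using g_closed by (simp add: hc_def mk_hom_def single_I nf_cl del: poly_ring_simps(1))

end

end

section \<open>The grading of the first cotangent cohomology\<close>

definition mono_deg :: "('v \<Rightarrow>\<^sub>0 nat) \<Rightarrow> ('v \<Rightarrow>\<^sub>0 nat) \<Rightarrow> 'v \<Rightarrow> int" where
  "mono_deg m m' = (\<lambda>v. int (lookup m' v) - int (lookup m v))"

text \<open>On monomials, the derivation \<open>z x\<^sup>\<alpha> \<partial>/\<partial>x\<^sub>p\<close>.\<close>

definition mono_derivation :: "'v \<Rightarrow> ('v \<Rightarrow>\<^sub>0 nat) \<Rightarrow> complex \<Rightarrow> ('v \<Rightarrow>\<^sub>0 nat) \<Rightarrow> 'v cpoly" where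
  "mono_derivation p \<alpha> z m = single (m - single p 1 + \<alpha>) (z * of_nat (lookup m p))"

lemma single_1_add_minus: "lookup n p \<noteq> 0 \<Longrightarrow> n = single p 1 + (n - single p (1 :: nat))"
  by (intro poly_mapping_eqI) (auto simp: lookup_add lookup_minus lookup_single when_def)

lemma mono_derivation_add:
  "mono_derivation p \<alpha> z (m + n) =
     single m 1 * mono_derivation p \<alpha> z n + single n 1 * mono_derivation p \<alpha> z m"
proof -
  \<comment> \<open>Truncated subtraction does no harm: if \<open>p\<close> does not occur in
    \<open>b\<close>, the coefficient is 0, and otherwise one factor can really be split
    off.\<close>
  have *: "single a 1 * mono_derivation p \<alpha> z b = single (a + b - single p 1 + \<alpha>) (z * of_nat (lookup b p))"
    for a b :: "'a \<Rightarrow>\<^sub>0 nat"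
  proof (cases "lookup b p = 0")
    case False
    then obtain b' where b: "b = single p 1 + b'" using single_1_add_minus by metis
    have "a + b = single p 1 + (a + b')" by (simp add: b algebra_simps)
    then show ?thesis by (simp add: b mono_derivation_def mult_single add.assoc)
  qed (simp add: mono_derivation_def)
  show ?thesis
    unfolding * by (simp add: mono_derivation_def lookup_add single_add[symmetric] algebra_simps)
qed

lemma lin_mono_derivation_mult:
  "lin (mono_derivation p \<alpha> z) (f * h) =
     f * lin (mono_derivation p \<alpha> z) h + h * lin (mono_derivation p \<alpha> z) f" (is "?L (f * h) = _")
proof -
  have single: "?L (single m w * h) = single m w * ?L h + h * ?L (single m w)" for m w
  proof -
    have "keys h \<subseteq> UNIV" by simp
    then show ?thesis
    proof (induction h rule: poly_mapping_induct_keys)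
      case (add n y h)
      have "?L (single m w * single n y) = pconst (w * y) * mono_derivation p \<alpha> z (m + n)"
        by (simp add: mult_single)
      also have "\<dots> = single m w * (pconst y * mono_derivation p \<alpha> z n) +
          single n y * (pconst w * mono_derivation p \<alpha> z m)"
        unfolding single_eq_pconst_times[of m w] single_eq_pconst_times[of n y]
        by (simp add: mono_derivation_add pconst_mult algebra_simps)
      finally show ?case using add.IH by (simp add: distrib_left distrib_right lin_add algebra_simps)
    qed simp
  qed
  have "keys f \<subseteq> UNIV" by simp
  then show ?thesis
    by (induction f rule: poly_mapping_induct_keys)
      (simp_all add: distrib_left distrib_right lin_add single)
qed

context monomial_ideal
begin

abbreviation "Cob \<equiv> coboundaries (range pconst) P I"
abbreviation "T \<equiv> T1 (range pconst) P I"
abbreviation "pr \<equiv> (+>\<^bsub>H\<^esub>) Cob"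

text \<open>The ideal is spanned by monomials, and each of them is homogeneous; so the degree
  condition can be tested on matrix entries.\<close>

lemma Hom_homog_iff:
  "\<phi> \<in> Hom_homog V I c \<longleftrightarrow>
     \<phi> \<in> carrier H \<and> (\<forall>m\<in>M. \<forall>m'. lookup (hc \<phi> m) m' \<noteq> 0 \<longrightarrow> mono_deg m m' = c)"
proof safe
  assume \<phi>: "\<phi> \<in> Hom_homog V I c"
  then show "\<phi> \<in> carrier H" by (simp add: Hom_homog_def)
  fix m m' assume m: "m \<in> M" and nz: "lookup (hc \<phi> m) m' \<noteq> 0"
  have single: "single m 1 \<in> I \<inter> poly_homog V (\<lambda>v. int (lookup m v))"
    using m M_V[OF m] by (auto simp: poly_homog_def single_I)
  have "\<forall>e. \<forall>f\<in>I \<inter> poly_homog V e. \<phi> f \<in> cl ` poly_homog V (\<lambda>v. e v + c v)"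
    using \<phi> unfolding Hom_homog_def mem_Collect_eq by (rule conjunct2)
  from bspec[OF spec[OF this] single] obtain p where p: "\<phi> (single m 1) = cl p" "p \<in> poly_homog V (\<lambda>v. int (lookup m v) + c v)"
    by (rule imageE)
  then have "hc \<phi> m = keep (- M) p" by (simp add: hc_def nf_cl poly_homog_def)
  with nz have "m' \<in> keys p" by (auto simp: lookup_keep in_keys_iff split: if_splits)
  with p show "mono_deg m m' = c" by (auto simp: poly_homog_def mono_deg_def)
next
  assume \<phi>: "\<phi> \<in> carrier H" and deg: "\<forall>m\<in>M. \<forall>m'. lookup (hc \<phi> m) m' \<noteq> 0 \<longrightarrow> mono_deg m m' = c"
  have "\<phi> f \<in> cl ` poly_homog V (\<lambda>v. e v + c v)" if f: "f \<in> I" "f \<in> poly_homog V e" for e f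
  proof -
    have "int (lookup m' v) = e v + c v" if m': "m' \<in> keys (nf (\<phi> f))" for m' v
    proof -
      obtain m where m: "m \<in> keys f" "m' \<in> keys (hc \<phi> m)"
        using m' keys_lin[of "hc \<phi>" f] unfolding nf_Hom[OF \<phi> f(1)] by blast
      then have "mono_deg m m' = c" using deg I_keys[OF f(1)] by (auto simp: in_keys_iff)
      moreover have "int (lookup m v) = e v" using m f(2) by (auto simp: poly_homog_def)
      ultimately show ?thesis by (auto simp: mono_deg_def)
    qed
    note deg_nf = this
    have A: "\<phi> f \<in> carrier A" using \<phi> f(1) by (rule Hom_closed)
    \<comment> \<open>The normal form serves as the homogeneous representative that the definition
      asks for.\<close>
    have "nf (\<phi> f) \<in> poly_homog V (\<lambda>v. e v + c v)"
      unfolding poly_homog_def by (intro CollectI conjI ballI allI nf_carrier(1)[OF A] deg_nf)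
    then show ?thesis by (rule image_eqI[where f = cl, OF cl_nf[OF A, symmetric]])
  qed
  with \<phi> show "\<phi> \<in> Hom_homog V I c" by (simp add: Hom_homog_def)
qed

lemma Hom_homog_add: "\<phi> \<in> Hom_homog V I c \<Longrightarrow> \<psi> \<in> Hom_homog V I c \<Longrightarrow> \<phi> \<oplus>\<^bsub>H\<^esub> \<psi> \<in> Hom_homog V I c"
  unfolding Hom_homog_iff by (auto simp: Hom_add_closed hc_Hom_add lookup_add) (metis add_0)

lemma hc_Hom_scale:
  assumes "\<phi> \<in> carrier H" "m \<in> M"
  shows "hc (cl (pconst z) \<odot>\<^bsub>H\<^esub> \<phi>) m = pconst z * hc \<phi> m"
  using assms by (simp add: hc_def Hom_ideal_simps single_I nf_pconst_mult Hom_closed)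

lemma Hom_homog_scale: "\<phi> \<in> Hom_homog V I c \<Longrightarrow> cl (pconst z) \<odot>\<^bsub>H\<^esub> \<phi> \<in> Hom_homog V I c"
  unfolding Hom_homog_iff using cl_closed[OF pconst_carrier] by (auto simp: Hom_smult_closed hc_Hom_scale)

lemma Hom_homog_zero: "\<zero>\<^bsub>H\<^esub> \<in> Hom_homog V I c"
  unfolding Hom_homog_iff by (simp add: Hom_zero_closed hc_Hom_zero)

lemma mono_derivation_coboundary:
  fixes p z
  assumes "keys \<alpha> \<subseteq> V"
  defines "D \<equiv> \<lambda>f. cl (lin (mono_derivation p \<alpha> z) f)"
  shows "restrict D I \<in> Cob" "m \<in> M \<Longrightarrow> hc (restrict D I) m = keep (- M) (mono_derivation p \<alpha> z m)"
proof -
  let ?g = "mono_derivation p \<alpha> z"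
  have g: "?g m \<in> carrier P" if "keys m \<subseteq> V" for m
    using that assms(1) keys_diff[of m "single p 1"]
    by (fastforce simp: mono_derivation_def keys_add_nat in_keys_iff lookup_minus lookup_add split: if_splits)
  have L: "lin ?g f \<in> carrier P" if "f \<in> carrier P" for f
    using that keys_lin[of ?g f] g by fastforce
  have "D \<in> derivations (range pconst) P I"
  proof (rule derivationI)
    fix f h assume f: "f \<in> carrier P" and h: "h \<in> carrier P"
    then show "D (f \<oplus>\<^bsub>P\<^esub> h) = D f \<oplus>\<^bsub>A\<^esub> D h"
      unfolding D_def using cl_add[OF L L] by (simp add: lin_add)
    have "D (f * h) = cl ((f \<otimes>\<^bsub>P\<^esub> lin ?g h) \<oplus>\<^bsub>P\<^esub> (h \<otimes>\<^bsub>P\<^esub> lin ?g f))"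
      by (simp add: D_def lin_mono_derivation_mult)
    also have "\<dots> = (cl f \<otimes>\<^bsub>A\<^esub> D h) \<oplus>\<^bsub>A\<^esub> (cl h \<otimes>\<^bsub>A\<^esub> D f)"
      unfolding D_def using f h L by (simp only: cl_add cl_mult P.m_closed)
    finally show "D (f \<otimes>\<^bsub>P\<^esub> h) = (cl f \<otimes>\<^bsub>A\<^esub> D h) \<oplus>\<^bsub>A\<^esub> (cl h \<otimes>\<^bsub>A\<^esub> D f)"
      by simp
  next
    fix c :: "'v cpoly" assume "c \<in> range pconst"
    then have "lin ?g c = 0" by (auto simp: pconst_def mono_derivation_def)
    then show "D c = \<zero>\<^bsub>A\<^esub>"
      unfolding D_def using cl_eq_zero_iff[of 0] by (simp add: monomial_span_def)
  qed (simp add: D_def L del: poly_ring_simps(1))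
  then show "restrict D I \<in> Cob" by (auto simp: coboundaries_def)
  show "hc (restrict D I) m = keep (- M) (?g m)" if "m \<in> M"
    using that g[OF M_V] by (simp add: hc_def D_def single_I nf_cl del: poly_ring_simps(1))
qed

text \<open>The homomorphisms that map \<open>x\<^sub>p x\<^sub>q\<close> into the ideal \<open>(x\<^sub>p, x\<^sub>q)\<close>; they separate the
  generators of \<open>T\<^sup>1\<close>.\<close>

definition vanishing :: "'v \<Rightarrow> 'v \<Rightarrow> ('v cpoly \<Rightarrow> 'v cpoly set) set" where
  "vanishing p q = {\<phi> \<in> carrier H. \<forall>m'. lookup m' p = 0 \<and> lookup m' q = 0 \<longrightarrow>
     lookup (hc \<phi> (single p 1 + single q 1)) m' = 0}"

text \<open>For scalars: if a product monomial contains neither \<open>p\<close> nor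
  \<open>q\<close>, then neither do its factors, so it cannot arise from a column whose monomials
  all contain \<open>p\<close> or \<open>q\<close>.\<close>

lemma vanishing_submodule:
  assumes M: "single p 1 + single q 1 \<in> M"
  shows "submodule A (vanishing p q) H"
proof
  show "vanishing p q \<subseteq> carrier H" by (auto simp: vanishing_def)
  show "\<zero>\<^bsub>H\<^esub> \<in> vanishing p q" using M by (simp add: vanishing_def Hom_zero_closed hc_Hom_zero)
  fix \<phi> \<psi> assume "\<phi> \<in> vanishing p q" "\<psi> \<in> vanishing p q"
  then show "\<phi> \<oplus>\<^bsub>H\<^esub> \<psi> \<in> vanishing p q"
    using M by (simp add: vanishing_def Hom_add_closed hc_Hom_add lookup_add)
next
  fix r \<phi> assume "r \<in> carrier A" and \<phi>: "\<phi> \<in> vanishing p q"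
  then obtain f where f: "f \<in> carrier P" "r = cl f" unfolding carrier_A by blast
  have "lookup (hc (r \<odot>\<^bsub>H\<^esub> \<phi>) (single p 1 + single q 1)) m' = 0"
    if m': "lookup m' p = 0" "lookup m' q = 0" for m'
  proof (rule ccontr)
    assume "lookup (hc (r \<odot>\<^bsub>H\<^esub> \<phi>) (single p 1 + single q 1)) m' \<noteq> 0"
    then have "m' \<in> keys (f * hc \<phi> (single p 1 + single q 1))"
      using M f \<phi> by (auto simp: hc_Hom_smult vanishing_def lookup_keep in_keys_iff simp del: poly_ring_simps(1) split: if_splits)
    then obtain a b where "m' = a + b" "b \<in> keys (hc \<phi> (single p 1 + single q 1))"
      using keys_mult by blast
    then show False using m' \<phi> by (auto simp: vanishing_def lookup_add in_keys_iff)
  qed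
  moreover have "r \<odot>\<^bsub>H\<^esub> \<phi> \<in> carrier H"
    using \<phi> f(1) unfolding f(2) by (intro Hom_smult_closed cl_closed) (auto simp: vanishing_def)
  ultimately show "r \<odot>\<^bsub>H\<^esub> \<phi> \<in> vanishing p q" by (simp add: vanishing_def)
qed

text \<open>By the Leibniz rule the product of the two variables goes to a sum of two terms, each
  divisible by one of them, and reduction modulo \<open>I\<close> only deletes monomials.\<close>

lemma coboundaries_vanishing:
  assumes "p \<in> V" "q \<in> V" and M: "single p 1 + single q 1 \<in> M"
  shows "Cob \<subseteq> vanishing p q"
proof
  fix \<phi> assume \<phi>: "\<phi> \<in> Cob"
  then have H: "\<phi> \<in> carrier H" using submodule.subset[OF coboundaries_submodule] by blast
  obtain D where D: "D \<in> derivations (range pconst) P I" "\<phi> = restrict D I"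
    using \<phi> by (auto simp: coboundaries_def)
  let ?x = "\<lambda>v. single (single v 1) 1 :: 'v cpoly"
  have x: "?x p \<in> carrier P" "?x q \<in> carrier P" using assms by auto
  have "hc \<phi> (single p 1 + single q 1) = nf (D (?x p \<otimes>\<^bsub>P\<^esub> ?x q))"
    using M by (simp add: hc_def D single_I mult_single)
  also have "\<dots> = nf ((cl (?x p) \<otimes>\<^bsub>A\<^esub> D (?x q)) \<oplus>\<^bsub>A\<^esub> (cl (?x q) \<otimes>\<^bsub>A\<^esub> D (?x p)))"
    using x derivation_mult[OF D(1)] by (simp only:)
  also have "\<dots> = keep (- M) (?x p * nf (D (?x q))) + keep (- M) (?x q * nf (D (?x p)))"
    using x derivation_closed[OF D(1)] by (simp only: nf_add nf_mult A.m_closed cl_closed)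
  finally have hc: "hc \<phi> (single p 1 + single q 1) =
    keep (- M) (?x p * nf (D (?x q))) + keep (- M) (?x q * nf (D (?x p)))" .
  have "lookup (?x v * f) m' = 0" if "lookup m' v = 0" for v m' f
    using that by (intro lookup_single_times_eq_0) (auto simp: lookup_add)
  then show "\<phi> \<in> vanishing p q"
    using H by (simp add: vanishing_def hc lookup_add lookup_keep del: One_nat_def)
qed

lemma pr_closed: "\<phi> \<in> carrier H \<Longrightarrow> pr \<phi> \<in> carrier T"
  unfolding T1_def carrier_quotient_module by (rule imageI)

lemma pr_eq_zero_iff: "\<phi> \<in> carrier H \<Longrightarrow> pr \<phi> = \<zero>\<^bsub>T\<^esub> \<longleftrightarrow> \<phi> \<in> Cob"
  unfolding T1_def by (rule H.quotient_module_eq_zero_iff[OF coboundaries_submodule])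

lemma pr_smult: "r \<in> carrier A \<Longrightarrow> \<phi> \<in> carrier H \<Longrightarrow> r \<odot>\<^bsub>T\<^esub> pr \<phi> = pr (r \<odot>\<^bsub>H\<^esub> \<phi>)"
  unfolding T1_def by (rule H.quotient_module_smult[OF coboundaries_submodule])

lemma pr_add: "\<phi> \<in> carrier H \<Longrightarrow> \<psi> \<in> carrier H \<Longrightarrow> pr \<phi> \<oplus>\<^bsub>T\<^esub> pr \<psi> = pr (\<phi> \<oplus>\<^bsub>H\<^esub> \<psi>)"
  unfolding T1_def by (rule H.quotient_module_add[OF coboundaries_submodule])

lemma carrier_T: "carrier T = pr ` carrier H"
  unfolding T1_def by (rule carrier_quotient_module)

lemma T_module: "module A T"
  unfolding T1_def by (rule H.module_quotient_module[OF coboundaries_submodule])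

lemma pr_zero: "pr \<zero>\<^bsub>H\<^esub> = \<zero>\<^bsub>T\<^esub>"
  using pr_eq_zero_iff[OF Hom_zero_closed] submodule.zero_closed[OF coboundaries_submodule] by blast

lemma T1_graded_eq_0:
  assumes "Hom_homog V I c \<subseteq> Cob"
  shows "carrier (T1_graded V I c) = {\<zero>\<^bsub>T\<^esub>}"
proof -
  have "pr \<phi> = \<zero>\<^bsub>T\<^esub>" if "\<phi> \<in> Hom_homog V I c" for \<phi>
    using that assms by (intro pr_eq_zero_iff[THEN iffD2]) (auto simp only: Hom_homog_iff)
  then have "pr ` Hom_homog V I c = (\<lambda>_. \<zero>\<^bsub>T\<^esub>) ` Hom_homog V I c"
    by (intro image_cong refl)
  also have "\<dots> = {\<zero>\<^bsub>T\<^esub>}" using Hom_homog_zero[of c] by (intro image_constant)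
  finally show ?thesis by (simp add: T1_graded_def)
qed

text \<open>The homogeneous classes form a submodule of \<open>T1\<close> once the scalars are
  restricted along the ring homomorphism that sends z to the class of the constant z.\<close>

lemma T1_graded_vectorspace: "vectorspace class_ring (T1_graded V I c)"
proof -
  let ?h = "\<lambda>z. cl (pconst z)"
  let ?TC = "\<lparr>carrier = carrier T, mult = undefined, one = undefined, zero = \<zero>\<^bsub>T\<^esub>, add = add T,
    smult = (\<lambda>z x. ?h z \<odot>\<^bsub>T\<^esub> x)\<rparr>"
  have h: "?h \<in> Ring.ring_hom class_ring A"
  proof (rule ring_hom_memI)
    fix x y :: complex
    show "cl (pconst x) \<in> carrier A" by (intro cl_closed pconst_carrier)
    show "cl (pconst (x \<otimes>\<^bsub>class_ring\<^esub> y)) = cl (pconst x) \<otimes>\<^bsub>A\<^esub> cl (pconst y)"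
      using cl_mult[OF pconst_carrier pconst_carrier] by (simp add: pconst_mult)
    show "cl (pconst (x \<oplus>\<^bsub>class_ring\<^esub> y)) = cl (pconst x) \<oplus>\<^bsub>A\<^esub> cl (pconst y)"
      using cl_add[OF pconst_carrier pconst_carrier] by (simp add: pconst_add)
    show "cl (pconst \<one>\<^bsub>class_ring\<^esub>) = \<one>\<^bsub>A\<^esub>"
      using I.rcos_ring_hom by (simp add: ring_hom_one[of _ P A, simplified])
  qed
  have cring: "cring (class_ring :: complex ring)"
    using class_field unfolding field_def domain_def by blast
  have TC: "module class_ring ?TC"
    by (rule module_restrict_scalars[OF T_module cring h])
  interpret TC: Module.module class_ring ?TC by (rule TC)
  have "submodule class_ring (pr ` Hom_homog V I c) ?TC"
  proof (rule submodule.intro)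
    show "module class_ring ?TC" by (rule TC)
    show "pr ` Hom_homog V I c \<subseteq> carrier ?TC"
      using pr_closed by (simp add: Hom_homog_iff image_subset_iff)
    show "\<zero>\<^bsub>?TC\<^esub> \<in> pr ` Hom_homog V I c"
      using imageI[OF Hom_homog_zero, of pr c] by (simp add: pr_zero)
  next
    fix x y assume x: "x \<in> pr ` Hom_homog V I c" and y: "y \<in> pr ` Hom_homog V I c"
    obtain \<phi> where \<phi>: "x = pr \<phi>" "\<phi> \<in> Hom_homog V I c" using x by (rule imageE)
    obtain \<psi> where \<psi>: "y = pr \<psi>" "\<psi> \<in> Hom_homog V I c" using y by (rule imageE)
    note * = \<phi> \<psi>
    then have "x \<oplus>\<^bsub>T\<^esub> y = pr (\<phi> \<oplus>\<^bsub>H\<^esub> \<psi>)" by (simp add: pr_add Hom_homog_iff)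
    then show "x \<oplus>\<^bsub>?TC\<^esub> y \<in> pr ` Hom_homog V I c" using * by (simp add: Hom_homog_add)
  next
    fix z :: complex and x assume "x \<in> pr ` Hom_homog V I c"
    then obtain \<phi> where *: "x = pr \<phi>" "\<phi> \<in> Hom_homog V I c" by (rule imageE)
    then have "?h z \<odot>\<^bsub>T\<^esub> x = pr (?h z \<odot>\<^bsub>H\<^esub> \<phi>)"
      using pr_smult[OF cl_closed[OF pconst_carrier]] by (simp add: Hom_homog_iff)
    then show "z \<odot>\<^bsub>?TC\<^esub> x \<in> pr ` Hom_homog V I c" using * by (simp add: Hom_homog_scale)
  qed
  then have "module class_ring (?TC\<lparr>carrier := pr ` Hom_homog V I c\<rparr>)"
    by (rule TC.submodule_is_module)
  then have "module class_ring (T1_graded V I c)"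
    by (simp add: T1_graded_def)
  then show ?thesis
    by (intro vectorspace.intro class_field.field_axioms)
qed

lemma T1_graded_has_dim_1:
  assumes \<gamma>: "\<gamma> \<in> Hom_homog V I c" "\<gamma> \<notin> Cob"
    and span: "\<And>\<phi>. \<phi> \<in> Hom_homog V I c \<Longrightarrow> \<exists>z. \<phi> = cl (pconst z) \<odot>\<^bsub>H\<^esub> \<gamma>"
  shows "has_dim class_ring (T1_graded V I c) 1"
proof (rule has_dim_1I[OF T1_graded_vectorspace])
  have H: "\<gamma> \<in> carrier H" using \<gamma> by (simp add: Hom_homog_iff)
  show "pr \<gamma> \<in> carrier (T1_graded V I c)" using \<gamma> by (simp add: T1_graded_def)
  show "pr \<gamma> \<noteq> \<zero>\<^bsub>T1_graded V I c\<^esub>" using pr_eq_zero_iff[OF H] \<gamma> by (simp add: T1_graded_def)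
  fix y assume "y \<in> carrier (T1_graded V I c)"
  then have "y \<in> pr ` Hom_homog V I c" by (simp add: T1_graded_def)
  then obtain \<phi> where \<phi>: "y = pr \<phi>" "\<phi> \<in> Hom_homog V I c" by (rule imageE)
  with span obtain z where "\<phi> = cl (pconst z) \<odot>\<^bsub>H\<^esub> \<gamma>" by blast
  then have "y = z \<odot>\<^bsub>T1_graded V I c\<^esub> pr \<gamma>"
    using \<phi> pr_smult[OF cl_closed[OF pconst_carrier] H] by (simp add: T1_graded_def)
  then show "\<exists>z\<in>carrier class_ring. y = z \<odot>\<^bsub>T1_graded V I c\<^esub> pr \<gamma>" by (intro bexI) simp_all
qed

end

lemma add_minus_single: "lookup s v = 0 \<or> lookup u v \<noteq> 0 \<Longrightarrow> s = 0 \<or> s = single v (1::nat) \<Longrightarrow> u = s + (u - s)"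
  by (intro poly_mapping_eqI) (auto simp: lookup_add lookup_minus lookup_single when_def)

lemma keys_single_1_add_minus: "v \<in> keys u \<Longrightarrow> u = single v 1 + (u - single v (1::nat))"
  by (rule single_1_add_minus) (simp add: in_keys_iff)

lemma keys_minus_nat: "keys (u - s :: 'v \<Rightarrow>\<^sub>0 nat) \<subseteq> keys u"
  by (auto simp: in_keys_iff lookup_minus)

text \<open>Negative parts are moved across, which turns the equation of signed degrees into one of
  natural exponents.\<close>

lemma mono_deg_eq_iff:
  "mono_deg m m' = (\<lambda>v. int (lookup \<alpha> v) - int (lookup \<beta> v)) \<longleftrightarrow> m' + \<beta> = m + \<alpha>"
proof -
  have "int x' - int x = int a - int b \<longleftrightarrow> x' + b = x + a" for x x' a b :: nat by linarith
  then show ?thesis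
    by (simp add: mono_deg_def fun_eq_iff poly_mapping_eq_iff lookup_add)
qed

text \<open>At each variable \<alpha> or \<beta> is 0; in either case the equation gives that the
  exponent in \<open>m\<close> is at least the one in \<beta>. So \<open>u = m - \<beta>\<close> is
  an honest difference.\<close>

lemma disjoint_add_eqE:
  fixes \<alpha> \<beta> m m' :: "'v \<Rightarrow>\<^sub>0 nat"
  assumes "m' + \<beta> = m + \<alpha>" "keys \<alpha> \<inter> keys \<beta> = {}"
  obtains u where "m = \<beta> + u" "m' = \<alpha> + u"
proof
  have "lookup m' v + lookup \<beta> v = lookup m v + lookup \<alpha> v" for v
    using assms(1) by (metis lookup_add)
  moreover have "lookup \<alpha> v = 0 \<or> lookup \<beta> v = 0" for v
    using assms(2) by (auto simp: in_keys_iff)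
  ultimately have *: "lookup m v = lookup \<beta> v + (lookup m v - lookup \<beta> v)"
    "lookup m' v = lookup \<alpha> v + (lookup m v - lookup \<beta> v)" for v
    by (metis add_cancel_right_right add_diff_cancel_right' add_diff_cancel_left' add.commute)+
  then show "m = \<beta> + (m - \<beta>)" "m' = \<alpha> + (m - \<beta>)"
    by (auto intro!: poly_mapping_eqI simp: lookup_add lookup_minus)
qed

section \<open>Decomposition into homogeneous components\<close>

context monomial_ideal
begin

definition deg_part :: "('v \<Rightarrow> int) set \<Rightarrow> ('v cpoly \<Rightarrow> 'v cpoly set) \<Rightarrow> 'v cpoly \<Rightarrow> 'v cpoly set" where
  "deg_part C \<phi> = mk_hom (\<lambda>m. keep {m'. mono_deg m m' \<in> C} (hc \<phi> m))"

text \<open>Multiplying source and target by the same monomial keeps their degree difference. Hence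
  selecting entries by degree commutes with shifts, and the selected columns again define a
  homomorphism.\<close>

lemma
  assumes \<phi>: "\<phi> \<in> carrier H"
  shows deg_part_closed: "deg_part C \<phi> \<in> carrier H"
    and hc_deg_part: "m \<in> M \<Longrightarrow> hc (deg_part C \<phi>) m = keep {m'. mono_deg m m' \<in> C} (hc \<phi> m)"
proof -
  let ?g = "\<lambda>m. keep {m'. mono_deg m m' \<in> C} (hc \<phi> m)"
  have closed: "?g m \<in> carrier P" if "m \<in> M" for m
    using hc_keys(2)[OF \<phi> that] by (auto simp: keys_keep in_keys_iff)
  have shift: "keep (- M) (?g (m + t)) = keep (- M) (single t 1 * ?g m)"
    if m: "m \<in> M" and t: "keys t \<subseteq> V" for m t
  proof (rule poly_mapping_eqI)
    fix m'
    show "lookup (keep (- M) (?g (m + t))) m' = lookup (keep (- M) (single t 1 * ?g m)) m'"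
    proof (cases "\<exists>s. m' = t + s")
      case True
      then obtain s where s: "m' = t + s" by blast
      have "mono_deg (m + t) (t + s) = mono_deg m s"
        by (auto simp: mono_deg_def lookup_add)
      moreover have "lookup (hc \<phi> (m + t)) (t + s) = lookup (hc \<phi> m) s" if "t + s \<notin> M"
        using hc_shift[OF \<phi> m t, of s] that by (simp add: add.commute)
      ultimately show ?thesis
        by (simp add: s lookup_keep lookup_single_times_add)
    next
      case False
      then show ?thesis
        using hc_add[OF \<phi> m t] by (simp add: lookup_keep lookup_single_times_eq_0)
    qed
  qed
  show "deg_part C \<phi> \<in> carrier H"
    unfolding deg_part_def by (rule mk_hom_closed[OF closed shift])
  show "hc (deg_part C \<phi>) m = ?g m" if m: "m \<in> M"
  proof -
    have "keep (- M) (?g m) = ?g m"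
      by (intro keep_eq_self) (use hc_keys(1)[OF \<phi> m] in \<open>auto simp: keys_keep in_keys_iff\<close>)
    then show ?thesis unfolding deg_part_def by (simp only: hc_mk_hom[OF closed shift m])
  qed
qed

text \<open>The columns of the finitely many monomials in \<open>B\<close> have finitely many
  nonzero entries, whose degrees form \<open>C\<close>. Any other entry is a shift of one of these
  and has the same degree, so \<phi> is the sum of its parts of degree in \<open>C\<close>, all of
  which lie in \<open>N\<close>.\<close>

lemma carrier_H_subsetI:
  assumes B: "finite B" "B \<subseteq> M" "\<And>m. m \<in> M \<Longrightarrow> \<exists>b\<in>B. \<exists>t. m = b + t \<and> keys t \<subseteq> V"
    and N: "submodule A N H"
    and homog: "\<And>m m'. m \<in> M \<Longrightarrow> keys m' \<subseteq> V \<Longrightarrow> m' \<notin> M \<Longrightarrow> Hom_homog V I (mono_deg m m') \<subseteq> N"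
  shows "carrier H \<subseteq> N"
proof
  fix \<phi> assume \<phi>: "\<phi> \<in> carrier H"
  interpret N: submodule A N H by (rule N)
  define C where "C = (\<Union>b\<in>B. mono_deg b ` keys (hc \<phi> b))"
  have "finite C" using B by (simp add: C_def)
  moreover have "\<exists>m m'. m \<in> M \<and> keys m' \<subseteq> V \<and> m' \<notin> M \<and> c = mono_deg m m'" if "c \<in> C" for c
    using that B(2) hc_keys[OF \<phi>] unfolding C_def in_keys_iff by blast
  ultimately have "deg_part C \<phi> \<in> N"
  proof (induction C rule: finite_induct)
    case empty
    have "deg_part {} \<phi> = \<zero>\<^bsub>H\<^esub>"
      by (intro Hom_eq_hcI deg_part_closed[OF \<phi>] Hom_zero_closed) (simp add: hc_deg_part[OF \<phi>] hc_Hom_zero keep_def)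
    then show ?case by simp
  next
    case (insert c C)
    have "deg_part {c} \<phi> \<in> Hom_homog V I c"
      by (auto simp: Hom_homog_iff deg_part_closed[OF \<phi>] hc_deg_part[OF \<phi>] lookup_keep)
    then have "deg_part {c} \<phi> \<in> N" using insert.prems homog by blast
    moreover have "deg_part C \<phi> \<in> N" using insert by blast
    moreover have "deg_part (insert c C) \<phi> = deg_part {c} \<phi> \<oplus>\<^bsub>H\<^esub> deg_part C \<phi>"
    proof (intro Hom_eq_hcI Hom_add_closed deg_part_closed[OF \<phi>])
      fix m assume m: "m \<in> M"
      show "hc (deg_part (insert c C) \<phi>) m = hc (deg_part {c} \<phi> \<oplus>\<^bsub>H\<^esub> deg_part C \<phi>) m"
        unfolding hc_Hom_add[OF deg_part_closed[OF \<phi>] deg_part_closed[OF \<phi>] m] hc_deg_part[OF \<phi> m]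
        using insert.hyps by (intro poly_mapping_eqI) (auto simp: lookup_keep lookup_add)
    qed
    ultimately show ?case by simp
  qed
  moreover have "deg_part C \<phi> = \<phi>"
  proof (intro Hom_eq_hcI deg_part_closed[OF \<phi>] \<phi>)
    fix m assume m: "m \<in> M"
    have "mono_deg m m' \<in> C" if nz: "lookup (hc \<phi> m) m' \<noteq> 0" for m'
    proof -
      obtain b t where b: "b \<in> B" "m = b + t" "keys t \<subseteq> V" using B(3)[OF m] by blast
      have bM: "b \<in> M" using B b(1) by blast
      have nz': "lookup (hc \<phi> (b + t)) m' \<noteq> 0" using nz b(2) by simp
      obtain s where s: "m' = s + t" "lookup (hc \<phi> b) s = lookup (hc \<phi> (b + t)) m'"
        by (rule hc_shift_nonzero[OF \<phi> bM b(3) nz'])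
      with nz' have s: "m' = s + t" "lookup (hc \<phi> b) s \<noteq> 0" by simp_all
      then have "mono_deg m m' = mono_deg b s" by (auto simp: b mono_deg_def lookup_add)
      moreover have "s \<in> keys (hc \<phi> b)" using s(2) by (simp add: in_keys_iff)
      ultimately show ?thesis unfolding C_def by (intro UN_I[OF b(1)]) simp
    qed
    then show "hc (deg_part C \<phi>) m = hc \<phi> m"
      unfolding hc_deg_part[OF \<phi> m] by (intro keep_eq_self) (auto simp: in_keys_iff)
  qed
  ultimately show "\<phi> \<in> N" by simp
qed

end

section \<open>Ideals generated by quadratic squarefree monomials\<close>

text \<open>\<open>connected\<close> lets coefficients be compared along \<open>w\<close>,
  \<open>w''\<close>, \<open>w'\<close> among the vertices that cross \<open>p\<close>. Its last
  clause ensures that a set of vertices compatible with \<open>w\<close> and \<open>w'\<close> is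
  compatible with \<open>w''\<close>.\<close>

locale flag_ideal =
  fixes V :: "'v set" and cr :: "'v \<Rightarrow> 'v \<Rightarrow> bool"
  assumes fin: "finite V"
    and cr_sym: "cr d e \<Longrightarrow> cr e d"
    and cr_irrefl: "\<not> cr d d"
    and connected: "p \<in> V \<Longrightarrow> w \<in> V \<Longrightarrow> w' \<in> V \<Longrightarrow> cr w p \<Longrightarrow> cr w' p \<Longrightarrow> cr w w' \<Longrightarrow>
      \<exists>w''\<in>V. cr w'' p \<and> \<not> cr w w'' \<and> \<not> cr w' w'' \<and> (\<forall>d\<in>V. cr d w'' \<longrightarrow> cr d w \<or> cr d w')"
begin

definition M :: "('v \<Rightarrow>\<^sub>0 nat) set" where
  "M = {m. keys m \<subseteq> V \<and> (\<exists>d\<in>keys m. \<exists>e\<in>keys m. cr d e)}"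

sublocale monomial_ideal V M
  by standard (auto simp: M_def keys_add_nat)

lemma M_I: "d \<in> keys m \<Longrightarrow> e \<in> keys m \<Longrightarrow> cr d e \<Longrightarrow> keys m \<subseteq> V \<Longrightarrow> m \<in> M"
  by (auto simp: M_def)

lemma M_mono: "m \<in> M \<Longrightarrow> keys m \<subseteq> keys m' \<Longrightarrow> keys m' \<subseteq> V \<Longrightarrow> m' \<in> M"
  by (auto simp: M_def)

lemma pair_M: "p \<in> V \<Longrightarrow> q \<in> V \<Longrightarrow> cr p q \<Longrightarrow> single p 1 + single q 1 \<in> M"
  by (auto simp: M_def keys_add_nat)

text \<open>For \<open>a\<close> a face and \<open>b = {p, q}\<close> a non-edge this is the condition for \<open>T\<^sup>1\<^bsub>a-b\<^esub> \<noteq> 0\<close>: a vertex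
  compatible with \<open>a\<close> is compatible with \<open>p\<close> and \<open>q\<close>, apart from \<open>p\<close> and \<open>q\<close> themselves.\<close>

definition good :: "'v set \<Rightarrow> 'v \<Rightarrow> 'v \<Rightarrow> bool" where
  "good a p q \<longleftrightarrow> (\<forall>d\<in>a. \<forall>e\<in>a. \<not> cr d e) \<and> p \<notin> a \<and> q \<notin> a \<and>
     (\<forall>w\<in>V. w \<noteq> p \<longrightarrow> w \<noteq> q \<longrightarrow> (\<forall>d\<in>a. \<not> cr d w) \<longrightarrow> \<not> cr w p \<and> \<not> cr w q)"

lemma good_commute: "good a p q \<longleftrightarrow> good a q p"
  by (auto simp: good_def)

context
  fixes \<alpha> \<beta> :: "'v \<Rightarrow>\<^sub>0 nat" and c :: "'v \<Rightarrow> int"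
  assumes \<alpha>_V: "keys \<alpha> \<subseteq> V" and disj: "keys \<alpha> \<inter> keys \<beta> = {}"
    and c: "c = (\<lambda>v. int (lookup \<alpha> v) - int (lookup \<beta> v))"
begin

lemma homog_entryE:
  assumes "\<phi> \<in> Hom_homog V I c" "m \<in> M" "lookup (hc \<phi> m) m' \<noteq> 0"
  obtains u where "m = \<beta> + u" "m' = \<alpha> + u"
proof -
  have "mono_deg m m' = c" using assms by (simp add: Hom_homog_iff)
  then have "m' + \<beta> = m + \<alpha>" unfolding c mono_deg_eq_iff .
  then show ?thesis using disj that by (rule disjoint_add_eqE)
qed

text \<open>All other entries vanish: by degree if they are not of the form
  \<open>(\<beta> + u, \<alpha> + u)\<close>, and by reduction modulo \<open>I\<close> if
  \<open>\<alpha> + u\<close> lies in \<open>M\<close>.\<close>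

lemma homog_eqI:
  assumes "\<phi> \<in> Hom_homog V I c" "\<psi> \<in> Hom_homog V I c"
    and "\<And>u. \<beta> + u \<in> M \<Longrightarrow> \<alpha> + u \<notin> M \<Longrightarrow> lookup (hc \<phi> (\<beta> + u)) (\<alpha> + u) = lookup (hc \<psi> (\<beta> + u)) (\<alpha> + u)"
  shows "\<phi> = \<psi>"
proof (rule Hom_eq_hcI)
  show H: "\<phi> \<in> carrier H" "\<psi> \<in> carrier H" using assms(1,2) by (simp_all add: Hom_homog_iff)
  fix m assume m: "m \<in> M"
  show "hc \<phi> m = hc \<psi> m"
  proof (rule poly_mapping_eqI, rule ccontr)
    fix m' assume neq: "lookup (hc \<phi> m) m' \<noteq> lookup (hc \<psi> m) m'"
    then have "lookup (hc \<phi> m) m' \<noteq> 0 \<or> lookup (hc \<psi> m) m' \<noteq> 0" by auto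
    then obtain u where u: "m = \<beta> + u" "m' = \<alpha> + u"
      using homog_entryE[OF assms(1) m] homog_entryE[OF assms(2) m] by metis
    moreover have "m' \<notin> M" using neq hc_keys(1)[OF _ m] H by metis
    ultimately show False using neq assms(3) m by simp
  qed
qed

text \<open>An entry of the matrix can be moved to the smallest \<open>u\<close> for which \<open>\<beta> + u\<close> still contains the given
  crossing pair; there no factor of \<open>x\<^sup>\<beta>\<close> can be split off, since \<open>x\<^sup>\<alpha>\<^sup>+\<^sup>u\<close> is not divisible by it.\<close>

lemma nonzero_entry_cases:
  assumes \<phi>: "\<phi> \<in> carrier H" and M: "\<beta> + u \<in> M" and nz: "lookup (hc \<phi> (\<beta> + u)) (\<alpha> + u) \<noteq> 0"
  shows "(\<exists>p\<in>V. \<exists>q\<in>V. cr p q \<and> \<beta> = single p 1 + single q 1) \<or>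
    (\<exists>p\<in>V. \<beta> = single p 1)"
proof -
  have uV: "keys \<beta> \<subseteq> V" "keys u \<subseteq> V" using M by (auto simp: M_def keys_add_nat)
  have au: "\<alpha> + u \<notin> M" using hc_keys[OF \<phi> M nz] by simp
  obtain d e where de: "d \<in> keys (\<beta> + u)" "e \<in> keys (\<beta> + u)" "cr d e" "d \<in> keys \<beta>"
  proof -
    obtain d e where de: "d \<in> keys (\<beta> + u)" "e \<in> keys (\<beta> + u)" "cr d e" using M by (auto simp: M_def)
    \<comment> \<open>A crossing pair inside \<open>u\<close> would put the target monomial
      \<open>\<alpha> + u\<close> into \<open>M\<close>; so at least one of the two belongs to
      \<beta>, and by symmetry it may be called \<open>d\<close>.\<close>
    have "\<not> (d \<in> keys u \<and> e \<in> keys u)" using au de(3) \<alpha>_V uV by (auto simp: M_def keys_add_nat)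
    then have "d \<in> keys \<beta> \<or> e \<in> keys \<beta>" using de by (auto simp: keys_add_nat)
    with that de cr_sym show ?thesis by blast
  qed
  have "d \<noteq> e" using de cr_irrefl by auto
  define s where "s = (if e \<in> keys \<beta> then 0 else single e (1::nat))"
  have u: "u = s + (u - s)"
    using de by (intro add_minus_single[of _ e]) (auto simp: s_def keys_add_nat in_keys_iff)
  have s: "keys (\<beta> + s) = keys \<beta> \<union> {e}" "keys s \<inter> keys \<beta> = {}"
    by (auto simp: s_def keys_add_nat)
  have sM: "\<beta> + s \<in> M" using de s uV by (intro M_I[of d _ e]) (auto simp: keys_add_nat)
  have t: "keys (u - s) \<subseteq> V" using uV keys_minus_nat by fastforce
  have "lookup (hc \<phi> (\<beta> + s)) (\<alpha> + s) = lookup (hc \<phi> (\<beta> + u)) (\<alpha> + u)"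
    using hc_shift[OF \<phi> sM t, of "\<alpha> + s"] au u by (metis add.assoc)
  with nz have nz': "lookup (hc \<phi> (\<beta> + s)) (\<alpha> + s) \<noteq> 0" by simp
  \<comment> \<open>If the source stayed in \<open>M\<close> without one factor \<open>v\<close>,
    then \<open>v\<close> would have to divide the target; but \<open>v\<close> belongs to \<beta>
    and hence neither to \<alpha> nor to \<open>s\<close>.\<close>
  have no_factor: "\<beta> + s - single v 1 \<notin> M" if v: "v \<in> keys \<beta>" for v
  proof
    assume v': "\<beta> + s - single v 1 \<in> M"
    have eq: "\<beta> + s = (\<beta> + s - single v 1) + single v 1"
      using keys_single_1_add_minus[of v "\<beta> + s"] v s by (metis UnI1 add.commute)
    have kv: "keys (single v (1::nat)) \<subseteq> V" using v uV by auto
    obtain r where "\<alpha> + s = r + single v 1"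
      using hc_shift_nonzero[OF \<phi> v' kv, of "\<alpha> + s"] nz' unfolding eq[symmetric] by blast
    then have "v \<in> keys (\<alpha> + s)" by (simp add: keys_add_nat)
    with v s(2) disj show False by (auto simp: keys_add_nat)
  qed
  have lookup_s: "lookup \<beta> e \<noteq> 0 \<or> lookup s e = 1" "lookup \<beta> d \<noteq> 0"
    using de by (auto simp: s_def in_keys_iff)
  \<comment> \<open>Otherwise removing a single factor \<open>v\<close> leaves both \<open>d\<close>
    and \<open>e\<close>, which \<open>no_factor\<close> forbids.\<close>
  have one: "v \<in> {d, e} \<and> lookup \<beta> v = 1" if v: "v \<in> keys \<beta>" for v
  proof (rule ccontr)
    assume v': "\<not> (v \<in> {d, e} \<and> lookup \<beta> v = 1)"
    have "d \<in> keys (\<beta> + s - single v 1)" "e \<in> keys (\<beta> + s - single v 1)"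
      using v v' lookup_s \<open>d \<noteq> e\<close>
      by (auto simp: in_keys_iff lookup_add lookup_minus lookup_single when_def)
    moreover have "keys (\<beta> + s - single v 1) \<subseteq> V"
      using keys_minus_nat[of "\<beta> + s" "single v 1"] s(1) uV de by (auto simp: keys_add_nat)
    ultimately have "\<beta> + s - single v 1 \<in> M" using de(3) by (intro M_I)
    with no_factor[OF v] show False by simp
  qed
  have dV: "d \<in> V" "e \<in> V" using de uV by (auto simp: keys_add_nat)
  show ?thesis
  proof (cases "e \<in> keys \<beta>")
    case True
    then have "lookup \<beta> v = lookup (single d 1 + single e 1) v" for v
      using one[of v] one[of d] one[of e] de(4) \<open>d \<noteq> e\<close>
      by (cases "v \<in> keys \<beta>") (auto simp: lookup_add lookup_single when_def in_keys_iff)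
    then have "\<beta> = single d 1 + single e 1" by (rule poly_mapping_eqI)
    then show ?thesis using dV de by blast
  next
    case False
    then have "lookup \<beta> v = lookup (single d 1) v" for v
      using one[of v] one[of d] de(4) \<open>d \<noteq> e\<close>
      by (cases "v \<in> keys \<beta>") (auto simp: lookup_single when_def in_keys_iff)
    then have "\<beta> = single d 1" by (rule poly_mapping_eqI)
    then show ?thesis using dV by blast
  qed
qed

end

end

section \<open>The homomorphisms attached to a crossing pair\<close>

context flag_ideal
begin

abbreviation mpair :: "'v \<Rightarrow> 'v \<Rightarrow> 'v \<Rightarrow>\<^sub>0 nat" where
  "mpair p q \<equiv> single p 1 + single q 1"

definition gen_fun :: "('v \<Rightarrow>\<^sub>0 nat) \<Rightarrow> 'v \<Rightarrow> 'v \<Rightarrow> ('v \<Rightarrow>\<^sub>0 nat) \<Rightarrow> 'v cpoly" where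
  "gen_fun \<alpha> p q m =
     (if p \<in> keys m \<and> q \<in> keys m then single (m - (single p 1 + single q 1) + \<alpha>) 1 else 0)"

text \<open>The homomorphism with \<open>x\<^sub>p x\<^sub>q \<mapsto> x\<^sup>\<alpha>\<close> that is zero on the generators of \<open>I\<close> other than \<open>x\<^sub>p x\<^sub>q\<close>.\<close>

definition gen_hom :: "('v \<Rightarrow>\<^sub>0 nat) \<Rightarrow> 'v \<Rightarrow> 'v \<Rightarrow> 'v cpoly \<Rightarrow> 'v cpoly set" where
  "gen_hom \<alpha> p q = mk_hom (gen_fun \<alpha> p q)"

lemma gen_hom_commute: "gen_hom \<alpha> p q = gen_hom \<alpha> q p"
  by (auto simp: gen_hom_def gen_fun_def add.commute intro!: arg_cong[of _ _ mk_hom])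

lemma keys_pair_minus:
  "p \<noteq> q \<Longrightarrow> p \<in> keys m \<Longrightarrow> q \<in> keys m \<Longrightarrow> m = (single p 1 + single q (1::nat)) + (m - (single p 1 + single q 1))"
  by (intro poly_mapping_eqI) (auto simp: lookup_add lookup_minus lookup_single when_def in_keys_iff)

context
  fixes \<alpha> :: "'v \<Rightarrow>\<^sub>0 nat" and p q :: 'v
  assumes \<alpha>_V: "keys \<alpha> \<subseteq> V" and pq: "p \<in> V" "q \<in> V" "cr p q" and good: "good (keys \<alpha>) p q"
begin

lemma p_neq_q: "p \<noteq> q"
  using pq cr_irrefl by auto

lemma mpair_M: "mpair p q \<in> M"
  using pq by (rule pair_M)

lemma good_disjoint: "keys \<alpha> \<inter> keys (mpair p q) = {}"
  using good by (auto simp: good_def keys_add_nat)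

lemma good_not_M: "\<alpha> \<notin> M"
  using good by (auto simp: good_def M_def)

lemma gen_fun_pair: "gen_fun \<alpha> p q (mpair p q + u) = single (\<alpha> + u) 1"
  by (simp add: gen_fun_def keys_add_nat add.commute del: One_nat_def)

text \<open>This is the well-definedness of \<open>gen_hom\<close>: it maps the monomial
  \<open>m\<close> to 0, so the value prescribed at its multiple \<open>m + t\<close> must be 0 in
  A. If \<open>\<alpha> + u\<close> were outside \<open>M\<close>, every vertex of \<open>u\<close>
  other than \<open>p\<close>, \<open>q\<close> would be compatible with \<alpha> and by goodness
  cross neither of them. The only crossing pair left for \<open>m\<close> is \<open>p\<close>,
  \<open>q\<close>, which it does not contain.\<close>

lemma good_zero:
  assumes u: "m + t = mpair p q + u" "m \<in> M" "\<not> (p \<in> keys m \<and> q \<in> keys m)" "keys t \<subseteq> V"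
  shows "\<alpha> + u \<in> M"
proof (rule ccontr)
  assume nM: "\<alpha> + u \<notin> M"
  have "m + t \<in> M" using u by (intro M_add)
  then have uV: "keys u \<subseteq> V" unfolding u(1) by (auto simp: M_def keys_add_nat)
  have face: "\<not> cr d e" if "d \<in> keys (\<alpha> + u)" "e \<in> keys (\<alpha> + u)" for d e
    using nM that \<alpha>_V uV by (auto simp: M_def keys_add_nat)
  have uK: "w \<in> keys u \<union> {p, q}" if "w \<in> keys m" for w
  proof -
    have "w \<in> keys (m + t)" using that by (simp add: keys_add_nat)
    then show ?thesis unfolding u(1) by (auto simp: keys_add_nat)
  qed
  have ncr: "\<not> cr w p \<and> \<not> cr w q" if w: "w \<in> keys u" "w \<noteq> p" "w \<noteq> q" for w
  proof -
    have "\<forall>d\<in>keys \<alpha>. \<not> cr d w" using face w(1) by (auto simp: keys_add_nat)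
    then show ?thesis using good w uV unfolding good_def by blast
  qed
  obtain d e where de: "d \<in> keys m" "e \<in> keys m" "cr d e" using u(2) by (auto simp: M_def)
  have "\<not> (d \<in> keys u \<and> e \<in> keys u)" using face de by (auto simp: keys_add_nat)
  moreover have "d \<noteq> e" using de cr_irrefl by auto
  ultimately show False
    using uK[OF de(1)] uK[OF de(2)] ncr[of d] ncr[of e] de u(3) cr_sym[OF de(3)] cr_irrefl by blast
qed

lemma gen_fun_closed: "m \<in> M \<Longrightarrow> gen_fun \<alpha> p q m \<in> carrier P"
  using \<alpha>_V M_V[of m] keys_minus_nat[of m "mpair p q"] by (auto simp: gen_fun_def keys_add_nat simp del: One_nat_def)

lemma gen_fun_shift:
  assumes m: "m \<in> M" and t: "keys t \<subseteq> V"
  shows "keep (- M) (gen_fun \<alpha> p q (m + t)) = keep (- M) (single t 1 * gen_fun \<alpha> p q m)"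
proof (cases "p \<in> keys m \<and> q \<in> keys m")
  case True
  then obtain u where u: "m = mpair p q + u" using keys_pair_minus[OF p_neq_q] by blast
  have "gen_fun \<alpha> p q (m + t) = single t 1 * gen_fun \<alpha> p q m"
    using gen_fun_pair[of "u + t"] gen_fun_pair[of u] by (simp add: u mult_single algebra_simps del: One_nat_def)
  then show ?thesis by simp
next
  case False
  then have "gen_fun \<alpha> p q m = 0" by (auto simp: gen_fun_def)
  moreover have "keep (- M) (gen_fun \<alpha> p q (m + t)) = 0"
  proof (cases "p \<in> keys (m + t) \<and> q \<in> keys (m + t)")
    case True
    then obtain u where u: "m + t = mpair p q + u" using keys_pair_minus[OF p_neq_q] by blast
    have "\<alpha> + u \<in> M" using good_zero[OF u m False t] .
    then show ?thesis
      unfolding u gen_fun_pair by (intro poly_mapping_eqI) (auto simp: lookup_keep lookup_single when_def)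
  qed (auto simp: gen_fun_def)
  ultimately show ?thesis by simp
qed

lemma gen_hom_closed: "gen_hom \<alpha> p q \<in> carrier H"
  unfolding gen_hom_def by (rule mk_hom_closed[OF gen_fun_closed gen_fun_shift])

lemma hc_gen_hom: "m \<in> M \<Longrightarrow> hc (gen_hom \<alpha> p q) m = keep (- M) (gen_fun \<alpha> p q m)"
  unfolding gen_hom_def by (rule hc_mk_hom[OF gen_fun_closed gen_fun_shift])

lemma gen_hom_homog: "gen_hom \<alpha> p q \<in> Hom_homog V I (\<lambda>v. int (lookup \<alpha> v) - int (lookup (mpair p q) v))"
  unfolding Hom_homog_iff
proof (intro conjI ballI allI impI gen_hom_closed)
  fix m m' assume m: "m \<in> M" and nz: "lookup (hc (gen_hom \<alpha> p q) m) m' \<noteq> 0"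
  then have nz': "lookup (gen_fun \<alpha> p q m) m' \<noteq> 0"
    by (auto simp: hc_gen_hom lookup_keep split: if_splits)
  then have "p \<in> keys m \<and> q \<in> keys m" by (auto simp: gen_fun_def split: if_splits)
  then obtain u where u: "m = mpair p q + u" using keys_pair_minus[OF p_neq_q] by blast
  have "m' = \<alpha> + u" using nz' unfolding u gen_fun_pair by (auto simp: lookup_single when_def split: if_splits)
  then show "mono_deg m m' = (\<lambda>v. int (lookup \<alpha> v) - int (lookup (mpair p q) v))" unfolding mono_deg_eq_iff u by (simp add: algebra_simps)
qed

text \<open>The witness is the row \<alpha>: it avoids \<open>p\<close> and \<open>q\<close>, lies
  outside \<open>M\<close>, and carries the entry 1.\<close>

lemma gen_hom_not_vanishing: "gen_hom \<alpha> p q \<notin> vanishing p q"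
proof
  assume "gen_hom \<alpha> p q \<in> vanishing p q"
  moreover have "lookup \<alpha> p = 0" "lookup \<alpha> q = 0" using good by (auto simp: good_def in_keys_iff)
  ultimately have "lookup (hc (gen_hom \<alpha> p q) (mpair p q)) \<alpha> = 0" by (simp add: vanishing_def)
  moreover have "hc (gen_hom \<alpha> p q) (mpair p q) = keep (- M) (single \<alpha> 1)"
    using hc_gen_hom[OF mpair_M] gen_fun_pair[of 0] by simp
  ultimately show False using good_not_M by (simp add: lookup_keep)
qed

lemma gen_hom_not_coboundary: "gen_hom \<alpha> p q \<notin> Cob"
  using gen_hom_not_vanishing coboundaries_vanishing[OF pq(1,2) mpair_M] by blast

text \<open>Every relevant entry is a shift of the one at the pair itself, so this single complex
  number determines \<phi>.\<close>

lemma homog_eq_scale_gen_hom: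
  assumes \<phi>: "\<phi> \<in> Hom_homog V I (\<lambda>v. int (lookup \<alpha> v) - int (lookup (mpair p q) v))"
  shows "\<phi> = cl (pconst (lookup (hc \<phi> (mpair p q)) \<alpha>)) \<odot>\<^bsub>H\<^esub> gen_hom \<alpha> p q"
proof (rule homog_eqI[OF \<alpha>_V good_disjoint refl \<phi> Hom_homog_scale[OF gen_hom_homog]])
  fix u assume M: "mpair p q + u \<in> M" and nM: "\<alpha> + u \<notin> M"
  have "\<phi> \<in> carrier H" using \<phi> by (simp add: Hom_homog_iff)
  moreover have "keys u \<subseteq> V" using M by (auto simp: M_def keys_add_nat)
  ultimately have "lookup (hc \<phi> (mpair p q + u)) (\<alpha> + u) = lookup (hc \<phi> (mpair p q)) \<alpha>"
    using nM by (intro hc_shift mpair_M)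
  moreover have "lookup (hc (gen_hom \<alpha> p q) (mpair p q + u)) (\<alpha> + u) = 1"
    unfolding hc_gen_hom[OF M] gen_fun_pair using nM by (simp add: lookup_keep)
  ultimately show "lookup (hc \<phi> (mpair p q + u)) (\<alpha> + u) =
    lookup (hc (cl (pconst (lookup (hc \<phi> (mpair p q)) \<alpha>)) \<odot>\<^bsub>H\<^esub> gen_hom \<alpha> p q) (mpair p q + u)) (\<alpha> + u)"
    unfolding hc_Hom_scale[OF gen_hom_closed M] by simp
qed

lemma T1_graded_good: "has_dim class_ring (T1_graded V I (\<lambda>v. int (lookup \<alpha> v) - int (lookup (mpair p q) v))) 1"
  using gen_hom_homog gen_hom_not_coboundary
  by (rule T1_graded_has_dim_1) (rule exI, rule homog_eq_scale_gen_hom)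

end

text \<open>Generators with the smallest \<alpha> thus yield the others by multiplication with
  monomials. Reducing before the multiplication changes nothing because \<open>M\<close> is closed
  under multiples.\<close>

lemma gen_hom_add:
  assumes "keys (\<alpha> + \<alpha>') \<subseteq> V" "p \<in> V" "q \<in> V" "cr p q" "good (keys \<alpha>) p q" "good (keys (\<alpha> + \<alpha>')) p q"
  shows "gen_hom (\<alpha> + \<alpha>') p q = cl (single \<alpha>' 1) \<odot>\<^bsub>H\<^esub> gen_hom \<alpha> p q"
proof (rule Hom_eq_hcI)
  have V: "keys \<alpha> \<subseteq> V" "keys \<alpha>' \<subseteq> V" using assms(1) by (auto simp: keys_add_nat)
  note closed = gen_hom_closed[OF V(1) assms(2-5)]
  show "gen_hom (\<alpha> + \<alpha>') p q \<in> carrier H" using assms by (intro gen_hom_closed)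
  show "cl (single \<alpha>' 1) \<odot>\<^bsub>H\<^esub> gen_hom \<alpha> p q \<in> carrier H"
    using closed V(2) by (intro Hom_smult_closed cl_closed single_carrier)
  fix m assume m: "m \<in> M"
  have g: "gen_fun (\<alpha> + \<alpha>') p q m = single \<alpha>' 1 * gen_fun \<alpha> p q m"
    by (simp add: gen_fun_def mult_single algebra_simps)
  have "keep (- M) (single \<alpha>' 1 * keep (- M) f) = keep (- M) (single \<alpha>' 1 * f)" for f
  proof (rule poly_mapping_eqI)
    fix m'
    show "lookup (keep (- M) (single \<alpha>' 1 * keep (- M) f)) m' = lookup (keep (- M) (single \<alpha>' 1 * f)) m'"
    proof (cases "\<exists>s. m' = \<alpha>' + s")
      case True
      then obtain s where s: "m' = \<alpha>' + s" by blast
      have "s \<notin> M" if "m' \<notin> M" using that M_add[of s \<alpha>'] V(2) by (auto simp: s add.commute)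
      then show ?thesis by (auto simp: s lookup_keep lookup_single_times_add)
    qed (simp add: lookup_keep lookup_single_times_eq_0)
  qed
  then show "hc (gen_hom (\<alpha> + \<alpha>') p q) m = hc (cl (single \<alpha>' 1) \<odot>\<^bsub>H\<^esub> gen_hom \<alpha> p q) m"
    unfolding hc_gen_hom[OF assms(1-4,6) m] hc_Hom_smult[OF single_carrier[OF V(2)] closed m]
      hc_gen_hom[OF V(1) assms(2-5) m] g by (rule sym)
qed

end

section \<open>Homogeneous homomorphisms that are coboundaries\<close>

context flag_ideal
begin

lemma single_add_M:
  assumes "single p (1::nat) + u \<in> M" "\<And>d e. d \<in> keys u \<Longrightarrow> e \<in> keys u \<Longrightarrow> \<not> cr d e"
  shows "\<exists>w\<in>keys u. cr w p"
proof -
  obtain d e where de: "d \<in> keys (single p (1::nat) + u)" "e \<in> keys (single p (1::nat) + u)" "cr d e"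
    using assms(1) unfolding M_def by blast
  then have "d = p \<or> d \<in> keys u" "e = p \<or> e \<in> keys u" by (auto simp: keys_add_nat)
  then show ?thesis using de(3) assms(2) cr_irrefl cr_sym by metis
qed

lemma add_single_not_M:
  assumes \<gamma>: "\<gamma> \<notin> M" "keys \<gamma> \<subseteq> V" and w: "\<And>d. d \<in> keys \<gamma> \<Longrightarrow> \<not> cr d w"
  shows "\<gamma> + single w (1::nat) \<notin> M"
proof
  assume "\<gamma> + single w (1::nat) \<in> M"
  then obtain d e where de: "d \<in> keys (\<gamma> + single w (1::nat))" "e \<in> keys (\<gamma> + single w (1::nat))" "cr d e"
    unfolding M_def by blast
  then have "d = w \<or> d \<in> keys \<gamma>" "e = w \<or> e \<in> keys \<gamma>" by (auto simp: keys_add_nat)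
  then consider "d = w" "e = w" | "d = w" "e \<in> keys \<gamma>" | "d \<in> keys \<gamma>" "e = w" | "d \<in> keys \<gamma>" "e \<in> keys \<gamma>"
    by blast
  then show False
  proof cases
    case 1
    then show ?thesis using de(3) cr_irrefl by simp
  next
    case 2
    then show ?thesis using cr_sym[OF de(3)] w by simp
  next
    case 3
    then show ?thesis using de(3) w by simp
  next
    case 4
    then show ?thesis using M_I[OF _ _ de(3) \<gamma>(2)] \<gamma>(1) by simp
  qed
qed

lemma coboundary_single:
  assumes \<alpha>_V: "keys \<alpha> \<subseteq> V" and p: "p \<in> V" "p \<notin> keys \<alpha>"
    and \<phi>: "\<phi> \<in> Hom_homog V I (\<lambda>v. int (lookup \<alpha> v) - int (lookup (single p 1) v))"
  shows "\<phi> \<in> Cob"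
proof -
  let ?\<beta> = "single p (1::nat)"
  have disj: "keys \<alpha> \<inter> keys ?\<beta> = {}" using p by auto
  have H: "\<phi> \<in> carrier H" using \<phi> by (simp add: Hom_homog_iff)
  define W where "W = {w \<in> V. cr w p \<and> \<alpha> + single w 1 \<notin> M}"
  define z where "z w = lookup (hc \<phi> (?\<beta> + single w 1)) (\<alpha> + single w 1)" for w
  have W: "?\<beta> + single w 1 \<in> M" "w \<in> V" "\<alpha> + single w 1 \<notin> M" if "w \<in> W" for w
  proof -
    show "?\<beta> + single w 1 \<in> M" using that p by (intro pair_M) (auto simp: W_def intro: cr_sym)
    show "w \<in> V" "\<alpha> + single w 1 \<notin> M" using that by (simp_all add: W_def)
  qed
  have face: "\<not> cr d w" if "w \<in> W" "d \<in> keys \<alpha>" for w d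
    using W[OF that(1)] that \<alpha>_V by (auto simp: M_def keys_add_nat)
  have \<alpha>_M: "\<alpha> \<notin> M" if "w \<in> W" for w
    using W[OF that] M_add[of \<alpha> "single w 1"] by auto
  \<comment> \<open>The entry with \<open>u\<close> equal to the product of the two variables is a
    common shift of both entries; it survives because \<open>w\<close> and \<open>w'\<close> do not
    cross.\<close>
  have compat: "z w = z w'" if w: "w \<in> W" "w' \<in> W" "\<not> cr w w'" for w w'
  proof -
    have nM: "\<alpha> + single w 1 + single w' 1 \<notin> M"
    proof (rule add_single_not_M[OF W(3)[OF w(1)]])
      show "keys (\<alpha> + single w 1) \<subseteq> V" using \<alpha>_V W(2)[OF w(1)] by (simp add: keys_add_nat)
      fix d assume "d \<in> keys (\<alpha> + single w 1)"
      then have "d \<in> keys \<alpha> \<or> d = w" by (auto simp: keys_add_nat)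
      then show "\<not> cr d w'" using face[OF w(2)] w(3) by blast
    qed
    have comm: "x + single w' 1 + single w (1::nat) = x + single w 1 + single w' 1" for x
      by (simp only: add.assoc add.commute[of "single w' 1"])
    have nM': "\<alpha> + single w' 1 + single w 1 \<notin> M" unfolding comm by (rule nM)
    have V: "keys (single w (1::nat)) \<subseteq> V" "keys (single w' (1::nat)) \<subseteq> V" using W(2) w by simp_all
    have "lookup (hc \<phi> (?\<beta> + single w 1 + single w' 1)) (\<alpha> + single w 1 + single w' 1) = z w"
      unfolding z_def by (rule hc_shift[OF H W(1)[OF w(1)] V(2) nM])
    moreover have "lookup (hc \<phi> (?\<beta> + single w' 1 + single w 1)) (\<alpha> + single w' 1 + single w 1) = z w'"
      unfolding z_def by (rule hc_shift[OF H W(1)[OF w(2)] V(1) nM'])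
    ultimately show ?thesis unfolding comm by simp
  qed
  have const: "z w = z w'" if w: "w \<in> W" "w' \<in> W" for w w'
  proof (cases "cr w w'")
    case True
    have cr: "cr w p" "cr w' p" using w by (simp_all add: W_def)
    obtain w'' where w'': "w'' \<in> V" "cr w'' p" "\<not> cr w w''" "\<not> cr w' w''"
      "\<forall>d\<in>V. cr d w'' \<longrightarrow> cr d w \<or> cr d w'"
      using connected[OF p(1) W(2)[OF w(1)] W(2)[OF w(2)] cr True] by blast
    have "\<not> cr d w''" if "d \<in> keys \<alpha>" for d
      using w''(5) that \<alpha>_V face w by blast
    then have "\<alpha> + single w'' 1 \<notin> M"
      by (rule add_single_not_M[OF \<alpha>_M[OF w(1)] \<alpha>_V])
    then have "w'' \<in> W" using w'' by (simp add: W_def)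
    then show ?thesis using compat[OF w(1) _ w''(3)] compat[OF w(2) _ w''(4)] by simp
  qed (use compat w in blast)
  \<comment> \<open>For empty \<open>W\<close> the choice is arbitrary, but then there is no entry
    to compare.\<close>
  define z0 where "z0 = z (SOME w. w \<in> W)"
  have z0: "z w = z0" if "w \<in> W" for w
    unfolding z0_def using that someI[of "\<lambda>w. w \<in> W", OF that] by (rule const)
  let ?D = "restrict (\<lambda>f. cl (lin (mono_derivation p \<alpha> z0) f)) I"
  have D: "?D \<in> Cob" "\<And>m. m \<in> M \<Longrightarrow> hc ?D m = keep (- M) (mono_derivation p \<alpha> z0 m)"
    using mono_derivation_coboundary[OF \<alpha>_V] by simp_all
  have "?D \<in> Hom_homog V I (\<lambda>v. int (lookup \<alpha> v) - int (lookup ?\<beta> v))"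
    unfolding Hom_homog_iff
  proof (intro conjI ballI allI impI)
    show "?D \<in> carrier H" using D(1) submodule.subset[OF coboundaries_submodule] by blast
    fix m m' assume m: "m \<in> M" and "lookup (hc ?D m) m' \<noteq> 0"
    then have m': "m' = m - ?\<beta> + \<alpha>" "lookup m p \<noteq> 0"
      by (auto simp: D(2) lookup_keep mono_derivation_def lookup_single when_def split: if_splits)
    have "m' + ?\<beta> = (?\<beta> + (m - ?\<beta>)) + \<alpha>" unfolding m'(1) by (simp only: ac_simps)
    also have "?\<beta> + (m - ?\<beta>) = m" using single_1_add_minus[OF m'(2)] by (rule sym)
    finally have "m' + ?\<beta> = m + \<alpha>" .
    then show "mono_deg m m' = (\<lambda>v. int (lookup \<alpha> v) - int (lookup ?\<beta> v))"
      unfolding mono_deg_eq_iff .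
  qed
  with \<alpha>_V disj refl \<phi> have "\<phi> = ?D"
  proof (rule homog_eqI)
    fix u assume M: "?\<beta> + u \<in> M" and nM: "\<alpha> + u \<notin> M"
    have uV: "keys u \<subseteq> V" using M_V[OF M] by (simp add: keys_add_nat)
    have auV: "keys (\<alpha> + u) \<subseteq> V" using \<alpha>_V uV by (simp add: keys_add_nat)
    have nc: "\<not> cr d e" if "d \<in> keys u" "e \<in> keys u" for d e
      using nM M_I[OF _ _ _ auV, of d e] that by (auto simp: keys_add_nat)
    obtain w where w: "w \<in> keys u" "cr w p" using single_add_M[OF M nc] by blast
    \<comment> \<open>So \<open>p\<close> has exponent exactly 1 in the source, and the derivation
      contributes no integer factor other than 1.\<close>
    have "p \<notin> keys u" using w nc by blast
    then have "lookup (?\<beta> + u) p = 1" by (simp add: lookup_add in_keys_iff)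
    moreover have "?\<beta> + u - ?\<beta> + \<alpha> = \<alpha> + u" by (simp add: add.commute)
    ultimately have "mono_derivation p \<alpha> z0 (?\<beta> + u) = single (\<alpha> + u) z0"
      by (simp only: mono_derivation_def of_nat_1 mult_1_right)
    then have rhs: "lookup (hc ?D (?\<beta> + u)) (\<alpha> + u) = z0"
      unfolding D(2)[OF M] using nM by (simp add: lookup_keep)
    have "\<alpha> + single w 1 \<notin> M"
      using nM M_mono[OF _ _ auV, of "\<alpha> + single w 1"] w(1) by (auto simp: keys_add_nat)
    then have wW: "w \<in> W" using w uV by (auto simp: W_def)
    have u: "u = single w 1 + (u - single w 1)" using w(1) by (rule keys_single_1_add_minus)
    have "keys (u - single w 1) \<subseteq> V" using uV keys_minus_nat[of u] by blast
    then have "lookup (hc \<phi> (?\<beta> + single w 1 + (u - single w 1))) (\<alpha> + single w 1 + (u - single w 1)) = z w"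
      unfolding z_def using nM u W[OF wW] by (intro hc_shift[OF H]) (auto simp: add.assoc)
    then show "lookup (hc \<phi> (?\<beta> + u)) (\<alpha> + u) = lookup (hc ?D (?\<beta> + u)) (\<alpha> + u)"
      using z0[OF wW] u rhs by (simp add: add.assoc)
  qed
  with D(1) show ?thesis by simp
qed

text \<open>Suppose \<open>w\<close> is compatible with \<alpha> but crosses one member of the pair.
  That member and \<open>w\<close> already give a monomial of \<open>I\<close>, so after
  multiplication with the other member, the target would be divisible by the latter. But the target
  is \<alpha> times \<open>w\<close>, which does not contain it.\<close>

lemma nonzero_entry_good:
  assumes \<alpha>_V: "keys \<alpha> \<subseteq> V" and pq: "p \<in> V" "q \<in> V" "cr p q" "p \<notin> keys \<alpha>" "q \<notin> keys \<alpha>"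
    and \<phi>: "\<phi> \<in> carrier H" and M: "single p 1 + single q 1 + u \<in> M"
    and nz: "lookup (hc \<phi> (single p 1 + single q 1 + u)) (\<alpha> + u) \<noteq> 0"
  shows "good (keys \<alpha>) p q"
proof -
  let ?\<beta> = "single p 1 + single q (1::nat)"
  have uV: "keys u \<subseteq> V" using M_V[OF M] by (simp add: keys_add_nat)
  have \<beta>M: "?\<beta> \<in> M" using pq(1-3) by (rule pair_M)
  have nM: "\<alpha> + u \<notin> M" using hc_keys(1)[OF \<phi> M nz] .
  have nz0: "lookup (hc \<phi> ?\<beta>) \<alpha> \<noteq> 0"
    using hc_shift[OF \<phi> \<beta>M uV nM] nz by simp
  have face: "\<not> cr d e" if "d \<in> keys \<alpha>" "e \<in> keys \<alpha>" for d e
    using nM that \<alpha>_V uV by (auto simp: M_def keys_add_nat)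
  \<comment> \<open>The pair is renamed so that the argument can be applied to \<open>p\<close> and
    \<open>q\<close> in either order.\<close>
  have *: "\<not> cr w p'"
    if w: "w \<in> V" "w \<noteq> q'" "\<forall>d\<in>keys \<alpha>. \<not> cr d w" and p': "?\<beta> = single p' 1 + single q' 1" "p' \<in> V" "q' \<in> V" "q' \<notin> keys \<alpha>"
    for w p' q'
  proof
    assume "cr w p'"
    then have M': "single p' 1 + single w 1 \<in> M" using w p' by (intro pair_M) (auto intro: cr_sym)
    have "\<alpha> \<notin> M" using face by (auto simp: M_def)
    then have "\<alpha> + single w 1 \<notin> M"
      using w(3) by (intro add_single_not_M \<alpha>_V) auto
    then have "lookup (hc \<phi> (?\<beta> + single w 1)) (\<alpha> + single w 1) \<noteq> 0"
      using hc_shift[OF \<phi> \<beta>M, of "single w 1" \<alpha>] w nz0 by simp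
    moreover have eq: "?\<beta> + single w 1 = (single p' 1 + single w 1) + single q' 1"
      unfolding p'(1) by (simp only: ac_simps)
    ultimately have nz': "lookup (hc \<phi> ((single p' 1 + single w 1) + single q' 1)) (\<alpha> + single w 1) \<noteq> 0"
      unfolding eq by blast
    have kq: "keys (single q' (1::nat)) \<subseteq> V" using p'(3) by simp
    obtain s where "\<alpha> + single w 1 = s + single q' 1"
      by (rule hc_shift_nonzero[OF \<phi> M' kq nz'])
    then have "q' \<in> keys (\<alpha> + single w 1)" by (simp add: keys_add_nat)
    then show False using w p' by (auto simp: keys_add_nat split: if_splits)
  qed
  have "\<not> cr w p" "\<not> cr w q" if w: "w \<in> V" "w \<noteq> p" "w \<noteq> q" "\<forall>d\<in>keys \<alpha>. \<not> cr d w" for w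
    using *[of w q p] *[of w p q] w pq by (simp_all add: add.commute)
  then show ?thesis using face pq unfolding good_def by blast
qed

theorem homog_coboundary:
  assumes \<alpha>_V: "keys \<alpha> \<subseteq> V" and disj: "keys \<alpha> \<inter> keys \<beta> = {}"
    and not_good: "\<And>p q. p \<in> V \<Longrightarrow> q \<in> V \<Longrightarrow> cr p q \<Longrightarrow> \<beta> = single p 1 + single q 1 \<Longrightarrow> \<not> good (keys \<alpha>) p q"
  shows "Hom_homog V I (\<lambda>v. int (lookup \<alpha> v) - int (lookup \<beta> v)) \<subseteq> Cob"
proof
  fix \<phi> assume \<phi>: "\<phi> \<in> Hom_homog V I (\<lambda>v. int (lookup \<alpha> v) - int (lookup \<beta> v))"
  then have H: "\<phi> \<in> carrier H" by (simp add: Hom_homog_iff)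
  show "\<phi> \<in> Cob"
  proof (cases "\<exists>p\<in>V. \<beta> = single p 1")
    case True
    then obtain p where "p \<in> V" "\<beta> = single p 1" by blast
    moreover have "p \<notin> keys \<alpha>" using disj calculation by auto
    ultimately show ?thesis using coboundary_single[OF \<alpha>_V] \<phi> by simp
  next
    case False
    have "\<phi> = \<zero>\<^bsub>H\<^esub>"
    proof (rule homog_eqI[OF \<alpha>_V disj refl \<phi> Hom_homog_zero], rule ccontr)
      fix u assume M: "\<beta> + u \<in> M" and
        "lookup (hc \<phi> (\<beta> + u)) (\<alpha> + u) \<noteq> lookup (hc \<zero>\<^bsub>H\<^esub> (\<beta> + u)) (\<alpha> + u)"
      then have nz: "lookup (hc \<phi> (\<beta> + u)) (\<alpha> + u) \<noteq> 0" by (simp add: hc_Hom_zero)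
      obtain p q where pq: "p \<in> V" "q \<in> V" "cr p q" "\<beta> = single p 1 + single q 1"
        using nonzero_entry_cases[OF \<alpha>_V disj refl H M nz] False by auto
      moreover have "p \<notin> keys \<alpha>" "q \<notin> keys \<alpha>" using disj by (auto simp: pq(4) keys_add_nat)
      ultimately have "good (keys \<alpha>) p q"
        using nonzero_entry_good[OF \<alpha>_V pq(1-3)] H M nz by simp
      with not_good[OF pq] show False by simp
    qed
    then show ?thesis using submodule.zero_closed[OF coboundaries_submodule] by simp
  qed
qed

end

text \<open>Both images are quotients of \<open>E\<close> by the same equivalence relation. It is
  applied to ordered pairs, with \<open>g\<close> forgetting the order and \<open>f\<close> giving
  the class of the generator.\<close>

lemma bij_betw_quotients:
  assumes "\<And>x y. x \<in> E \<Longrightarrow> y \<in> E \<Longrightarrow> f x = f y \<longleftrightarrow> g x = g y"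
  shows "bij_betw (\<lambda>b. f (inv_into E g b)) (g ` E) (f ` E)"
proof (rule bij_betw_imageI)
  have inv: "inv_into E g (g x) \<in> E" "f (inv_into E g (g x)) = f x" if "x \<in> E" for x
    using that assms[of "inv_into E g (g x)" x] by (simp_all add: inv_into_into f_inv_into_f)
  show "inj_on (\<lambda>b. f (inv_into E g b)) (g ` E)"
    using inv assms by (auto simp: inj_on_def)
  show "(\<lambda>b. f (inv_into E g b)) ` g ` E = f ` E"
    using inv by (simp add: image_image)
qed

section \<open>A minimal generating set\<close>

context flag_ideal
begin

definition ind :: "'v set \<Rightarrow> 'v \<Rightarrow>\<^sub>0 nat" where
  "ind S = (\<Sum>v\<in>S. single v 1)"

lemma lookup_ind: "S \<subseteq> V \<Longrightarrow> lookup (ind S) v = of_bool (v \<in> S)"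
  using finite_subset[OF _ fin, of S] by (simp add: ind_def lookup_sum lookup_single when_def sum.delta)

lemma keys_ind: "S \<subseteq> V \<Longrightarrow> keys (ind S) = S"
  by (auto simp: in_keys_iff lookup_ind)

lemma ind_add_minus: "S \<subseteq> V \<Longrightarrow> S \<subseteq> keys \<alpha> \<Longrightarrow> \<alpha> = ind S + (\<alpha> - ind S)"
  by (intro poly_mapping_eqI) (auto simp: lookup_add lookup_minus lookup_ind in_keys_iff)

text \<open>The truncated differences are the positive and the negative part of the signed
  degree.\<close>

lemma mono_deg_normalized:
  "mono_deg m m' = (\<lambda>v. int (lookup (m' - m) v) - int (lookup (m - m') v))"
  "keys (m' - m) \<inter> keys (m - m') = {}"
  by (auto simp: mono_deg_def lookup_minus fun_eq_iff in_keys_iff)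

text \<open>Two representatives of a class differ by a coboundary, and coboundaries lie in
  \<open>vanishing p q\<close>; so membership depends only on the class.\<close>

lemma pr_eq_vanishing:
  assumes "\<phi> \<in> carrier H" "\<psi> \<in> vanishing p q" "pr \<phi> = pr \<psi>" "p \<in> V" "q \<in> V" "cr p q"
  shows "\<phi> \<in> vanishing p q"
proof -
  have M: "single p 1 + single q 1 \<in> M" using assms(4-6) by (rule pair_M)
  interpret v: submodule A "vanishing p q" H by (rule vanishing_submodule[OF M])
  interpret C: abelian_subgroup Cob H by (rule H.submodule_abelian_subgroup[OF coboundaries_submodule])
  have "\<phi> \<in> pr \<psi>" using C.a_rcos_self[OF assms(1)] unfolding assms(3) .
  then obtain \<chi> where "\<chi> \<in> Cob" "\<phi> = \<chi> \<oplus>\<^bsub>H\<^esub> \<psi>" unfolding a_r_coset_def' by blast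
  then show ?thesis
    using v.m_closed[OF _ assms(2), of \<chi>] coboundaries_vanishing[OF assms(4,5) M] by blast
qed

text \<open>\<open>core\<close> stands for the least good set of a crossing pair. \<open>E\<close>
  consists of ordered pairs, so each generator is listed in both orders and the two copies are
  identified through \<open>core_sym\<close>.\<close>

context
  fixes core :: "'v \<Rightarrow> 'v \<Rightarrow> 'v set" and E :: "('v \<times> 'v) set" and gen :: "'v \<times> 'v \<Rightarrow> 'v cpoly \<Rightarrow> 'v cpoly set"
  assumes core_V: "p \<in> V \<Longrightarrow> q \<in> V \<Longrightarrow> cr p q \<Longrightarrow> core p q \<subseteq> V"
    and core_good: "p \<in> V \<Longrightarrow> q \<in> V \<Longrightarrow> cr p q \<Longrightarrow> good (core p q) p q"
    and core_least: "p \<in> V \<Longrightarrow> q \<in> V \<Longrightarrow> cr p q \<Longrightarrow> a \<subseteq> V \<Longrightarrow> good a p q \<Longrightarrow> core p q \<subseteq> a"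
    and core_sym: "core p q = core q p"
  defines "E \<equiv> {(p, q). p \<in> V \<and> q \<in> V \<and> cr p q}"
    and "gen \<equiv> \<lambda>(p, q). gen_hom (ind (core p q)) p q"
begin

lemma core_ind:
  assumes "(p, q) \<in> E"
  shows "p \<in> V" "q \<in> V" "cr p q" "keys (ind (core p q)) \<subseteq> V" "good (keys (ind (core p q))) p q"
  using assms core_V[of p q] core_good[of p q] by (auto simp: E_def keys_ind)

lemma gen_closed: "e \<in> E \<Longrightarrow> gen e \<in> carrier H"
  using core_ind gen_hom_closed by (cases e) (simp add: gen_def)

lemma gen_graded: "e \<in> E \<Longrightarrow> \<exists>c. pr (gen e) \<in> carrier (T1_graded V I c)"
proof (cases e)
  case (Pair p q)
  moreover assume "e \<in> E"
  ultimately have "gen e \<in> Hom_homog V I (\<lambda>v. int (lookup (ind (core p q)) v) -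
      int (lookup (single p 1 + single q 1) v))"
    using gen_hom_homog[OF core_ind(4,1,2,3,5), of p q] by (simp add: gen_def)
  from imageI[OF this, of pr] show ?thesis
    by (intro exI) (simp add: T1_graded_def)
qed

text \<open>The monomial of \<open>p\<close> and \<open>q\<close> is not divisible by both members
  of another crossing pair, so the generator of that pair sends it to 0.\<close>

lemma gen_vanishing:
  assumes e: "(p, q) \<in> E" "e \<in> E" "(\<lambda>(p, q). {p, q}) e \<noteq> {p, q}"
  shows "gen e \<in> vanishing p q"
proof -
  obtain r s where rs: "e = (r, s)" by (cases e)
  have M: "single p 1 + single q 1 \<in> M" using core_ind[OF e(1)] by (intro pair_M)
  have "r \<noteq> s" using core_ind[of r s] e(2) cr_irrefl unfolding rs by auto
  with e(3) have "\<not> (r \<in> {p, q} \<and> s \<in> {p, q})" unfolding rs by auto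
  then have "gen_fun (ind (core r s)) r s (single p 1 + single q 1) = 0"
    by (auto simp: gen_fun_def keys_add_nat)
  then have "hc (gen e) (single p 1 + single q 1) = 0"
    using hc_gen_hom[OF core_ind(4,1,2,3,5) M, of r s] e(2) by (simp add: rs gen_def)
  then show ?thesis using gen_closed[OF e(2)] by (simp add: vanishing_def)
qed

lemma gen_not_vanishing: "(p, q) \<in> E \<Longrightarrow> gen (p, q) \<notin> vanishing p q"
  using gen_hom_not_vanishing[OF core_ind(4,1,2,3,5), of p q] by (simp add: gen_def)

lemma pr_gen_eq_iff:
  assumes "e \<in> E" "e' \<in> E"
  shows "pr (gen e) = pr (gen e') \<longleftrightarrow> (\<lambda>(p, q). {p, q}) e = (\<lambda>(p, q). {p, q}) e'"
proof
  assume eq: "(\<lambda>(p, q). {p, q}) e = (\<lambda>(p, q). {p, q}) e'"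
  obtain p q r s where *: "e = (p, q)" "e' = (r, s)" by (cases e, cases e')
  then consider "p = r" "q = s" | "p = s" "q = r" using eq by (auto simp: doubleton_eq_iff)
  then have "gen e = gen e'"
  proof cases
    case 2
    then show ?thesis
      unfolding * gen_def prod.case using core_sym[of r s] by (simp add: gen_hom_commute[of _ r s])
  qed (simp add: *)
  then show "pr (gen e) = pr (gen e')" by simp
next
  assume eq: "pr (gen e) = pr (gen e')"
  obtain p q where pq: "e = (p, q)" by (cases e)
  show "(\<lambda>(p, q). {p, q}) e = (\<lambda>(p, q). {p, q}) e'"
  proof (rule ccontr)
    assume "(\<lambda>(p, q). {p, q}) e \<noteq> (\<lambda>(p, q). {p, q}) e'"
    then have ne: "(\<lambda>(p, q). {p, q}) e' \<noteq> {p, q}" by (simp add: pq)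
    have E: "(p, q) \<in> E" using assms(1) by (simp only: pq)
    have "gen e \<in> vanishing p q"
      by (rule pr_eq_vanishing[OF gen_closed[OF assms(1)] gen_vanishing[OF E assms(2) ne] eq core_ind(1-3)[OF E]])
    then show False using gen_not_vanishing[OF E] by (simp only: pq)
  qed
qed

interpretation T: Module.module A T
  by (rule T_module)

lemma pr_gen_subset: "(\<lambda>e. pr (gen e)) ` E \<subseteq> carrier T"
  using pr_closed gen_closed by (simp add: image_subset_iff)

lemma span_gen: "T.span ((\<lambda>e. pr (gen e)) ` E) = carrier T"
proof (rule equalityI)
  let ?S = "T.span ((\<lambda>e. pr (gen e)) ` E)"
  interpret S: submodule A ?S T by (rule T.span_is_submodule[OF pr_gen_subset])
  show "?S \<subseteq> carrier T" by (rule S.subset)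
  \<comment> \<open>The claim is pulled back to \<open>H\<close>, where homomorphisms split into
    homogeneous parts; \<open>N\<close> is the preimage of the span.\<close>
  define N where "N = {\<phi> \<in> carrier H. pr \<phi> \<in> ?S}"
  define B where "B = (\<lambda>(p, q). single p (1::nat) + single q 1) ` E"
  have "carrier H \<subseteq> N"
  proof (rule carrier_H_subsetI[of B])
    have "E \<subseteq> V \<times> V" by (auto simp: E_def)
    then show "finite B" unfolding B_def using fin by (intro finite_imageI) (auto intro: finite_subset)
    show "B \<subseteq> M" unfolding B_def E_def using pair_M by auto
    show "submodule A N H"
    proof (rule submodule.intro)
      show "N \<subseteq> carrier H" by (auto simp: N_def)
      show "\<zero>\<^bsub>H\<^esub> \<in> N" using S.zero_closed by (simp add: N_def Hom_zero_closed pr_zero)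
    next
      fix \<phi> \<psi> assume "\<phi> \<in> N" "\<psi> \<in> N"
      then show "\<phi> \<oplus>\<^bsub>H\<^esub> \<psi> \<in> N"
        by (simp add: N_def Hom_add_closed pr_add[symmetric])
    next
      fix r \<phi> assume "r \<in> carrier A" "\<phi> \<in> N"
      then show "r \<odot>\<^bsub>H\<^esub> \<phi> \<in> N"
        by (simp add: N_def Hom_smult_closed pr_smult[symmetric])
    qed (rule H.module_axioms)
  next
    fix m assume m: "m \<in> M"
    then obtain p q where pq: "p \<in> keys m" "q \<in> keys m" "cr p q" unfolding M_def by blast
    then have "p \<noteq> q" using cr_irrefl by auto
    then have "m = (single p 1 + single q 1) + (m - (single p 1 + single q 1))"
      using pq by (intro keys_pair_minus)
    moreover have "single p 1 + single q 1 \<in> B"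
      using pq M_V[OF m] unfolding B_def E_def by (intro image_eqI[of _ _ "(p, q)"]) auto
    moreover have "keys (m - (single p 1 + single q 1)) \<subseteq> V"
      using keys_minus_nat M_V[OF m] by (rule subset_trans)
    ultimately show "\<exists>b\<in>B. \<exists>t. m = b + t \<and> keys t \<subseteq> V" by blast
  next
    fix m m' assume m: "m \<in> M" and m': "keys m' \<subseteq> V" "m' \<notin> M"
    define \<alpha> where "\<alpha> = m' - m"
    define \<beta> where "\<beta> = m - m'"
    have deg: "mono_deg m m' = (\<lambda>v. int (lookup \<alpha> v) - int (lookup \<beta> v))"
      unfolding \<alpha>_def \<beta>_def by (rule mono_deg_normalized)
    have disj: "keys \<alpha> \<inter> keys \<beta> = {}" unfolding \<alpha>_def \<beta>_def by (rule mono_deg_normalized)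
    have \<alpha>_V: "keys \<alpha> \<subseteq> V" unfolding \<alpha>_def using keys_minus_nat m'(1) by (rule subset_trans)
    show "Hom_homog V I (mono_deg m m') \<subseteq> N"
    proof (cases "\<exists>p q. p \<in> V \<and> q \<in> V \<and> cr p q \<and> \<beta> = single p 1 + single q 1 \<and> good (keys \<alpha>) p q")
      case True
      then obtain p q where pq: "p \<in> V" "q \<in> V" "cr p q" "\<beta> = single p 1 + single q 1" "good (keys \<alpha>) p q" by blast
      then have E: "(p, q) \<in> E" by (simp add: E_def)
      let ?\<gamma> = "ind (core p q)"
      \<comment> \<open>The least good set lies in the support of \<alpha>, so its squarefree
        monomial divides that of \<alpha>.\<close>
      have \<alpha>: "\<alpha> = ?\<gamma> + (\<alpha> - ?\<gamma>)"
        using core_V[OF pq(1-3)] core_least[OF pq(1-3) \<alpha>_V pq(5)] by (rule ind_add_minus)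
      have V: "keys (\<alpha> - ?\<gamma>) \<subseteq> V" using keys_minus_nat \<alpha>_V by (rule subset_trans)
      have "gen_hom (?\<gamma> + (\<alpha> - ?\<gamma>)) p q = cl (single (\<alpha> - ?\<gamma>) 1) \<odot>\<^bsub>H\<^esub> gen_hom ?\<gamma> p q"
        using \<alpha>_V pq(5) core_ind[OF E] by (intro gen_hom_add) (simp_all only: \<alpha>[symmetric])
      then have hom: "gen_hom \<alpha> p q = cl (single (\<alpha> - ?\<gamma>) 1) \<odot>\<^bsub>H\<^esub> gen (p, q)"
        unfolding \<alpha>[symmetric] by (simp add: gen_def)
      have "pr (gen (p, q)) \<in> ?S" using T.in_own_span[OF pr_gen_subset] E by (rule subsetD[OF _ imageI])
      then have "pr (gen_hom \<alpha> p q) \<in> ?S"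
        unfolding hom using gen_closed[OF E] V
        by (subst pr_smult[symmetric]) (auto intro!: cl_closed single_carrier S.smult_closed simp del: poly_ring_simps(1))
      moreover have "gen_hom \<alpha> p q \<in> carrier H"
        using \<alpha>_V pq by (intro gen_hom_closed)
      ultimately have N: "cl (pconst z) \<odot>\<^bsub>H\<^esub> gen_hom \<alpha> p q \<in> N" for z
        using cl_closed[OF pconst_carrier] by (simp add: N_def Hom_smult_closed pr_smult[symmetric])
      show ?thesis
      proof
        fix \<phi> assume "\<phi> \<in> Hom_homog V I (mono_deg m m')"
        then have \<phi>: "\<phi> = cl (pconst (lookup (hc \<phi> \<beta>) \<alpha>)) \<odot>\<^bsub>H\<^esub> gen_hom \<alpha> p q"
          unfolding deg pq(4) by (rule homog_eq_scale_gen_hom[OF \<alpha>_V pq(1-3,5)])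
        show "\<phi> \<in> N" using N[of "lookup (hc \<phi> \<beta>) \<alpha>"] unfolding \<phi>[symmetric] .
      qed
    next
      case False
      have "Hom_homog V I (mono_deg m m') \<subseteq> Cob"
        unfolding deg using \<alpha>_V disj by (rule homog_coboundary) (use False in simp)
      moreover have "Cob \<subseteq> N"
      proof
        fix \<phi> assume \<phi>: "\<phi> \<in> Cob"
        then have H: "\<phi> \<in> carrier H" using submodule.subset[OF coboundaries_submodule] by (rule subsetD[rotated])
        then have "pr \<phi> = \<zero>\<^bsub>T\<^esub>" using \<phi> by (simp add: pr_eq_zero_iff)
        then show "\<phi> \<in> N" using H S.zero_closed by (simp add: N_def)
      qed
      ultimately show ?thesis by (rule subset_trans)
    qed
  qed
  then show "carrier T \<subseteq> ?S"
    unfolding carrier_T by (auto simp: N_def subset_iff)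
qed

text \<open>If the class for \<open>(p, q)\<close> is missing from \<open>G\<close>, then
  \<open>G\<close> lies in the image of \<open>vanishing p q\<close>. This image is a submodule of
  \<open>T1\<close>, and it is proper because it does not contain the missing class.\<close>

lemma minimal_generating_set_gen: "minimal_generating_set A T ((\<lambda>e. pr (gen e)) ` E)"
  unfolding minimal_generating_set_def
proof (intro conjI allI impI notI T_module pr_gen_subset span_gen)
  fix G assume sub: "G \<subset> (\<lambda>e. pr (gen e)) ` E" and span: "T.span G = carrier T"
  obtain x where "x \<in> (\<lambda>e. pr (gen e)) ` E" "x \<notin> G" using sub by (meson psubset_imp_ex_mem DiffE)
  then obtain p q where pq: "(p, q) \<in> E" "pr (gen (p, q)) \<notin> G" by (elim imageE) (metis surj_pair)
  have M: "single p 1 + single q 1 \<in> M" using core_ind[OF pq(1)] by (intro pair_M)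
  interpret v: submodule A "vanishing p q" H by (rule vanishing_submodule[OF M])
  have vH: "\<phi> \<in> carrier H" if "\<phi> \<in> vanishing p q" for \<phi> using that v.subset by (rule subsetD[rotated])
  have "submodule A (pr ` vanishing p q) T"
  proof (rule submodule.intro)
    show "pr ` vanishing p q \<subseteq> carrier T" using pr_closed vH by (simp add: image_subset_iff)
    show "\<zero>\<^bsub>T\<^esub> \<in> pr ` vanishing p q" using imageI[OF v.zero_closed, of pr] by (simp add: pr_zero)
  next
    fix x y assume x: "x \<in> pr ` vanishing p q" and y: "y \<in> pr ` vanishing p q"
    obtain \<phi> where \<phi>: "x = pr \<phi>" "\<phi> \<in> vanishing p q" using x by (rule imageE)
    obtain \<psi> where \<psi>: "y = pr \<psi>" "\<psi> \<in> vanishing p q" using y by (rule imageE)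
    have "x \<oplus>\<^bsub>T\<^esub> y = pr (\<phi> \<oplus>\<^bsub>H\<^esub> \<psi>)" using \<phi> \<psi> vH by (simp add: pr_add)
    then show "x \<oplus>\<^bsub>T\<^esub> y \<in> pr ` vanishing p q" using v.m_closed[OF \<phi>(2) \<psi>(2)] by (rule image_eqI)
  next
    fix r x assume r: "r \<in> carrier A" and x: "x \<in> pr ` vanishing p q"
    obtain \<phi> where \<phi>: "x = pr \<phi>" "\<phi> \<in> vanishing p q" using x by (rule imageE)
    have "r \<odot>\<^bsub>T\<^esub> x = pr (r \<odot>\<^bsub>H\<^esub> \<phi>)" using \<phi> r vH by (simp add: pr_smult)
    then show "r \<odot>\<^bsub>T\<^esub> x \<in> pr ` vanishing p q" using v.smult_closed[OF r \<phi>(2)] by (rule image_eqI)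
  qed (rule T_module)
  moreover have "G \<subseteq> pr ` vanishing p q"
  proof
    fix y assume y: "y \<in> G"
    then obtain e where e: "y = pr (gen e)" "e \<in> E" using sub by (meson imageE psubsetD)
    have "(\<lambda>(p, q). {p, q}) e \<noteq> {p, q}"
      using pr_gen_eq_iff[OF e(2) pq(1)] y pq(2) e(1) by auto
    then show "y \<in> pr ` vanishing p q"
      using gen_vanishing[OF pq(1) e(2)] unfolding e(1) by (intro imageI)
  qed
  ultimately have "T.span G \<subseteq> pr ` vanishing p q" by (rule T.span_is_subset[rotated])
  then have "carrier T \<subseteq> pr ` vanishing p q" unfolding span .
  then have "pr (gen (p, q)) \<in> pr ` vanishing p q"
    using pr_closed[OF gen_closed[OF pq(1)]] by (rule subsetD)
  then obtain \<psi> where "pr (gen (p, q)) = pr \<psi>" "\<psi> \<in> vanishing p q" by (rule imageE)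
  then have "gen (p, q) \<in> vanishing p q"
    using pr_eq_vanishing[OF gen_closed[OF pq(1)]] core_ind[OF pq(1)] by simp
  with gen_not_vanishing[OF pq(1)] show False by simp
qed

theorem generators:
  "\<exists>G. minimal_generating_set A T G \<and> (\<forall>g\<in>G. \<exists>c. g \<in> carrier (T1_graded V I c)) \<and>
     (\<exists>h. bij_betw h {{p, q} | p q. p \<in> V \<and> q \<in> V \<and> cr p q} G)"
proof (intro exI conjI)
  show "minimal_generating_set A T ((\<lambda>e. pr (gen e)) ` E)" by (rule minimal_generating_set_gen)
  show "\<forall>g\<in>(\<lambda>e. pr (gen e)) ` E. \<exists>c. g \<in> carrier (T1_graded V I c)"
    using gen_graded by (simp only: ball_simps(9)) simp
  have "{{p, q} | p q. p \<in> V \<and> q \<in> V \<and> cr p q} = (\<lambda>(p, q). {p, q}) ` E"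
    unfolding E_def by auto
  \<comment> \<open>\<open>inv_into\<close> picks one of the two orders of each pair; by
    \<open>pr_gen_eq_iff\<close> both give the same class.\<close>
  then show "bij_betw (\<lambda>b. pr (gen (inv_into E (\<lambda>(p, q). {p, q}) b)))
      {{p, q} | p q. p \<in> V \<and> q \<in> V \<and> cr p q} ((\<lambda>e. pr (gen e)) ` E)"
    using bij_betw_quotients[OF pr_gen_eq_iff] by simp
qed

end

end

section \<open>Diagonals of a polygon\<close>

lemma crossing_iff:
  assumes "i < k" "j < l"
  shows "crossing {i, k} {j, l} \<longleftrightarrow> i < j \<and> j < k \<and> k < l \<or> j < i \<and> i < l \<and> l < k"
proof
  assume "crossing {i, k} {j, l}"
  then obtain i' j' k' l' where *: "i' < j'" "j' < k'" "k' < l'" "{{i, k}, {j, l}} = {{i', k'}, {j', l'}}"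
    unfolding crossing_def by blast
  then have "({i, k} = {i', k'} \<and> {j, l} = {j', l'}) \<or> ({i, k} = {j', l'} \<and> {j, l} = {i', k'})"
    by (simp only: doubleton_eq_iff)
  with * assms show "i < j \<and> j < k \<and> k < l \<or> j < i \<and> i < l \<and> l < k"
    by (auto simp: doubleton_eq_iff)
next
  assume "i < j \<and> j < k \<and> k < l \<or> j < i \<and> i < l \<and> l < k"
  then show "crossing {i, k} {j, l}"
  proof
    assume "j < i \<and> i < l \<and> l < k"
    then show ?thesis unfolding crossing_def
      by (intro exI[of _ j] exI[of _ i] exI[of _ l] exI[of _ k]) (simp add: insert_commute)
  qed (auto simp: crossing_def)
qed

lemma crossing_sym: "crossing d e \<Longrightarrow> crossing e d"
  unfolding crossing_def by (metis insert_commute)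

lemma crossing_irrefl: "\<not> crossing d d"
  unfolding crossing_def by (auto simp: doubleton_eq_iff)

lemma diagonal_iff:
  "i < j \<Longrightarrow> {i, j} \<in> diagonals n \<longleftrightarrow> 1 \<le> i \<and> j \<le> n \<and> j \<noteq> i + 1 \<and> \<not> (i = 1 \<and> j = n)"
  unfolding diagonals_def by (auto simp: doubleton_eq_iff)

lemma diagonalE:
  assumes "d \<in> diagonals n"
  obtains i j where "d = {i, j}" "i < j" "1 \<le> i" "j \<le> n" "j \<noteq> i + 1" "\<not> (i = 1 \<and> j = n)"
  using assms unfolding diagonals_def by blast

lemma finite_diagonals: "finite (diagonals n)"
  by (rule finite_subset[of _ "Pow {1..n}"]) (auto simp: diagonals_def)

text \<open>An edge of the n-gon is crossed by no diagonal. This disposes of those sides of a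
  quadrangle that happen to be edges.\<close>

lemma crossing_is_diagonal:
  assumes "crossing {i, j} d" "d \<in> diagonals n" "1 \<le> i" "i < j" "j \<le> n"
  shows "{i, j} \<in> diagonals n"
proof -
  obtain r s where d: "d = {r, s}" "r < s" "1 \<le> r" "s \<le> n" using assms(2) by (rule diagonalE)
  then show ?thesis using assms by (auto simp: crossing_iff diagonal_iff)
qed

text \<open>One end of the chord lies strictly beyond the side. Wherever the other end lies outside
  that arc, one of the two diagonals separates the ends.\<close>

lemma crossing_quad_side:
  assumes "a < c" "c < b" "b < d" "x < y" "crossing {x, y} {c, b} \<or> crossing {x, y} {a, c}"
  shows "crossing {x, y} {a, b} \<or> crossing {x, y} {c, d}"
  using assms by (simp add: crossing_iff) linarith

lemma crossing_connected:
  assumes "p \<in> diagonals n" "w \<in> diagonals n" "w' \<in> diagonals n"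
    and cr: "crossing w p" "crossing w' p" "crossing w w'"
  shows "\<exists>w''\<in>diagonals n. crossing w'' p \<and> \<not> crossing w w'' \<and> \<not> crossing w' w'' \<and>
    (\<forall>d\<in>diagonals n. crossing d w'' \<longrightarrow> crossing d w \<or> crossing d w')"
proof -
  obtain i k where p: "p = {i, k}" "i < k" "1 \<le> i" "k \<le> n" using assms(1) by (rule diagonalE)
  have *: "\<exists>w''\<in>diagonals n. crossing w'' p \<and> \<not> crossing {a, b} w'' \<and> \<not> crossing {c, d} w'' \<and>
      (\<forall>e\<in>diagonals n. crossing e w'' \<longrightarrow> crossing e {a, b} \<or> crossing e {c, d})"
    if o: "a < c" "c < b" "b < d" "1 \<le> a" "d \<le> n" and cr: "crossing {a, b} p" "crossing {c, d} p" for a b c d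
  proof -
    \<comment> \<open>\<open>p\<close> strictly separates \<open>a\<close> from \<open>b\<close>,
      and \<open>c\<close> is not on \<open>p\<close>; so it also separates \<open>c\<close> from
      \<open>b\<close> or from \<open>a\<close>, depending on the side of \<open>c\<close>.\<close>
    have "crossing {c, b} p \<or> crossing {a, c} p"
      using cr o p(2) unfolding p(1) by (simp add: crossing_iff) linarith
    then obtain v w where vw: "v < w" "1 \<le> v" "w \<le> n" "crossing {v, w} p" "{v, w} = {c, b} \<or> {v, w} = {a, c}"
      using o by (metis less_imp_le_nat less_le_trans order_trans)
    have "{v, w} \<in> diagonals n" using vw(4) assms(1) vw(2,1,3) by (rule crossing_is_diagonal)
    moreover have "\<not> crossing {a, b} {v, w}" "\<not> crossing {c, d} {v, w}"
      using vw(5) o by (auto simp: crossing_iff)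
    moreover have "crossing e {a, b} \<or> crossing e {c, d}" if e: "e \<in> diagonals n" "crossing e {v, w}" for e
    proof -
      obtain x y where xy: "e = {x, y}" "x < y" using e(1) by (rule diagonalE)
      have "crossing {x, y} {c, b} \<or> crossing {x, y} {a, c}" using e(2) vw(5) unfolding xy(1) by metis
      then show ?thesis unfolding xy(1) by (rule crossing_quad_side[OF o(1-3) xy(2)])
    qed
    ultimately show ?thesis using vw(4) by blast
  qed
  obtain a b where w: "w = {a, b}" "a < b" "1 \<le> a" "b \<le> n" using assms(2) by (rule diagonalE)
  obtain c d where w': "w' = {c, d}" "c < d" "1 \<le> c" "d \<le> n" using assms(3) by (rule diagonalE)
  have "a < c \<and> c < b \<and> b < d \<or> c < a \<and> a < d \<and> d < b"
    using cr(3) w w' by (simp add: crossing_iff)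
  then show ?thesis
  proof
    assume "a < c \<and> c < b \<and> b < d"
    then show ?thesis using *[of a c b d] cr w w' by simp
  next
    assume "c < a \<and> a < d \<and> d < b"
    then show ?thesis using *[of c a d b] cr w w' by (simp add: conj_commute disj_commute) metis
  qed
qed

lemma flag_ideal_diagonals: "flag_ideal (diagonals n) crossing"
  by unfold_locales (rule finite_diagonals crossing_sym crossing_irrefl crossing_connected; assumption?)+

section \<open>Good sets contain the sides of their quadrangle\<close>

abbreviation "good n \<equiv> flag_ideal.good (diagonals n) crossing"

lemmas good_def = flag_ideal.good_def[OF flag_ideal_diagonals]

text \<open>\<open>t\<close> is the far end of the longest chord from \<open>x\<close> in the
  interval, or \<open>x + 1\<close> if no chord from \<open>x\<close> spans more than one step. A
  chord over \<open>t\<close> would either start at \<open>x\<close> and be longer, or start later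
  and cross the chord from \<open>x\<close> to \<open>t\<close>.\<close>

lemma gap_point:
  fixes R :: "nat \<Rightarrow> nat \<Rightarrow> bool"
  assumes noncr: "\<And>r s r' s'. R r s \<Longrightarrow> R r' s' \<Longrightarrow> r < r' \<Longrightarrow> r' < s \<Longrightarrow> \<not> s < s'"
    and "\<not> R x y" "x + 1 < y"
  obtains t where "x < t" "t < y" "\<And>r s. R r s \<Longrightarrow> x \<le> r \<Longrightarrow> s \<le> y \<Longrightarrow> \<not> (r < t \<and> t < s)"
proof -
  define S where "S = {s. R x s \<and> s \<le> y \<and> x + 1 < s}"
  have "S \<subseteq> {..y}" by (auto simp: S_def)
  then have fin: "finite S" by (rule finite_subset) simp
  define t where "t = (if S = {} then x + 1 else Max S)"
  have mem: "t \<in> S" if "S \<noteq> {}" using Max_in[OF fin that] that by (simp add: t_def)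
  have le: "s \<le> t" if "s \<in> S" for s using Max_ge[OF fin that] that by (auto simp: t_def)
  have t: "x < t \<and> t < y"
  proof (cases "S = {}")
    case True
    then show ?thesis using assms(3) by (simp add: t_def)
  next
    case False
    then have "R x t" "t \<le> y" "x + 1 < t" using mem by (auto simp: S_def)
    then show ?thesis using assms(2) by (cases "t = y") auto
  qed
  have "\<not> (r < t \<and> t < s)" if rs: "R r s" "x \<le> r" "s \<le> y" for r s
  proof
    assume o: "r < t \<and> t < s"
    show False
    proof (cases "r = x")
      case True
      then have "s \<in> S" using rs o t by (auto simp: S_def)
      then show False using le o by fastforce
    next
      case False
      then have "S \<noteq> {}" using rs o by (auto simp: t_def)
      then have "R x t" using mem by (auto simp: S_def)
      then show False using noncr[of x t r s] rs o False by auto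
    qed
  qed
  with t that show ?thesis by blast
qed

text \<open>For a crossing pair these are the sides of the quadrangle that are not edges of the
  n-gon, described without naming its vertices.\<close>

definition core :: "nat \<Rightarrow> nat set \<Rightarrow> nat set \<Rightarrow> nat set set" where
  "core n p q = {d \<in> diagonals n. d \<subseteq> p \<union> q \<and> d \<noteq> p \<and> d \<noteq> q}"

lemma core_sym: "core n p q = core n q p"
  by (auto simp: core_def)

lemma good_face: "good n a p q \<Longrightarrow> d \<in> a \<Longrightarrow> e \<in> a \<Longrightarrow> \<not> crossing d e"
  by (simp add: good_def)

text \<open>A member \<open>d\<close> of \<open>a\<close> is itself compatible with
  \<open>a\<close>, so the condition for further diagonals can be applied to
  \<open>d\<close>.\<close>

lemma good_noncrossing:
  assumes "good n a p q" "a \<subseteq> diagonals n" "d \<in> a"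
  shows "\<not> crossing d p" "\<not> crossing d q"
proof -
  have "d \<in> diagonals n" "d \<noteq> p" "d \<noteq> q" "\<forall>e\<in>a. \<not> crossing e d"
    using assms by (auto simp: good_def)
  then show "\<not> crossing d p" "\<not> crossing d q"
    using assms(1) unfolding good_def by blast+
qed

context
  fixes n i j k l :: nat
  assumes ord: "1 \<le> i" "i < j" "j < k" "k < l" "l \<le> n"
begin

lemma pq_diagonals: "{i, k} \<in> diagonals n" "{j, l} \<in> diagonals n"
  using ord by (auto simp: diagonal_iff)

lemma core_eq: "core n {i, k} {j, l} = {{i, j}, {j, k}, {k, l}, {i, l}} \<inter> diagonals n"
proof (intro equalityI subsetI)
  fix d assume d: "d \<in> core n {i, k} {j, l}"
  then have dn: "d \<in> diagonals n" by (simp add: core_def)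
  then obtain r s where rs: "d = {r, s}" "r < s" by (rule diagonalE)
  then have "r \<in> {i, j, k, l}" "s \<in> {i, j, k, l}" "{r, s} \<noteq> {i, k}" "{r, s} \<noteq> {j, l}"
    using d by (auto simp: core_def)
  then have "{r, s} \<in> {{i, j}, {j, k}, {k, l}, {i, l}}"
    using rs(2) ord by (elim insertE emptyE) simp_all
  with dn show "d \<in> {{i, j}, {j, k}, {k, l}, {i, l}} \<inter> diagonals n"
    unfolding rs(1) by (rule IntI[rotated])
qed (use ord in \<open>auto simp: core_def doubleton_eq_iff\<close>)

lemma good_core: "good n (core n {i, k} {j, l}) {i, k} {j, l}"
  unfolding good_def
proof (intro conjI ballI impI)
  fix d e assume "d \<in> core n {i, k} {j, l}" "e \<in> core n {i, k} {j, l}"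
  then show "\<not> crossing d e"
    unfolding core_eq using ord by (auto simp: crossing_iff)
next
  \<comment> \<open>A chord that crosses a diagonal of the quadrangle and is not its other diagonal
    has an end off the quadrangle, hence leaves it through a side.\<close>
  have *: "crossing {r, s} {i, j} \<or> crossing {r, s} {j, k} \<or> crossing {r, s} {k, l} \<or> crossing {r, s} {i, l}"
    if "r < s" "crossing {r, s} {i, k} \<or> crossing {r, s} {j, l}" "\<not> (r = i \<and> s = k)" "\<not> (r = j \<and> s = l)" for r s
    using that ord unfolding crossing_iff[OF that(1) ord(2)] crossing_iff[OF that(1) ord(3)] crossing_iff[OF that(1) ord(4)]
      crossing_iff[OF that(1) less_trans[OF ord(2,3)]] crossing_iff[OF that(1) less_trans[OF ord(3,4)]]
      crossing_iff[OF that(1) less_trans[OF ord(2) less_trans[OF ord(3,4)]]]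
    by - (cases "r < i"; cases "r < j"; cases "r < k"; cases "r < l"; simp; linarith?)
  fix w assume w: "w \<in> diagonals n" "w \<noteq> {i, k}" "w \<noteq> {j, l}" "\<forall>d\<in>core n {i, k} {j, l}. \<not> crossing d w"
  obtain r s where rs: "w = {r, s}" "r < s" using w(1) by (rule diagonalE)
  have side: "\<not> crossing w {x, y}" if "{x, y} \<in> {{i, j}, {j, k}, {k, l}, {i, l}}" "1 \<le> x" "x < y" "y \<le> n" for x y
  proof
    assume "crossing w {x, y}"
    then have cr: "crossing {x, y} w" by (rule crossing_sym)
    then have "{x, y} \<in> core n {i, k} {j, l}"
      unfolding core_eq using crossing_is_diagonal[OF cr w(1)] that by blast
    with w(4) cr show False by blast
  qed
  have "\<not> (crossing w {i, k} \<or> crossing w {j, l})"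
  proof
    assume "crossing w {i, k} \<or> crossing w {j, l}"
    moreover have "\<not> (r = i \<and> s = k)" "\<not> (r = j \<and> s = l)" using w(2,3) rs(1) by auto
    ultimately have "crossing w {i, j} \<or> crossing w {j, k} \<or> crossing w {k, l} \<or> crossing w {i, l}"
      using *[OF rs(2)] unfolding rs(1) by blast
    then show False using side[of i j] side[of j k] side[of k l] side[of i l] ord by auto
  qed
  then show "\<not> crossing w {i, k}" "\<not> crossing w {j, l}" by auto
qed (auto simp: core_def)

context
  fixes a
  assumes a: "a \<subseteq> diagonals n" and good_a: "good n a {i, k} {j, l}"
begin

lemma pair_noncr:
  assumes "{r, s} \<in> a" "r < s"
  shows "\<not> (r < i \<and> i < s \<and> s < k)" "\<not> (i < r \<and> r < k \<and> k < s)"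
    "\<not> (r < j \<and> j < s \<and> s < l)" "\<not> (j < r \<and> r < l \<and> l < s)"
  using good_noncrossing[OF good_a a assms(1)] assms(2) ord by (auto simp: crossing_iff)

lemma pair_noncr': "{r, s} \<in> a \<Longrightarrow> {r', s'} \<in> a \<Longrightarrow> r < r' \<Longrightarrow> r' < s \<Longrightarrow> \<not> s < s'"
  using good_a crossing_iff[of r s r' s'] unfolding good_def by auto

text \<open>If a point \<open>t\<close> outside the quadrangle can be joined to one of its vertices \<open>v\<close> without crossing \<open>a\<close>,
  then \<open>{t, v}\<close> contradicts goodness as soon as it crosses a diagonal of the quadrangle.\<close>

lemma good_contradiction:
  assumes "w \<in> diagonals n" "w \<noteq> {i, k}" "w \<noteq> {j, l}" "crossing w {i, k} \<or> crossing w {j, l}"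
    and "w = {u, v}" "u < v" "\<And>r s. {r, s} \<in> a \<Longrightarrow> r < s \<Longrightarrow> \<not> crossing {r, s} {u, v}"
  shows False
proof -
  have "\<not> crossing d w" if "d \<in> a" for d
  proof -
    have "d \<in> diagonals n" using a \<open>d \<in> a\<close> by (rule subsetD)
    then obtain r s where "d = {r, s}" "r < s" by (rule diagonalE)
    with assms(5-7) that show ?thesis by simp
  qed
  with good_a assms(1-4) show False unfolding good_def by blast
qed

text \<open>Otherwise \<open>gap_point\<close> gives a vertex \<open>t\<close> over which no member
  of \<open>a\<close> inside the arc passes. The chord from \<open>t\<close> to \<open>k\<close>
  crosses \<open>{j, l}\<close>; a member of \<open>a\<close> crossing this chord would pass over
  \<open>t\<close> within the arc or cross a diagonal of the quadrangle.\<close>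

lemma side_ij: 
  assumes "j \<noteq> i + 1"
  shows "{i, j} \<in> a"
proof (rule ccontr)
  assume "{i, j} \<notin> a"
  moreover have "i + 1 < j" using ord assms by simp
  ultimately obtain t where t: "i < t" "t < j" "\<And>r s. {r, s} \<in> a \<Longrightarrow> i \<le> r \<Longrightarrow> s \<le> j \<Longrightarrow> \<not> (r < t \<and> t < s)"
    using gap_point[of "\<lambda>r s. {r, s} \<in> a" i j] pair_noncr' by metis
  show False
  proof (rule good_contradiction[of "{t, k}" t k])
    fix r s assume rs: "{r, s} \<in> a" "r < s"
    show "\<not> crossing {r, s} {t, k}"
    proof
      assume "crossing {r, s} {t, k}"
      then consider "r < t" "t < s" "s < k" | "t < r" "r < k" "k < s"
        using rs t(1,2) ord by (auto simp: crossing_iff)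
      then show False
      proof cases
        case 1
        have "i \<le> r" "s \<le> j" using pair_noncr[OF rs] 1 t(1,2) ord by linarith+
        then show ?thesis using t(3)[OF rs(1)] 1 t(1,2) by linarith
      next
        case 2
        then show ?thesis using pair_noncr[OF rs] t(1,2) ord by linarith
      qed
    qed
  qed (use t(1,2) ord in \<open>auto simp: diagonal_iff crossing_iff doubleton_eq_iff\<close>)
qed

lemma side_jk:
  assumes "k \<noteq> j + 1"
  shows "{j, k} \<in> a"
proof (rule ccontr)
  assume "{j, k} \<notin> a"
  moreover have "j + 1 < k" using ord assms by simp
  ultimately obtain t where t: "j < t" "t < k" "\<And>r s. {r, s} \<in> a \<Longrightarrow> j \<le> r \<Longrightarrow> s \<le> k \<Longrightarrow> \<not> (r < t \<and> t < s)"
    using gap_point[of "\<lambda>r s. {r, s} \<in> a" j k] pair_noncr' by metis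
  show False
  proof (rule good_contradiction[of "{t, l}" t l])
    fix r s assume rs: "{r, s} \<in> a" "r < s"
    show "\<not> crossing {r, s} {t, l}"
    proof
      assume "crossing {r, s} {t, l}"
      then consider "r < t" "t < s" "s < l" | "t < r" "r < l" "l < s"
        using rs t(1,2) ord by (auto simp: crossing_iff)
      then show False
      proof cases
        case 1
        have "j \<le> r" "s \<le> k" using pair_noncr[OF rs] 1 t(1,2) ord by linarith+
        then show ?thesis using t(3)[OF rs(1)] 1 t(1,2) by linarith
      next
        case 2
        then show ?thesis using pair_noncr[OF rs] t(1,2) ord by linarith
      qed
    qed
  qed (use t(1,2) ord in \<open>auto simp: diagonal_iff crossing_iff doubleton_eq_iff\<close>)
qed

lemma side_kl:
  assumes "l \<noteq> k + 1"
  shows "{k, l} \<in> a"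
proof (rule ccontr)
  assume "{k, l} \<notin> a"
  moreover have "k + 1 < l" using ord assms by simp
  ultimately obtain t where t: "k < t" "t < l" "\<And>r s. {r, s} \<in> a \<Longrightarrow> k \<le> r \<Longrightarrow> s \<le> l \<Longrightarrow> \<not> (r < t \<and> t < s)"
    using gap_point[of "\<lambda>r s. {r, s} \<in> a" k l] pair_noncr' by metis
  show False
  proof (rule good_contradiction[of "{i, t}" i t])
    fix r s assume rs: "{r, s} \<in> a" "r < s"
    show "\<not> crossing {r, s} {i, t}"
    proof
      assume "crossing {r, s} {i, t}"
      then consider "r < i" "i < s" "s < t" | "i < r" "r < t" "t < s"
        using rs t(1,2) ord by (auto simp: crossing_iff)
      then show False
      proof cases
        case 1
        then show ?thesis using pair_noncr[OF rs] t(1,2) ord by linarith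
      next
        case 2
        have "k \<le> r" "s \<le> l" using pair_noncr[OF rs] 2 t(1,2) ord by linarith+
        then show ?thesis using t(3)[OF rs(1)] 2 t(1,2) by linarith
      qed
    qed
  qed (use t(1,2) ord in \<open>auto simp: diagonal_iff crossing_iff doubleton_eq_iff\<close>)
qed

lemma side_il:
  assumes "\<not> (i = 1 \<and> l = n)"
  shows "{i, l} \<in> a"
proof (rule ccontr)
  assume nil: "{i, l} \<notin> a"
  \<comment> \<open>The vertices from \<open>l\<close> through \<open>n\<close> and \<open>1\<close> up to \<open>i\<close>, renumbered from \<open>0\<close>.\<close>
  define f where "f u = (if u + l \<le> n then u + l else u + l - n)" for u
  define y where "y = n + i - l"
  define R where "R u v \<longleftrightarrow> u < v \<and> v \<le> y \<and> {f u, f v} \<in> a" for u v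
  have f0: "f 0 = l" "f y = i" using ord by (auto simp: f_def y_def)
  have noncr: "\<not> s < s'" if "R r s" "R r' s'" "r < r'" "r' < s" for r s r' s'
  proof
    assume "s < s'"
    then have "crossing {f r, f s} {f r', f s'}"
    proof -
      have "s' \<le> n + i - l" using that by (simp add: R_def y_def)
      then have s'y: "s' + l \<le> n + i" using ord by linarith
      \<comment> \<open>The renumbering is a rotation and preserves crossings; the cases record how
        many of \<open>r < r' < s < s'\<close> lie past the jump from \<open>n\<close> to 1.\<close>
      consider "s' + l \<le> n" | "s' + l > n" "s + l \<le> n" | "s + l > n" "r' + l \<le> n"
        | "r' + l > n" "r + l \<le> n" | "r + l > n" by linarith
      then show ?thesis
      proof cases
        case 1
        then show ?thesis using that \<open>s < s'\<close> by (simp add: f_def crossing_iff)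
      next
        case 2
        then show ?thesis using that \<open>s < s'\<close> s'y ord
          by (simp add: f_def insert_commute[of "r' + l"] crossing_iff)
      next
        case 3
        then have "s + l - n < s' + l - n" "s' + l - n < r + l" using \<open>s < s'\<close> s'y ord by linarith+
        then show ?thesis using 3 that \<open>s < s'\<close> s'y ord
          by (simp add: f_def insert_commute[of "r' + l"] insert_commute[of "r + l"] crossing_iff)
      next
        case 4
        then have "r' + l - n < s + l - n" "s + l - n < s' + l - n" "s' + l - n < r + l"
          using that \<open>s < s'\<close> s'y ord by linarith+
        then show ?thesis using 4 that \<open>s < s'\<close>
          by (simp add: f_def insert_commute[of "r + l"] crossing_iff)
      next
        case 5
        then have "r + l - n < r' + l - n" "r' + l - n < s + l - n" "s + l - n < s' + l - n"
          using that \<open>s < s'\<close> by linarith+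
        then show ?thesis using 5 that \<open>s < s'\<close> s'y ord by (simp add: f_def crossing_iff)
      qed
    qed
    moreover have "{f r, f s} \<in> a" "{f r', f s'} \<in> a" using that(1,2) by (simp_all add: R_def)
    ultimately show False using good_face[OF good_a] by metis
  qed
  have "\<not> R 0 y" using nil f0 by (simp add: R_def insert_commute)
  moreover have "0 + 1 < y" using assms ord by (auto simp: y_def)
  ultimately obtain t where t: "0 < t" "t < y" "\<And>r s. R r s \<Longrightarrow> 0 \<le> r \<Longrightarrow> s \<le> y \<Longrightarrow> \<not> (r < t \<and> t < s)"
    using gap_point[of R 0 y] noncr by metis
  have gap: "\<not> (r < t \<and> t < s)" if "{f r, f s} \<in> a" "r < s" "s \<le> y" for r s
    using t(3)[of r s] that by (simp add: R_def)
  show False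
  \<comment> \<open>In the original numbering the gap vertex \<open>u\<close> lies above
    \<open>l\<close> or below \<open>i\<close>; in both cases it is joined to \<open>j\<close>, and
    this chord crosses \<open>{i, k}\<close>.\<close>
  proof (cases "t + l \<le> n")
    case True
    define u where "u = t + l"
    have u: "l < u" "u \<le> n" using t True by (auto simp: u_def)
    show False
    proof (rule good_contradiction[of "{j, u}" j u])
      fix r s assume rs: "{r, s} \<in> a" "r < s"
      have bounds: "1 \<le> r" "s \<le> n" using a rs by (auto simp: diagonal_iff dest!: subsetD)
      show "\<not> crossing {r, s} {j, u}"
      proof
        assume "crossing {r, s} {j, u}"
        then consider "r < j" "j < s" "s < u" | "j < r" "r < u" "u < s"
          using rs u ord by (auto simp: crossing_iff)
        then show False
        proof cases
          case 1
          then have "l \<le> s" using pair_noncr(3)[OF rs] by linarith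
          then have "r \<le> i" using pair_noncr(2)[OF rs] 1 ord by linarith
          \<comment> \<open>The chord spans the jump from \<open>n\<close> to 1, so its larger end
            \<open>s\<close> comes first after renumbering.\<close>
          then have "{f (s - l), f (r + n - l)} \<in> a"
            using rs bounds ord \<open>l \<le> s\<close> \<open>r \<le> i\<close> by (simp add: f_def insert_commute)
          moreover have "s - l < t" "t < r + n - l" "r + n - l \<le> y"
            using \<open>l \<le> s\<close> \<open>r \<le> i\<close> 1 bounds ord u by (auto simp: u_def y_def)
          ultimately show False using gap[of "s - l" "r + n - l"] by linarith
        next
          case 2
          then have "l \<le> r" using pair_noncr(4)[OF rs] u by linarith
          then have "{f (r - l), f (s - l)} \<in> a"
            using rs bounds by (simp add: f_def)
          moreover have "r - l < t" "t < s - l" "s - l \<le> y"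
            using \<open>l \<le> r\<close> 2 bounds ord u by (auto simp: u_def y_def)
          ultimately show False using gap[of "r - l" "s - l"] by linarith
        qed
      qed
    qed (use u ord in \<open>auto simp: diagonal_iff crossing_iff doubleton_eq_iff\<close>)
  next
    case False
    define u where "u = t + l - n"
    have u: "1 \<le> u" "u < i" using t False ord by (auto simp: u_def y_def)
    show False
    proof (rule good_contradiction[of "{u, j}" u j])
      fix r s assume rs: "{r, s} \<in> a" "r < s"
      have bounds: "1 \<le> r" "s \<le> n" using a rs by (auto simp: diagonal_iff dest!: subsetD)
      show "\<not> crossing {r, s} {u, j}"
      proof
        assume "crossing {r, s} {u, j}"
        then consider "r < u" "u < s" "s < j" | "u < r" "r < j" "j < s"
          using rs u ord by (auto simp: crossing_iff)
        then show False
        proof cases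
          case 1
          then have "s \<le> i" using pair_noncr(1)[OF rs] u ord by linarith
          then have "{f (r + n - l), f (s + n - l)} \<in> a"
            using rs bounds ord by (simp add: f_def)
          moreover have "r + n - l < t" "t < s + n - l" "s + n - l \<le> y"
            using \<open>s \<le> i\<close> 1 bounds ord u False by (auto simp: u_def y_def)
          ultimately show False using gap[of "r + n - l" "s + n - l"] by linarith
        next
          case 2
          then have "l \<le> s" using pair_noncr(3)[OF rs] by linarith
          then have "r \<le> i" using pair_noncr(2)[OF rs] 2 ord by linarith
          then have "{f (s - l), f (r + n - l)} \<in> a"
            using rs bounds ord \<open>l \<le> s\<close> \<open>r \<le> i\<close> by (simp add: f_def insert_commute)
          moreover have "s - l < t" "t < r + n - l" "r + n - l \<le> y"
            using \<open>l \<le> s\<close> \<open>r \<le> i\<close> 2 bounds ord u False by (auto simp: u_def y_def)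
          ultimately show False using gap[of "s - l" "r + n - l"] by linarith
        qed
      qed
    qed (use u ord in \<open>auto simp: diagonal_iff crossing_iff doubleton_eq_iff\<close>)
  qed
qed

lemma core_subset: "core n {i, k} {j, l} \<subseteq> a"
proof
  fix d assume d: "d \<in> core n {i, k} {j, l}"
  then have "d \<in> diagonals n" "d \<in> {{i, j}, {j, k}, {k, l}, {i, l}}" unfolding core_eq by auto
  then show "d \<in> a"
    using side_ij side_jk side_kl side_il ord diagonal_iff[of _ _ n] by auto
qed

end

end

section \<open>Faces, links and the pieces of a dissection\<close>

lemma face_iff: "a \<in> dissection_complex n \<longleftrightarrow> a \<subseteq> diagonals n \<and> (\<forall>d\<in>a. \<forall>e\<in>a. \<not> crossing d e)"
  by (simp add: dissection_complex_def)

lemma vertices_subset: "vertices (dissection_complex n) \<subseteq> diagonals n"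
  by (auto simp: vertices_def face_iff)

lemma link_vertexI:
  assumes "a \<in> dissection_complex n" "p \<in> diagonals n" "p \<notin> a" "\<And>d. d \<in> a \<Longrightarrow> \<not> crossing d p"
  shows "p \<in> vertices (link a (dissection_complex n))"
proof -
  have "\<not> crossing p d" if "d \<in> a" for d using assms(4)[OF that] crossing_sym by blast
  then have "{p} \<in> link a (dissection_complex n)"
    using assms crossing_irrefl by (auto simp: link_def face_iff)
  then show ?thesis by (auto simp: vertices_def)
qed

lemma sides_pair: "r < s \<Longrightarrow> sides n {r, s} = {{r..s}, {1..r} \<union> {s..n}}"
  by (simp add: sides_def)

context
  fixes n i j k l :: nat and a :: "nat set set"
  assumes ord: "1 \<le> i" "i < j" "j < k" "k < l" "l \<le> n"
    and a: "a \<in> dissection_complex n"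
begin

text \<open>If both ends of \<open>w\<close> are vertices of the quadrangle, \<open>w\<close> is a
  side. Otherwise some \<open>d\<close> in \<open>a\<close> cuts an end of \<open>w\<close> off from
  the quadrangle; not crossing \<open>d\<close>, the whole of \<open>w\<close> stays beyond
  \<open>d\<close> and can at most touch the quadrangle.\<close>

lemma good_if_polygon:
  assumes polygon: "{i, j, k, l} \<in> polygons n a" and pq: "{i, k} \<notin> a" "{j, l} \<notin> a"
  shows "good n a {i, k} {j, l}"
  unfolding good_def
proof (intro conjI ballI impI pq)
  show "\<not> crossing d e" if "d \<in> a" "e \<in> a" for d e using a that by (simp add: face_iff)
  obtain s where s: "\<forall>d\<in>a. s d \<in> sides n d" "{i, j, k, l} = {1..n} \<inter> (\<Inter>d\<in>a. s d)"
    using polygon unfolding polygons_def by blast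
  fix w assume w: "w \<in> diagonals n" "w \<noteq> {i, k}" "w \<noteq> {j, l}" "\<forall>d\<in>a. \<not> crossing d w"
  obtain u v where uv: "w = {u, v}" "u < v" "1 \<le> u" "v \<le> n" using w(1) by (rule diagonalE)
  have "\<not> (crossing w {i, k} \<or> crossing w {j, l})"
  proof (cases "u \<in> {i, j, k, l} \<and> v \<in> {i, j, k, l}")
    case True
    then have "w \<in> {{i, j}, {j, k}, {k, l}, {i, l}}"
      using w(2,3) uv(2) ord unfolding uv(1) by (elim conjE insertE emptyE) simp_all
    then show ?thesis using ord by (auto simp: crossing_iff)
  next
    case False
    then obtain x where x: "x \<in> {u, v}" "x \<notin> {i, j, k, l}" by blast
    then have "x \<in> {1..n}" using uv by auto
    with x s(2) obtain d where d: "d \<in> a" "x \<notin> s d" by blast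
    have "d \<in> diagonals n" using a d(1) by (auto simp: face_iff)
    then obtain p q where pq: "d = {p, q}" "p < q" "1 \<le> p" "q \<le> n" by (rule diagonalE)
    have Q: "{i, j, k, l} \<subseteq> s d" using s(2) d(1) by blast
    have ncr: "\<not> crossing {p, q} {u, v}" using w(4) d(1) unfolding pq(1) uv(1) by blast
    have "s d = {p..q} \<or> s d = {1..p} \<union> {q..n}" using s(1) d(1) sides_pair[OF pq(2)] unfolding pq(1) by blast
    then show ?thesis
    proof
      assume sd: "s d = {p..q}"
      then have "p \<le> i" "l \<le> q" using Q by auto
      moreover have "x < p \<or> q < x" using d(2) sd by auto
      ultimately show ?thesis
        using x(1) ncr pq(2) uv(2) ord unfolding uv(1) by (auto simp: crossing_iff)
    next
      assume sd: "s d = {1..p} \<union> {q..n}"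
      then have "\<And>y. y \<in> {i, j, k, l} \<Longrightarrow> y \<le> p \<or> q \<le> y" using Q by auto
      then have "i \<le> p \<or> q \<le> i" "j \<le> p \<or> q \<le> j" "k \<le> p \<or> q \<le> k" "l \<le> p \<or> q \<le> l" by blast+
      moreover have "p < x" "x < q" using d(2) sd \<open>x \<in> {1..n}\<close> by auto
      then have "p \<le> u" "v \<le> q" using x(1) ncr pq(2) uv(2) by (auto simp: crossing_iff)
      ultimately show ?thesis
        using uv(2) ord unfolding uv(1) by (auto simp: crossing_iff)
    qed
  qed
  then show "\<not> crossing w {i, k}" "\<not> crossing w {j, l}" by auto
qed

text \<open>For each \<open>d\<close> in \<open>a\<close> the side containing the quadrangle is
  chosen; it exists because \<open>d\<close> neither crosses nor equals a diagonal of the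
  quadrangle. No other vertex remains, since it lies beyond a side of the quadrangle, and that side
  belongs to \<open>a\<close> by \<open>core_subset\<close>.\<close>

lemma polygon_if_good:
  assumes good_a: "good n a {i, k} {j, l}"
  shows "{i, j, k, l} \<in> polygons n a"
proof -
  let ?Q = "{i, j, k, l}"
  have a_diag: "a \<subseteq> diagonals n" using a by (simp add: face_iff)
  have core: "core n {i, k} {j, l} \<subseteq> a" using ord a_diag good_a by (rule core_subset)
  define s where "s d = (if ?Q \<subseteq> {Min d..Max d} then {Min d..Max d} else {1..Min d} \<union> {Max d..n})" for d :: "nat set"
  have s: "s {p, q} = (if p \<le> i \<and> l \<le> q then {p..q} else {1..p} \<union> {q..n})" if "p < q" for p q
    using that ord by (simp add: s_def)
  have Q: "?Q \<subseteq> s d" if d: "d \<in> a" for d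
  proof -
    have "d \<in> diagonals n" using a_diag d by (rule subsetD)
    then obtain p q where pq: "d = {p, q}" "p < q" "1 \<le> p" "q \<le> n" by (rule diagonalE)
    note nc = pair_noncr[OF ord a_diag good_a d[unfolded pq(1)] pq(2)]
    have ne: "\<not> (p = i \<and> q = k)" "\<not> (p = j \<and> q = l)" using good_a d unfolding good_def pq(1) by auto
    show ?thesis
    proof (cases "p \<le> i \<and> l \<le> q")
      case True
      then show ?thesis using ord unfolding pq(1) s[OF pq(2)] by auto
    next
      case False
      \<comment> \<open>No vertex of the quadrangle lies strictly between \<open>p\<close> and
        \<open>q\<close>, so all of them are on the complementary side.\<close>
      have "(i \<le> p \<or> q \<le> i) \<and> (j \<le> p \<or> q \<le> j) \<and> (k \<le> p \<or> q \<le> k) \<and> (l \<le> p \<or> q \<le> l)"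
      proof -
        consider "p < i" | "p = i" | "i < p" "p < k" | "k \<le> p" by linarith
        then show ?thesis
        proof cases
          case 1
          then have "q < l" using False by linarith
          then have "q \<le> j" using nc(3) 1 ord by linarith
          then have "q \<le> i" using nc(1) 1 ord by linarith
          then show ?thesis using ord by linarith
        next
          case 2
          then have "q < l" using False by linarith
          then have "q \<le> j" using nc(3) 2 ord by linarith
          then show ?thesis using 2 ord by linarith
        next
          case 3
          then have "q \<le> k" using nc(2) by linarith
          moreover from this have "j \<le> p \<or> q \<le> j" using nc(3) ord by linarith
          ultimately show ?thesis using 3 ord by linarith
        next
          case 4
          then have "l \<le> p \<or> q \<le> l" using nc(4) ord by linarith
          then show ?thesis using 4 ord by linarith
        qed
      qed
      then have "x \<le> p \<or> q \<le> x" if "x \<in> ?Q" for x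
        using that by blast
      then show ?thesis using False ord pq unfolding pq(1) s[OF pq(2)] by auto
    qed
  qed
  have out: "x \<in> ?Q" if x: "x \<in> {1..n}" "\<And>d. d \<in> a \<Longrightarrow> x \<in> s d" for x
  proof (rule ccontr)
    assume xQ: "x \<notin> ?Q"
    have side: "x \<in> s {p, q}" if "{p, q} \<in> {{i, j}, {j, k}, {k, l}, {i, l}}" "p < q" "{p, q} \<in> diagonals n" for p q
      using that x(2) core unfolding core_eq[OF ord] by blast
    consider "i < x" "x < j" | "j < x" "x < k" | "k < x" "x < l" | "x < i" | "l < x"
      using xQ by fastforce
    then show False
    proof cases
      case 1
      then show ?thesis using side[of i j] s[of i j] ord by (auto simp: diagonal_iff)
    next
      case 2
      then show ?thesis using side[of j k] s[of j k] ord by (auto simp: diagonal_iff)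
    next
      case 3
      then show ?thesis using side[of k l] s[of k l] ord by (auto simp: diagonal_iff)
    next
      case 4
      then show ?thesis using side[of i l] s[of i l] ord x(1) by (auto simp: diagonal_iff)
    next
      case 5
      then show ?thesis using side[of i l] s[of i l] ord x(1) by (auto simp: diagonal_iff)
    qed
  qed
  have "?Q = {1..n} \<inter> (\<Inter>d\<in>a. s d)"
  proof (intro equalityI subsetI)
    fix x assume "x \<in> ?Q"
    moreover have "?Q \<subseteq> {1..n}" using ord by auto
    ultimately show "x \<in> {1..n} \<inter> (\<Inter>d\<in>a. s d)" using Q by blast
  next
    fix x assume "x \<in> {1..n} \<inter> (\<Inter>d\<in>a. s d)"
    then show "x \<in> ?Q" using out by simp
  qed
  moreover have "\<forall>d\<in>a. s d \<in> sides n d" by (simp add: s_def sides_def)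
  moreover have "3 \<le> card ?Q" using ord by simp
  ultimately show ?thesis unfolding polygons_def by blast
qed

end

section \<open>Quadrangles, the defining ideal and the final statements\<close>

lemma crossing_diagonalsE:
  assumes "crossing p q" "p \<in> diagonals n" "q \<in> diagonals n"
  obtains i j k l where "1 \<le> i" "i < j" "j < k" "k < l" "l \<le> n"
    "(p = {i, k} \<and> q = {j, l}) \<or> (p = {j, l} \<and> q = {i, k})"
proof -
  obtain i j k l where o: "i < j" "j < k" "k < l" "{p, q} = {{i, k}, {j, l}}"
    using assms(1) unfolding crossing_def by blast
  then have eq: "(p = {i, k} \<and> q = {j, l}) \<or> (p = {j, l} \<and> q = {i, k})" by (simp only: doubleton_eq_iff)
  then have "{i, k} \<in> diagonals n" "{j, l} \<in> diagonals n" using assms(2,3) by auto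
  then have "1 \<le> i" "l \<le> n" using o by (auto simp: diagonal_iff)
  with that o eq show ?thesis by blast
qed

lemma sorted_quadruple_eq:
  fixes i j k l i' j' k' l' :: nat
  assumes "i < j" "j < k" "k < l" "i' < j'" "j' < k'" "k' < l'" "{i, j, k, l} = {i', j', k', l'}"
  shows "i = i' \<and> j = j' \<and> k = k' \<and> l = l'"
proof -
  have "[i, j, k, l] = [i', j', k', l']"
    using assms by (intro sorted_distinct_set_unique) auto
  then show ?thesis by simp
qed

text \<open>The increasing order of four vertices determines which of them are opposite, so the
  crossing pair is recovered from its union.\<close>

lemma bij_betw_quadrangles:
  "bij_betw Union {{p, q} | p q. p \<in> diagonals n \<and> q \<in> diagonals n \<and> crossing p q} (quadrangles n)"
    (is "bij_betw _ ?B _")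
proof -
  have B: "\<exists>i j k l. 1 \<le> i \<and> i < j \<and> j < k \<and> k < l \<and> l \<le> n \<and> b = {{i, k}, {j, l}}" if "b \<in> ?B" for b
  proof -
    obtain p q where pq: "b = {p, q}" "p \<in> diagonals n" "q \<in> diagonals n" "crossing p q" using \<open>b \<in> ?B\<close> by blast
    obtain i j k l where o: "1 \<le> i" "i < j" "j < k" "k < l" "l \<le> n"
      and eq: "(p = {i, k} \<and> q = {j, l}) \<or> (p = {j, l} \<and> q = {i, k})"
      using pq(4,2,3) by (rule crossing_diagonalsE)
    have "b = {{i, k}, {j, l}}" using eq unfolding pq(1) by (auto simp: insert_commute)
    with o show ?thesis by blast
  qed
  have U: "\<Union> {{i, k}, {j, l}} = {i, j, k, l}" for i j k l :: nat by auto
  show ?thesis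
  proof (rule bij_betw_imageI)
    show "inj_on Union ?B"
    proof (rule inj_onI)
      fix b b' assume b: "b \<in> ?B" and b': "b' \<in> ?B" and eq: "\<Union> b = \<Union> b'"
      obtain i j k l where o: "i < j" "j < k" "k < l" "b = {{i, k}, {j, l}}" using B[OF b] by blast
      obtain i' j' k' l' where o': "i' < j'" "j' < k'" "k' < l'" "b' = {{i', k'}, {j', l'}}" using B[OF b'] by blast
      have "{i, j, k, l} = {i', j', k', l'}" using eq unfolding o(4) o'(4) U .
      then show "b = b'" using sorted_quadruple_eq[OF o(1-3) o'(1-3)] o(4) o'(4) by simp
    qed
    show "Union ` ?B = quadrangles n"
    proof (intro equalityI subsetI)
      fix x assume "x \<in> Union ` ?B"
      then obtain b where b: "x = \<Union> b" "b \<in> ?B" by (rule imageE)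
      obtain i j k l where "1 \<le> i" "i < j" "j < k" "k < l" "l \<le> n" "b = {{i, k}, {j, l}}" using B[OF b(2)] by blast
      then show "x \<in> quadrangles n" unfolding b(1) quadrangles_def using U by blast
    next
      fix x assume "x \<in> quadrangles n"
      then obtain i j k l where o: "1 \<le> i" "i < j" "j < k" "k < l" "l \<le> n" and x: "x = {i, j, k, l}"
        unfolding quadrangles_def by blast
      have "crossing {i, k} {j, l}" using o by (simp add: crossing_iff)
      then have "{{i, k}, {j, l}} \<in> ?B" using pq_diagonals[OF o] by blast
      then show "x \<in> Union ` ?B" unfolding x U[symmetric] by (rule imageI)
    qed
  qed
qed

text \<open>A monomial whose support contains a crossing pair is divisible by the generator of that
  pair, because the two diagonals are distinct.\<close>

lemma ideal_n_eq: "ideal_n n = monomial_span (flag_ideal.M (diagonals n) crossing)"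
proof -
  interpret flag_ideal "diagonals n" crossing by (rule flag_ideal_diagonals)
  let ?gens = "{pvar {i, k} * pvar {j, l} | i j k l. 1 \<le> i \<and> i < j \<and> j < k \<and> k < l \<and> l \<le> n} :: nat set cpoly set"
  have gens: "?gens \<subseteq> I"
  proof
    fix f :: "nat set cpoly" assume "f \<in> ?gens"
    then obtain i j k l where o: "1 \<le> i" "i < j" "j < k" "k < l" "l \<le> n" and f: "f = pvar {i, k} * pvar {j, l}" by blast
    have "single {i, k} 1 + single {j, l} 1 \<in> M"
      using pq_diagonals[OF o] o by (intro pair_M) (simp_all add: crossing_iff)
    then show "f \<in> I" unfolding f pvar_def mult_single by (intro single_I)
  qed
  have Idl: "ideal (Idl\<^bsub>P\<^esub> ?gens) P"
    using gens I_subset by (intro P.genideal_ideal) (rule subset_trans)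
  show ?thesis
    unfolding ideal_n_def
  proof (rule equalityI)
    show "Idl\<^bsub>P\<^esub> ?gens \<subseteq> I" using ideal_I gens by (rule P.genideal_minimal)
    show "I \<subseteq> Idl\<^bsub>P\<^esub> ?gens"
    proof
      fix f assume "f \<in> I"
      then have "keys f \<subseteq> M" by (rule I_keys)
      then show "f \<in> Idl\<^bsub>P\<^esub> ?gens"
      proof (induction f rule: poly_mapping_induct_keys)
        case zero
        show ?case using additive_subgroup.zero_closed[OF ideal.axioms(1)[OF Idl]] by simp
      next
        case (add m z f)
        obtain p q where pq: "p \<in> keys m" "q \<in> keys m" "crossing p q" using add(1) unfolding M_def by blast
        have V: "keys m \<subseteq> diagonals n" using M_V[OF add(1)] .
        then have diag: "p \<in> diagonals n" "q \<in> diagonals n" using pq by auto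
        then obtain i j k l where o: "1 \<le> i" "i < j" "j < k" "k < l" "l \<le> n"
          and eq: "(p = {i, k} \<and> q = {j, l}) \<or> (p = {j, l} \<and> q = {i, k})"
          by (rule crossing_diagonalsE[OF pq(3)])
        have "pvar p * pvar q = pvar {i, k} * pvar {j, l}" using eq by (auto simp: mult.commute)
        then have "pvar p * pvar q \<in> ?gens" using o by blast
        then have gen: "pvar p * pvar q \<in> Idl\<^bsub>P\<^esub> ?gens"
          using P.genideal_self[of ?gens] gens I_subset by blast
        have "p \<noteq> q" using pq(3) cr_irrefl by auto
        then have m: "m = mpair p q + (m - mpair p q)" using pq by (intro keys_pair_minus)
        have "single m z = single (m - mpair p q) z * (pvar p * pvar q)"
          by (subst m) (simp add: pvar_def mult_single add.commute)
        moreover have "single (m - mpair p q) z \<in> carrier P"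
          using keys_minus_nat V by (intro single_carrier) (rule subset_trans)
        ultimately have "single m z \<in> Idl\<^bsub>P\<^esub> ?gens"
          using ideal.I_l_closed[OF Idl gen] by simp
        then show ?case
          using additive_subgroup.a_closed[OF ideal.axioms(1)[OF Idl] _ add.IH] by simp
      qed
    qed
  qed
qed

text \<open>The condition is translated into goodness by \<open>good_if_polygon\<close> and
  \<open>polygon_if_good\<close>; a good set for a crossing pair yields the face, link and polygon
  conditions together. If the condition fails, no good pair is left and
  \<open>homog_coboundary\<close> applies.\<close>

theorem T1_A_deg_graded:
  fixes a b :: "nat set set" and \<alpha> :: "nat set \<Rightarrow> nat"
  assumes ab: "a \<subseteq> diagonals n" "b \<subseteq> diagonals n" "a \<inter> b = {}" "{d. \<alpha> d \<noteq> 0} = a"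
  shows "if a \<in> dissection_complex n \<and> b \<subseteq> vertices (link a (dissection_complex n)) \<and>
            (\<exists>i j k l. 1 \<le> i \<and> i < j \<and> j < k \<and> k < l \<and> l \<le> n \<and>
               b = {{i, k}, {j, l}} \<and> {i, j, k, l} \<in> polygons n a)
         then has_dim (class_ring :: complex ring) (T1_A_deg n (\<lambda>d. int (\<alpha> d) - of_bool (d \<in> b))) 1
         else carrier (T1_A_deg n (\<lambda>d. int (\<alpha> d) - of_bool (d \<in> b))) = {\<zero>\<^bsub>T1_A n\<^esub>}"
proof -
  interpret flag_ideal "diagonals n" crossing by (rule flag_ideal_diagonals)
  define \<alpha>' where "\<alpha>' = Abs_poly_mapping \<alpha>"
  have "finite {d. \<alpha> d \<noteq> 0}" using ab(1) finite_diagonals unfolding ab(4) by (rule finite_subset)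
  then have lookup: "lookup \<alpha>' = \<alpha>" unfolding \<alpha>'_def by (rule lookup_Abs_poly_mapping)
  then have keys: "keys \<alpha>' = a" using ab(4) by (auto simp: in_keys_iff)
  have c: "(\<lambda>d. int (\<alpha> d) - of_bool (d \<in> b)) = (\<lambda>d. int (lookup \<alpha>' d) - int (lookup (ind b) d))"
    using ab(2) by (simp add: lookup lookup_ind fun_eq_iff)
  note defs = T1_A_deg_def T1_A_def ideal_n_eq c
  show ?thesis
  proof (split if_split, intro conjI impI)
    assume *: "a \<in> dissection_complex n \<and> b \<subseteq> vertices (link a (dissection_complex n)) \<and>
      (\<exists>i j k l. 1 \<le> i \<and> i < j \<and> j < k \<and> k < l \<and> l \<le> n \<and>
         b = {{i, k}, {j, l}} \<and> {i, j, k, l} \<in> polygons n a)"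
    from conjunct2[OF conjunct2[OF *]] obtain i j k l where
      "1 \<le> i \<and> i < j \<and> j < k \<and> k < l \<and> l \<le> n \<and> b = {{i, k}, {j, l}} \<and> {i, j, k, l} \<in> polygons n a"
      by (elim exE)
    then have o: "1 \<le> i" "i < j" "j < k" "k < l" "l \<le> n"
      and b: "b = {{i, k}, {j, l}}" "{i, j, k, l} \<in> polygons n a" by simp_all
    have "{i, k} \<notin> a" "{j, l} \<notin> a" using ab(3) b(1) by auto
    then have good_a: "good (keys \<alpha>') {i, k} {j, l}"
      unfolding keys using * by (intro good_if_polygon[OF o _ b(2)]) auto
    have "{i, k} \<noteq> {j, l}" using o by (auto simp: doubleton_eq_iff)
    then have ind: "ind b = mpair {i, k} {j, l}" unfolding b(1) by (simp add: ind_def)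
    have cr: "crossing {i, k} {j, l}" using o by (simp add: crossing_iff)
    show "has_dim class_ring (T1_A_deg n (\<lambda>d. int (\<alpha> d) - of_bool (d \<in> b))) 1"
      unfolding defs ind using pq_diagonals[OF o] cr good_a ab(1) unfolding keys[symmetric]
      by (intro T1_graded_good)
  next
    assume *: "\<not> (a \<in> dissection_complex n \<and> b \<subseteq> vertices (link a (dissection_complex n)) \<and>
      (\<exists>i j k l. 1 \<le> i \<and> i < j \<and> j < k \<and> k < l \<and> l \<le> n \<and>
         b = {{i, k}, {j, l}} \<and> {i, j, k, l} \<in> polygons n a))"
    have "\<not> good a p q" if pq: "p \<in> diagonals n" "q \<in> diagonals n" "crossing p q" "ind b = mpair p q" for p q
    proof
      assume good_a: "good a p q"
      have "keys (ind b) = {p, q}" unfolding pq(4) by (auto simp: keys_add_nat)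
      then have b: "b = {p, q}" using keys_ind[OF ab(2)] by simp
      have face: "a \<in> dissection_complex n" using good_a ab(1) by (simp add: good_def face_iff)
      have link: "p \<in> vertices (link a (dissection_complex n))" "q \<in> vertices (link a (dissection_complex n))"
        using good_a pq good_noncrossing[OF good_a ab(1)] by (auto intro!: link_vertexI[OF face] simp: good_def)
      obtain i j k l where o: "1 \<le> i" "i < j" "j < k" "k < l" "l \<le> n"
        and eq: "(p = {i, k} \<and> q = {j, l}) \<or> (p = {j, l} \<and> q = {i, k})"
        using pq(3,1,2) by (rule crossing_diagonalsE)
      have b': "b = {{i, k}, {j, l}}" using eq unfolding b by (auto simp: insert_commute)
      have "good a {i, k} {j, l}" using eq good_a good_commute by auto
      then have "{i, j, k, l} \<in> polygons n a" by (rule polygon_if_good[OF o face])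
      with o b' have quad: "\<exists>i j k l. 1 \<le> i \<and> i < j \<and> j < k \<and> k < l \<and> l \<le> n \<and>
         b = {{i, k}, {j, l}} \<and> {i, j, k, l} \<in> polygons n a"
        by (intro exI conjI)
      have "b \<subseteq> vertices (link a (dissection_complex n))" using link unfolding b by simp
      from notE[OF * conjI[OF face conjI[OF this quad]]] show False .
    qed
    then have "Hom_homog (diagonals n) I (\<lambda>d. int (lookup \<alpha>' d) - int (lookup (ind b) d)) \<subseteq> Cob"
      using ab by (intro homog_coboundary) (auto simp: keys keys_ind)
    then show "carrier (T1_A_deg n (\<lambda>d. int (\<alpha> d) - of_bool (d \<in> b))) = {\<zero>\<^bsub>T1_A n\<^esub>}"
      unfolding defs by (rule T1_graded_eq_0)
  qed
qed

theorem T1_A_generators: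
  "\<exists>G. minimal_generating_set (A_ring n) (T1_A n) G \<and>
     (\<forall>g\<in>G. \<exists>c. g \<in> carrier (T1_A_deg n c)) \<and> (\<exists>h. bij_betw h (quadrangles n) G)"
proof -
  interpret flag_ideal "diagonals n" crossing by (rule flag_ideal_diagonals)
  let ?B = "{{p, q} | p q. p \<in> diagonals n \<and> q \<in> diagonals n \<and> crossing p q}"
  have core: "core n p q \<subseteq> diagonals n \<and> good (core n p q) p q \<and>
      (\<forall>a. a \<subseteq> diagonals n \<longrightarrow> good a p q \<longrightarrow> core n p q \<subseteq> a)"
    if pq: "p \<in> diagonals n" "q \<in> diagonals n" "crossing p q" for p q
  proof -
    obtain i j k l where o: "1 \<le> i" "i < j" "j < k" "k < l" "l \<le> n"
      and eq: "(p = {i, k} \<and> q = {j, l}) \<or> (p = {j, l} \<and> q = {i, k})"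
      using pq(3,1,2) by (rule crossing_diagonalsE)
    have "good (core n {i, k} {j, l}) {i, k} {j, l}" by (rule good_core[OF o])
    moreover have "core n {i, k} {j, l} \<subseteq> a" if "a \<subseteq> diagonals n" "good a {i, k} {j, l}" for a
      using that by (rule core_subset[OF o])
    moreover have "core n p q \<subseteq> diagonals n" by (auto simp: core_def)
    ultimately show ?thesis
      using eq good_commute[of _ p q] core_sym[of n p q] by (elim disjE conjE) simp_all
  qed
  have "\<exists>G. minimal_generating_set A T G \<and> (\<forall>g\<in>G. \<exists>c. g \<in> carrier (T1_graded (diagonals n) I c)) \<and>
      (\<exists>h. bij_betw h ?B G)"
  proof (rule generators)
    fix p q assume pq: "p \<in> diagonals n" "q \<in> diagonals n" "crossing p q"
    show "core n p q \<subseteq> diagonals n" "good (core n p q) p q" using core[OF pq] by blast+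
    fix a assume "a \<subseteq> diagonals n" "good a p q"
    then show "core n p q \<subseteq> a" using core[OF pq] by blast
  next
    show "core n p q = core n q p" for p q by (rule core_sym)
  qed
  then obtain G h where G: "minimal_generating_set A T G"
    "\<forall>g\<in>G. \<exists>c. g \<in> carrier (T1_graded (diagonals n) I c)" "bij_betw h ?B G" by blast
  have "bij_betw (h \<circ> inv_into ?B Union) (quadrangles n) G"
    using bij_betw_inv_into[OF bij_betw_quadrangles] G(3) by (rule bij_betw_trans)
  with G(1,2) show ?thesis
    unfolding A_ring_def T1_A_def T1_A_deg_def ideal_n_eq by blast
qed

theorem theorem5p5:
  fixes n :: nat
  assumes "3 \<le> n"
  shows
    "(\<forall>(a :: nat set set) (b :: nat set set) (\<alpha> :: nat set \<Rightarrow> nat).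
        a \<subseteq> vertices (dissection_complex n) \<and> b \<subseteq> vertices (dissection_complex n) \<and> a \<inter> b = {} \<and>
        {d. \<alpha> d \<noteq> 0} = a \<longrightarrow>
        (if a \<in> dissection_complex n \<and> b \<subseteq> vertices (link a (dissection_complex n)) \<and>
            (\<exists>i j k l. 1 \<le> i \<and> i < j \<and> j < k \<and> k < l \<and> l \<le> n \<and>
               b = {{i, k}, {j, l}} \<and> {i, j, k, l} \<in> polygons n a)
         then has_dim (class_ring :: complex ring) (T1_A_deg n (\<lambda>d. int (\<alpha> d) - of_bool (d \<in> b))) 1
         else carrier (T1_A_deg n (\<lambda>d. int (\<alpha> d) - of_bool (d \<in> b))) = {\<zero>\<^bsub>T1_A n\<^esub>}))
     \<and> (\<exists>G. minimal_generating_set (A_ring n) (T1_A n) G \<and>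
            (\<forall>g\<in>G. \<exists>c. g \<in> carrier (T1_A_deg n c)) \<and>
            (\<exists>h. bij_betw h (quadrangles n) G))"
proof (intro conjI allI impI)
  fix a b :: "nat set set" and \<alpha> :: "nat set \<Rightarrow> nat"
  assume "a \<subseteq> vertices (dissection_complex n) \<and> b \<subseteq> vertices (dissection_complex n) \<and> a \<inter> b = {} \<and>
    {d. \<alpha> d \<noteq> 0} = a"
  then have "a \<subseteq> diagonals n" "b \<subseteq> diagonals n" "a \<inter> b = {}" "{d. \<alpha> d \<noteq> 0} = a"
    using vertices_subset[of n] by blast+
  then show "if a \<in> dissection_complex n \<and> b \<subseteq> vertices (link a (dissection_complex n)) \<and>
            (\<exists>i j k l. 1 \<le> i \<and> i < j \<and> j < k \<and> k < l \<and> l \<le> n \<and>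
               b = {{i, k}, {j, l}} \<and> {i, j, k, l} \<in> polygons n a)
         then has_dim (class_ring :: complex ring) (T1_A_deg n (\<lambda>d. int (\<alpha> d) - of_bool (d \<in> b))) 1
         else carrier (T1_A_deg n (\<lambda>d. int (\<alpha> d) - of_bool (d \<in> b))) = {\<zero>\<^bsub>T1_A n\<^esub>}"
    by (rule T1_A_deg_graded)
qed (rule T1_A_generators)

end
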